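(* Let $\mathbb{F}_q$ be a finite field with $q$ elements and let $n>1$, $1\le d<n$ be integers. If $\ell>1$ is a divisor of $q^n-1$ such that $n\geq 2d+2(|P_d|+1)\log_{q}\ell$, then there is at least one $\alpha\in\mathbb{F}_{q^n}$ of degree $n$ over $\mathbb{F}_q$ such that the number of connected components of the graph $G_d(n,q,\alpha)$ is divisible by $\ell$.
   Context: For $\alpha\in\mathbb{F}_{q^n}$ of degree $n$ over $\mathbb{F}_q$, $\Gamma_f=\mathbb{F}_q[\alpha]^*=\mathbb{F}_{q^n}^*$. A polynomial of positive degree is primary if it is a power of an irreducible polynomial. $P_d$ is the set of monic primary polynomials of degree $d$ in $\mathbb{F}_q[x]$ and $|P_d|$ its cardinality; $E_d=\{g(\alpha): g\in P_d\}$. $G_d(n,q,\alpha)$ is the directed Cayley graph with vertex set $\Gamma_f$ and edges $\beta_1\to\beta_2$ whenever $\beta_2/\beta_1\in E_d$. Its connected components are the cosets in $\Gamma_f$ of the subgroup generated by $E_d$, so their number is the index of that subgroup. *)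

theory Defs
  imports
    Complex_Main
    "HOL-Library.Cardinality"
    "Jordan_Normal_Form.Char_Poly"
    "Graph_Theory.Graph_Theory"
begin

text \<open>
  Throughout, the extension of fields \<open>F\<^sub>q \<subseteq> F\<^sub>q\<^sup>n\<close> is given by two finite field types
  \<^typ>\<open>'k\<close>, \<^typ>\<open>'l\<close> and an embedding \<open>h :: 'k \<Rightarrow> 'l\<close> (\<^locale>\<open>field_hom\<close>).
\<close>

definition eval_over :: "('k::field \<Rightarrow> 'l::field) \<Rightarrow> 'k poly \<Rightarrow> 'l \<Rightarrow> 'l" where
  "eval_over h p \<alpha> = poly (map_poly h p) \<alpha>"

definition is_min_poly :: "('k::field \<Rightarrow> 'l::field) \<Rightarrow> 'l \<Rightarrow> 'k poly \<Rightarrow> bool" where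
  "is_min_poly h \<alpha> m \<longleftrightarrow> lead_coeff m = 1 \<and> eval_over h m \<alpha> = 0 \<and>
     (\<forall>p. p \<noteq> 0 \<and> eval_over h p \<alpha> = 0 \<longrightarrow> degree m \<le> degree p)"

definition has_degree_over :: "('k::field \<Rightarrow> 'l::field) \<Rightarrow> 'l \<Rightarrow> nat \<Rightarrow> bool" where
  "has_degree_over h \<alpha> n \<longleftrightarrow> (\<exists>m. is_min_poly h \<alpha> m \<and> degree m = n)"

definition primary_poly :: "'k::field poly \<Rightarrow> bool" where
  "primary_poly p \<longleftrightarrow> degree p > 0 \<and> (\<exists>g k. irreducible g \<and> p = g ^ k)"

definition monic_primary_polys :: "nat \<Rightarrow> 'k::field poly set" where
  "monic_primary_polys d = {p. lead_coeff p = 1 \<and> primary_poly p \<and> degree p = d}"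

definition connection_set :: "('k::field \<Rightarrow> 'l::field) \<Rightarrow> nat \<Rightarrow> 'l \<Rightarrow> 'l set" where
  "connection_set h d \<alpha> = (\<lambda>g. eval_over h g \<alpha>) ` monic_primary_polys d"

text \<open>
  The vertex set is the whole multiplicative group of \<^typ>\<open>'l\<close>; it coincides with the unit group
  of \<open>F\<^sub>q[\<alpha>]\<close> when \<open>\<alpha>\<close> generates \<^typ>\<open>'l\<close> over \<^typ>\<open>'k\<close>, which is the only case used.
\<close>

definition cayley_digraph :: "('k::field \<Rightarrow> 'l::field) \<Rightarrow> nat \<Rightarrow> 'l \<Rightarrow> 'l pair_pre_digraph" where
  "cayley_digraph h d \<alpha> =
     \<lparr> pverts = {\<beta>. \<beta> \<noteq> 0},
       parcs = {(\<beta>\<^sub>1, \<beta>\<^sub>2). \<beta>\<^sub>1 \<noteq> 0 \<and> \<beta>\<^sub>2 \<noteq> 0 \<and> \<beta>\<^sub>2 / \<beta>\<^sub>1 \<in> connection_set h d \<alpha>} \<rparr>"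

lemma wf_cayley_digraph: "wf_digraph (with_proj (cayley_digraph h d \<alpha>))"
  by unfold_locales (auto simp: cayley_digraph_def)

text \<open>
  Connected components of a digraph are its maximal connected subgraphs, where \<^const>\<open>Digraph_Component.connected\<close>
  (from \<open>Graph_Theory\<close>) ignores the orientation of the arcs.
\<close>

definition connected_components :: "('a, 'b) pre_digraph \<Rightarrow> ('a, 'b) pre_digraph set" where
  "connected_components G = {H. pre_digraph.max_subgraph G Digraph_Component.connected H}"

end

theory Submission
  imports "HOL-Algebra.Algebraic_Closure_Type" "HOL-Algebra.Multiplicative_Group" Defs
begin

text \<open>
  Let \<open>Q = q ^ n\<close> and \<open>Q - 1 = l * e\<close>. If \<open>\<alpha>\<close> has degree \<open>n\<close> and every \<open>g(\<alpha>)\<close> with \<open>g\<close> monic primary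
  of degree \<open>d\<close> satisfies \<open>g(\<alpha>) ^ e = 1\<close>, then \<open>x \<mapsto> x ^ e\<close> is constant on the connected components;
  multiplication by a nonzero element permutes the components, so its \<open>l\<close> fibres have equally many.

  Such an \<open>\<alpha>\<close> is found by counting. Orthogonality of the characters of order dividing \<open>l\<close> expresses
  the number of \<open>x\<close> with \<open>g(x) ^ e = 1\<close> for all \<open>g\<close> through character sums, one for each choice of an
  exponent \<open>a\<^sub>g < l\<close> for every \<open>g\<close>. Instead of Weil's theorem, Stepanov's method bounds, for every set
  \<open>Z\<close> of \<open>l\<close>-th roots of unity, the number of \<open>x\<close> at which \<open>y = \<Prod>g ^ (e * a\<^sub>g)\<close> takes a value in \<open>Z\<close>:
  an auxiliary polynomial \<open>\<Sum>r\<^sub>a\<^sub>j * Y\<^sub>a * (X - z\<^sub>0) ^ (Q * j)\<close>, where \<open>Y\<^sub>a\<close> agrees with \<open>y ^ a\<close> as a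
  function, vanishes to order \<open>M\<close> at all these \<open>x\<close>. It is nonzero because modulo \<open>(X - z\<^sub>0) ^ Q\<close> every
  \<open>g ^ Q\<close> is the constant \<open>g(z\<^sub>0)\<close>, so that \<open>y\<close> becomes an \<open>l\<close>-th root of \<open>c / \<Prod>g ^ a\<^sub>g\<close>, and by Kummer
  theory such a root satisfies no equation of degree below \<open>l\<close> with coefficients of small degree.
\<close>

text \<open>The hypothesis on \<open>n\<close> amounts to \<open>D * W * l \<le> s\<close> with
  \<open>D = q ^ d\<close>, \<open>W = l ^ |P|\<close> and \<open>s = sqrt Q\<close>. Orthogonality
  costs a factor \<open>W\<close>, so the average error per exponent tuple, measured in units of
  \<open>s\<close>, has to stay below \<open>s / W\<close>, and \<open>s / W \<ge> D * l\<close> is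
  what is known. With multiplicity \<open>M\<close> near \<open>s / sqrt l\<close>, Stepanov's bound
  gives about \<open>sqrt l * (1 + 2 * \<kappa>^2 * D)\<close> in these units, where
  \<open>\<kappa> = 1 - 1 / l\<close>. The loss of order \<open>sqrt l\<close> is absorbed by the
  extra factor \<open>l\<close> that stems from the summand 1 in \<open>|P| + 1\<close>. The room is
  narrow for small \<open>l\<close>, so constants are tracked explicitly. Sets \<open>Z\<close> of
  values appear because bounding the excess of each value separately would cost another factor of
  about \<open>l\<close>; the bound for the joint excess over all of \<open>Z\<close> does not grow
  with \<open>card Z\<close>.\<close>

hide_const (open) Polynomials.degree Polynomials.lead_coeff UnivPoly.coeff UnivPoly.monom
  Divisibility.irreducible Coset.order Module.smult UnivPoly.eval

section \<open>Finite fields: generators, roots of unity and the Frobenius map\<close>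

lemma finite_field_power_card_minus_1:
  fixes x :: "'a::{finite,field}"
  assumes "x \<noteq> 0"
  shows "x ^ (CARD('a) - 1) = 1"
proof -
  have "bij_betw ((*) x) (UNIV - {0}) (UNIV - {0})"
    using assms by (intro bij_betw_byWitness[where f' = "\<lambda>y. y / x"]) auto
  then have "(\<Prod>y\<in>UNIV - {0}. x * y) = (\<Prod>y\<in>UNIV - {0}. y)"
    by (rule prod.reindex_bij_betw)
  then have "x ^ card (UNIV - {0::'a}) * (\<Prod>y\<in>UNIV - {0::'a}. y) = (\<Prod>y\<in>UNIV - {0::'a}. y)"
    by (simp add: prod.distrib)
  moreover have "(\<Prod>y\<in>UNIV - {0::'a}. y) \<noteq> 0" by simp
  ultimately show ?thesis by (simp add: card_Diff_singleton)
qed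

lemma one_less_card_field: "1 < CARD('a::{finite,field})"
  using card_mono[of "UNIV :: 'a set" "{0, 1}"] by simp

lemma finite_field_power_card:
  fixes x :: "'a::{finite,field}"
  shows "x ^ CARD('a) = x"
proof (cases "x = 0")
  case True
  then show ?thesis by simp
next
  case False
  have "x ^ CARD('a) = x * x ^ (CARD('a) - 1)"
    using one_less_card_field[where 'a = 'a] by (metis less_imp_Suc_add power_Suc add_diff_cancel_left' plus_1_eq_Suc power_eq_if zero_less_card_finite not_less_zero)
  then show ?thesis by (simp only: finite_field_power_card_minus_1[OF False] mult_1_right)
qed

lemma finite_field_generator:
  obtains g :: "'a::{finite,field}"
  where "g \<noteq> 0" "bij_betw (\<lambda>i. g ^ i) {..<CARD('a) - 1} (UNIV - {0})"
proof -
  let ?R = "ring_of_type_algebra :: 'a ring"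
  interpret R: Ring.field ?R by (rule field_from_type_algebra)
  have car: "carrier ?R = UNIV" and zero: "\<zero>\<^bsub>?R\<^esub> = 0" and one: "\<one>\<^bsub>?R\<^esub> = 1"
    and mult: "\<And>x y. x \<otimes>\<^bsub>?R\<^esub> y = x * y"
    by (auto simp: ring_of_type_algebra_def)
  have pow: "x [^]\<^bsub>?R\<^esub> (i::nat) = x ^ i" for x i
    by (induction i) (simp_all add: R.nat_pow_Suc one mult mult.commute)
  obtain g where g: "g \<in> carrier (Multiplicative_Group.mult_of ?R)"
      and gen: "carrier (Multiplicative_Group.mult_of ?R) = {g [^]\<^bsub>?R\<^esub> i | i::nat. i \<in> UNIV}"
    using R.finite_field_mult_group_has_gen by (auto simp: car)
  from g have g0: "g \<noteq> 0" by (simp add: car zero)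
  let ?n = "CARD('a) - 1"
  have n0: "?n > 0" using one_less_card_field[where 'a = 'a] by simp
  have "(\<lambda>i. g ^ i) ` {..<?n} = UNIV - {0}"
  proof
    show "UNIV - {0} \<subseteq> (\<lambda>i. g ^ i) ` {..<?n}"
    proof
      fix x :: 'a assume "x \<in> UNIV - {0}"
      then obtain i where x: "x = g ^ i" using gen by (auto simp: car zero pow)
      have "g ^ i = g ^ (?n * (i div ?n) + i mod ?n)" by simp
      also have "\<dots> = g ^ (i mod ?n)"
        by (simp only: power_add power_mult finite_field_power_card_minus_1[OF g0] power_one mult_1)
      finally show "x \<in> (\<lambda>i. g ^ i) ` {..<?n}" using n0 x by auto
    qed
  qed (use g0 in auto)
  moreover have "card (UNIV - {0::'a}) = ?n" by (simp add: card_Diff_singleton)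
  ultimately have "bij_betw (\<lambda>i. g ^ i) {..<?n} (UNIV - {0})"
    by (simp add: bij_betw_def eq_card_imp_inj_on)
  with g0 show ?thesis by (rule that)
qed

lemma card_roots_of_unity:
  assumes "l dvd CARD('a::{finite,field}) - 1"
  shows "card {z::'a. z ^ l = 1} = l"
proof -
  obtain g :: 'a where g: "g \<noteq> 0" "bij_betw (\<lambda>i. g ^ i) {..<CARD('a) - 1} (UNIV - {0})"
    by (rule finite_field_generator)
  from assms obtain e where e: "CARD('a) - 1 = l * e" ..
  have pos: "0 < l * e" using one_less_card_field[where 'a = 'a] e by linarith
  let ?p = "monom 1 l - 1 :: 'a poly"
  have "coeff ?p l \<noteq> 0" using pos by simp
  then have p0: "?p \<noteq> 0" by fastforce
  have "degree ?p \<le> l" by (intro degree_diff_le degree_monom_le) auto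
  moreover have "{z. z ^ l = 1} = {z. poly ?p z = 0}" by (simp add: poly_monom)
  ultimately have le: "card {z::'a. z ^ l = 1} \<le> l"
    using card_poly_roots_bound[OF p0] by simp
  have "inj_on (\<lambda>i. g ^ (e * i)) {..<l}"
  proof (rule inj_onI)
    fix i j assume ij: "i \<in> {..<l}" "j \<in> {..<l}" "g ^ (e * i) = g ^ (e * j)"
    have "e * i < l * e" "e * j < l * e" using ij pos by auto
    moreover have "inj_on (\<lambda>i. g ^ i) {..<l * e}"
      using g(2) unfolding bij_betw_def e by blast
    ultimately have "e * i = e * j"
      using ij(3) by (auto dest: inj_onD)
    then show "i = j" using pos by simp
  qed
  moreover have "(\<lambda>i. g ^ (e * i)) ` {..<l} \<subseteq> {z. z ^ l = 1}"
  proof safe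
    fix i
    have "(g ^ (e * i)) ^ l = (g ^ (l * e)) ^ i"
      by (simp add: power_mult [symmetric] mult_ac)
    then show "(g ^ (e * i)) ^ l = 1"
      by (simp only: e [symmetric] finite_field_power_card_minus_1[OF g(1)] power_one)
  qed
  ultimately have "card {..<l} \<le> card {z::'a. z ^ l = 1}"
    by (intro card_inj_on_le[of "\<lambda>i. g ^ (e * i)"]) auto
  with le show ?thesis by simp
qed

text \<open>As functions \<open>(x + 1) ^ Q\<close> and \<open>x ^ Q + 1\<close> agree, so the
  polynomial made of the middle binomial terms has \<open>Q\<close> roots but degree below
  \<open>Q\<close>, and is zero. This yields additivity of the \<open>Q\<close>-th power without
  introducing the characteristic.\<close>

lemma finite_field_of_nat_binomial:
  assumes "0 < i" "i < CARD('a::{finite,field})"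
  shows "of_nat (CARD('a) choose i) = (0::'a)"
proof -
  let ?n = "CARD('a)"
  let ?p = "\<Sum>i\<in>{0<..<?n}. monom (of_nat (?n choose i)) i :: 'a poly"
  have "poly ?p x = 0" for x
  proof -
    have "(x + 1) ^ ?n = (\<Sum>i\<le>?n. of_nat (?n choose i) * x ^ i)"
      by (simp add: binomial_ring)
    also have "{..?n} = insert 0 (insert ?n {0<..<?n})" by auto
    also have "(\<Sum>i\<in>insert 0 (insert ?n {0<..<?n}). of_nat (?n choose i) * x ^ i) = 1 + (x ^ ?n + poly ?p x)"
      by (simp add: poly_sum poly_monom)
    finally show ?thesis by (simp add: finite_field_power_card)
  qed
  moreover have "degree ?p < ?n"
    by (rule degree_sum_less) (auto intro: le_less_trans[OF degree_monom_le])
  ultimately have "?p = 0"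
    using card_poly_roots_bound[of ?p] by (cases "?p = 0") auto
  then have "coeff ?p i = 0" by simp
  then show ?thesis using assms by (simp add: coeff_sum sum.delta)
qed

lemma poly_add_power_card:
  fixes p q :: "'a::{finite,field} poly"
  shows "(p + q) ^ CARD('a) = p ^ CARD('a) + q ^ CARD('a)"
proof -
  let ?n = "CARD('a)"
  have "(p + q) ^ ?n = (\<Sum>i\<le>?n. of_nat (?n choose i) * p ^ i * q ^ (?n - i))"
    by (rule binomial_ring)
  also have "{..?n} = insert 0 (insert ?n {0<..<?n})" by auto
  also have "(\<Sum>i\<in>insert 0 (insert ?n {0<..<?n}). of_nat (?n choose i) * p ^ i * q ^ (?n - i))
      = q ^ ?n + (p ^ ?n + (\<Sum>i\<in>{0<..<?n}. of_nat (?n choose i) * p ^ i * q ^ (?n - i)))"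
    by simp
  also have "(\<Sum>i\<in>{0<..<?n}. of_nat (?n choose i) * p ^ i * q ^ (?n - i)) = 0"
    by (intro sum.neutral) (auto simp: of_nat_poly finite_field_of_nat_binomial)
  finally show ?thesis by simp
qed

lemma poly_diff_power_card:
  fixes p q :: "'a::{finite,field} poly"
  shows "(p - q) ^ CARD('a) = p ^ CARD('a) - q ^ CARD('a)"
  using poly_add_power_card[of "p - q" q] by simp

lemma linear_power_card_dvd:
  fixes G :: "'a::{finite,field} poly"
  shows "[:-a, 1:] ^ CARD('a) dvd G ^ CARD('a) - [:poly G a:]"
proof -
  have "[:-a, 1:] dvd G - [:poly G a:]" by (simp add: dvd_iff_poly_eq_0)
  then have "[:-a, 1:] ^ CARD('a) dvd (G - [:poly G a:]) ^ CARD('a)" by (rule dvd_power_same)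
  then show ?thesis by (simp add: poly_diff_power_card poly_const_pow finite_field_power_card)
qed

subsection \<open>Hasse derivatives\<close>

text \<open>
  This is \<open>p(X + T)\<close> as a polynomial in \<open>T\<close>; its \<open>k\<close>-th coefficient is the \<open>k\<close>-th Hasse derivative
  of \<open>p\<close>, which detects multiplicities in every characteristic.
\<close>

definition taylor :: "'a::comm_ring_1 poly \<Rightarrow> 'a poly poly" where
  "taylor p = pcompose (map_poly (\<lambda>c. [:c:]) p) [:[:0, 1:], 1:]"

lemma taylor_0 [simp]: "taylor 0 = 0"
  by (simp add: taylor_def)

lemma taylor_pCons: "taylor (pCons a p) = [:[:a:]:] + [:[:0, 1:], 1:] * taylor p"
proof -
  have "map_poly (\<lambda>c. [:c:]) (pCons a p) = pCons [:a:] (map_poly (\<lambda>c. [:c:]) p)"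
    by (rule poly_eqI) (simp add: coeff_map_poly coeff_pCons split: nat.splits)
  then show ?thesis by (simp add: taylor_def pcompose_pCons)
qed

lemma taylor_const: "taylor [:a:] = [:[:a:]:]"
  by (simp add: taylor_pCons)

lemma taylor_1 [simp]: "taylor 1 = 1"
  by (simp add: one_pCons taylor_const)

lemma taylor_add: "taylor (p + q) = taylor p + taylor q"
  unfolding taylor_def
  by (subst pcompose_add [symmetric], rule arg_cong2[where f = pcompose]) (auto intro!: poly_eqI simp: coeff_map_poly)

lemma taylor_smult: "taylor (smult a p) = smult [:a:] (taylor p)"
  unfolding taylor_def
  by (subst pcompose_smult [symmetric], rule arg_cong2[where f = pcompose])
     (auto intro!: poly_eqI simp: coeff_map_poly mult.commute)

lemma taylor_mult: "taylor (p * q) = taylor p * taylor q"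
  by (induction p) (simp_all add: taylor_add taylor_smult taylor_pCons algebra_simps)

lemma coeff_taylor_pCons:
  "coeff (taylor (pCons a p)) k =
     (if k = 0 then [:a:] else coeff (taylor p) (k - 1)) + [:0, 1:] * coeff (taylor p) k"
  by (cases k) (simp_all add: taylor_pCons)

lemma coeff_taylor_0: "coeff (taylor p) 0 = p"
  by (induction p) (simp_all add: coeff_taylor_pCons)

lemma map_poly_taylor: "map_poly (\<lambda>c. poly c x) (taylor p) = pcompose p [:x, 1:]"
proof (induction p)
  case (pCons a p)
  have "coeff (map_poly (\<lambda>c. poly c x) (taylor (pCons a p))) k =
      coeff ([:a:] + [:x, 1:] * map_poly (\<lambda>c. poly c x) (taylor p)) k" for k
    by (cases k) (simp_all add: coeff_map_poly coeff_taylor_pCons)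
  then show ?case by (simp add: poly_eq_iff pcompose_pCons flip: pCons.IH)
qed simp

lemma degree_coeff_taylor:
  "coeff (taylor p) k \<noteq> 0 \<Longrightarrow> degree (coeff (taylor p) k) + k \<le> degree p"
proof (induction p arbitrary: k)
  case (pCons a p)
  show ?case
  proof (cases "p = 0")
    case True
    then show ?thesis using pCons.prems by (cases k) (simp_all add: taylor_const)
  next
    case False
    have 1: "degree ([:0, 1:] * coeff (taylor p) k) + k \<le> Suc (degree p)" if "coeff (taylor p) k \<noteq> 0"
    proof -
      have "degree ([:0, 1:] * coeff (taylor p) k) \<le> Suc (degree (coeff (taylor p) k))"
        using degree_mult_le[of "[:0, 1:]" "coeff (taylor p) k"] by simp
      then show ?thesis using pCons.IH[OF that] by simp
    qed
    have 2: "degree (coeff (taylor p) (k - 1)) + k \<le> Suc (degree p)" if "coeff (taylor p) (k - 1) \<noteq> 0" "k > 0"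
      using pCons.IH[OF that(1)] that(2) by simp
    have 3: "k \<le> Suc (degree p)" using pCons.prems 1 2
      by (cases "k = 0"; cases "coeff (taylor p) k = 0"; cases "coeff (taylor p) (k-1) = 0")
         (fastforce simp: coeff_taylor_pCons)+
    have "degree (coeff (taylor (pCons a p)) k) \<le> Suc (degree p) - k"
      unfolding coeff_taylor_pCons
    proof (rule degree_add_le)
      show "degree ([:0, 1:] * coeff (taylor p) k) \<le> Suc (degree p) - k"
        using 1 by (cases "coeff (taylor p) k = 0") auto
      show "degree (if k = 0 then [:a:] else coeff (taylor p) (k - 1)) \<le> Suc (degree p) - k"
        using 2 by (cases "coeff (taylor p) (k - 1) = 0") auto
    qed
    with 3 False show ?thesis by simp
  qed
qed simp

text \<open>The values at \<open>x\<close> of the coefficients of \<open>taylor p\<close> are the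
  coefficients of \<open>p(X + x)\<close>. If the first \<open>M\<close> vanish,
  \<open>X ^ M\<close> splits off, and shifting back turns it into
  \<open>(X - x) ^ M\<close>.\<close>

lemma linear_power_dvd_if_taylor:
  fixes p :: "'a::field poly"
  assumes "\<And>k. k < M \<Longrightarrow> poly (coeff (taylor p) k) x = 0"
  shows "[:-x, 1:] ^ M dvd p"
proof -
  have "coeff (pcompose p [:x, 1:]) k = 0" if "k < M" for k
    using assms[OF that] by (simp flip: map_poly_taylor add: coeff_map_poly)
  then have "monom 1 M dvd pcompose p [:x, 1:]" by (simp add: monom_1_dvd_iff')
  then obtain u where u: "pcompose p [:x, 1:] = [:0, 1:] ^ M * u"
    by (auto simp: monom_altdef elim: dvdE)
  have "p = pcompose (pcompose p [:x, 1:]) [:-x, 1:]"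
    by (simp add: pcompose_pCons flip: pcompose_assoc)
  also have "\<dots> = [:-x, 1:] ^ M * pcompose u [:-x, 1:]"
    by (simp add: u pcompose_mult pcompose_hom.hom_power pcompose_pCons)
  finally show ?thesis by simp
qed

subsection \<open>Kummer theory\<close>

interpretation to_ac: field_hom "to_ac :: 'a::field \<Rightarrow> 'a alg_closure"
  by unfold_locales auto

interpretation to_ac_poly: map_poly_inj_idom_hom "to_ac :: 'a::field \<Rightarrow> 'a alg_closure" ..

text \<open>Otherwise the minimal polynomial of \<open>t\<close> has some degree
  \<open>k < l\<close> and divides \<open>X ^ l - c\<close>, so all its roots are
  \<open>l\<close>-th roots of \<open>c\<close>. Its constant term, made monic, is the product of
  the \<open>k\<close> negated roots, and its \<open>l\<close>-th power is
  \<open>((-1) ^ l * c) ^ k\<close>, which the hypothesis excludes.\<close>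

lemma kummer_no_root:
  fixes c :: "'a::field" and P :: "'a poly" and l :: nat
  assumes not_power: "\<And>k b. 0 < k \<Longrightarrow> k < l \<Longrightarrow> b ^ l \<noteq> ((-1) ^ l * c) ^ k"
    and t: "t ^ l = to_ac c"
    and P: "P \<noteq> 0" "degree P < l"
  shows "poly (map_poly to_ac P) t \<noteq> 0"
proof
  assume "poly (map_poly to_ac P) t = 0"
  define A where "A = (\<lambda>m. m \<noteq> 0 \<and> poly (map_poly to_ac m) t = 0)"
  define k where "k = (LEAST k. \<exists>m. A m \<and> degree m = k)"
  have AP: "A P" using P \<open>poly _ t = 0\<close> by (simp add: A_def)
  then have "\<exists>k m. A m \<and> degree m = k" by metis
  from LeastI_ex[OF this] obtain m where m: "A m" "degree m = k" unfolding k_def by metis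
  have least: "k \<le> degree p" if "A p" for p
    unfolding k_def by (rule Least_le) (use that in blast)
  have "k < l" using least[OF AP] P by simp
  have "k > 0"
  proof (rule ccontr)
    assume "\<not> 0 < k"
    then obtain a where "m = [:a:]" using m(2) degree_eq_zeroE by blast
    moreover have "map_poly to_ac [:a:] = [:to_ac a:]"
      by (rule poly_eqI) (simp add: coeff_map_poly coeff_pCons split: nat.splits)
    ultimately show False using m(1) by (simp add: A_def)
  qed
  let ?X = "monom 1 l - [:c:]"
  have rootX: "poly (map_poly to_ac ?X) t = 0"
    using t by (simp add: hom_distribs poly_monom map_poly_pCons)
  have "?X mod m = 0"
  proof (rule ccontr)
    assume "?X mod m \<noteq> 0"
    have "map_poly to_ac ?X = map_poly to_ac (?X div m) * map_poly to_ac m + map_poly to_ac (?X mod m)"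
      by (metis div_mult_mod_eq to_ac_poly.hom_add to_ac_poly.hom_mult)
    then have "poly (map_poly to_ac (?X mod m)) t = 0"
      using rootX m(1) by (simp add: A_def)
    then have "A (?X mod m)" using \<open>?X mod m \<noteq> 0\<close> by (simp add: A_def)
    then have "k \<le> degree (?X mod m)" by (rule least)
    with \<open>?X mod m \<noteq> 0\<close> m show False
      using degree_mod_less[of m ?X] by (auto simp: A_def)
  qed
  then have dvd: "m dvd ?X" by (simp add: dvd_eq_mod_eq_0)
  let ?m = "map_poly to_ac m"
  have m0: "m \<noteq> 0" using m(1) by (simp add: A_def)
  then have "?m \<noteq> 0" by simp
  then obtain R where R: "size R = degree ?m" "?m = smult (lead_coeff ?m) (\<Prod>x\<in>#R. [:-x, 1:])"
    using alg_closed_imp_factorization by metis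
  have pow: "x ^ l = to_ac c" if "x \<in># R" for x
  proof -
    have "poly (\<Prod>x\<in>#R. [:-x, 1:]) x = 0"
      using that by (auto simp: poly_prod_mset)
    then have "poly ?m x = 0" by (subst R(2)) simp
    moreover from dvd have "?m dvd map_poly to_ac ?X" by (rule to_ac_poly.hom_dvd)
    ultimately have "poly (map_poly to_ac ?X) x = 0" by (auto elim!: dvdE)
    then show ?thesis by (simp add: hom_distribs poly_monom map_poly_pCons)
  qed
  let ?b = "coeff m 0 / lead_coeff m"
  have "to_ac (coeff m 0) = poly ?m 0" by (simp add: poly_0_coeff_0)
  also have "\<dots> = to_ac (lead_coeff m) * (\<Prod>x\<in>#R. -x)"
    by (subst R(2)) (simp add: poly_prod_mset)
  finally have b: "to_ac ?b = (\<Prod>x\<in>#R. -x)" using m0 by (simp add: field_simps)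
  have "to_ac (?b ^ l) = (\<Prod>x\<in>#R. (-x) ^ l)"
  proof -
    have "(\<Prod>x\<in>#R. -x) ^ l = (\<Prod>x\<in>#R. (-x) ^ l)"
      by (induction R) (simp_all add: power_mult_distrib del: mult_minus_left)
    then show ?thesis by (simp only: to_ac_power b)
  qed
  also have "\<dots> = (\<Prod>x\<in>#R. (-1) ^ l * to_ac c)"
    by (intro arg_cong[where f = prod_mset] image_mset_cong) (metis power_minus pow)
  also have "\<dots> = to_ac (((-1) ^ l * c) ^ k)"
    using m(2) by (simp add: R(1) hom_distribs)
  finally have "?b ^ l = ((-1) ^ l * c) ^ k" by (simp only: to_ac_eq_iff)
  with not_power[OF \<open>0 < k\<close> \<open>k < l\<close>] show False by blast
qed

interpretation to_fract: inj_idom_hom "to_fract :: 'a::idom \<Rightarrow> 'a fract"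
  by unfold_locales auto

interpretation to_fract_poly: map_poly_inj_idom_hom "to_fract :: 'a::idom \<Rightarrow> 'a fract" ..

lemma order_power: "p \<noteq> 0 \<Longrightarrow> order a (p ^ n) = n * order a (p :: 'a::idom poly)"
  by (induction n) (simp_all add: order_mult order_0I)

lemma order_prod:
  fixes f :: "'i \<Rightarrow> 'a::idom poly"
  assumes "finite I" "\<And>i. i \<in> I \<Longrightarrow> f i \<noteq> 0"
  shows "order a (\<Prod>i\<in>I. f i) = (\<Sum>i\<in>I. order a (f i))"
  using assms by (induction I rule: finite_induct) (simp_all add: order_mult order_0I)

text \<open>At a root of \<open>G i\<close> in the algebraic closure the product of all
  \<open>G j\<close> has a simple zero, so the denominator has order exactly \<open>m i\<close>
  there. Comparing orders after clearing denominators shows that \<open>l\<close> divides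
  \<open>k * m i\<close> for every \<open>i\<close>; by the gcd condition \<open>l\<close> divides
  \<open>k\<close>, against \<open>k < l\<close>.\<close>

lemma ratio_power_not_power:
  fixes G :: "'i \<Rightarrow> 'a::field poly" and b :: "'a poly fract" and m :: "'i \<Rightarrow> nat"
  assumes fin: "finite I" and deg: "\<And>i. i \<in> I \<Longrightarrow> degree (G i) > 0"
    and sqf: "\<And>\<rho>. order \<rho> (map_poly to_ac (\<Prod>i\<in>I. G i)) \<le> 1"
    and gcd: "Gcd (insert l (m ` I)) = 1"
    and \<phi>: "\<phi> \<noteq> 0" and k: "0 < k" "k < l"
  shows "b ^ l \<noteq> ((-1) ^ l * (to_fract [:\<phi>:] / to_fract (\<Prod>i\<in>I. G i ^ m i))) ^ k"
proof
  let ?f = "\<Prod>i\<in>I. G i ^ m i"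
  assume eq: "b ^ l = ((-1) ^ l * (to_fract [:\<phi>:] / to_fract ?f)) ^ k"
  have G0: "G i \<noteq> 0" if "i \<in> I" for i using deg[OF that] by auto
  have f0: "?f \<noteq> 0" using G0 fin by simp
  obtain u v where b: "b = to_fract u / to_fract v" and v: "v \<noteq> 0"
    by (cases b) (auto simp: Fract_conv_to_fract)
  have "to_fract (u ^ l * ?f ^ k) = to_fract (([:(-1) ^ l * \<phi>:]) ^ k * v ^ l)"
  proof -
    have e1: "to_fract [:(-1) ^ l * \<phi>:] = (-1) ^ l * to_fract [:\<phi>:]"
      by (cases "even l") (simp_all flip: to_fract_uminus)
    have "(to_fract u / to_fract v) ^ l = (to_fract [:(-1) ^ l * \<phi>:] / to_fract ?f) ^ k"
      using eq by (simp add: b e1)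
    then show ?thesis
      using v f0 by (simp add: power_divide to_fract.hom_mult to_fract.hom_power frac_eq_eq del: to_fract.hom_prod)
  qed
  then have main: "u ^ l * ?f ^ k = [:((-1) ^ l * \<phi>) ^ k:] * v ^ l"
    by (simp only: to_fract.eq_iff poly_const_pow)
  have c0: "((-1) ^ l * \<phi>) ^ k \<noteq> 0" using \<phi> by simp
  have u0: "u \<noteq> 0"
  proof
    assume "u = 0"
    then have "u ^ l * ?f ^ k = 0" using k by simp
    with main c0 v show False by simp
  qed
  have "l dvd k * m i" if i: "i \<in> I" for i
  proof -
    have "degree (map_poly to_ac (G i)) > 0" using deg[OF i] by simp
    then obtain \<rho> where \<rho>: "poly (map_poly to_ac (G i)) \<rho> = 0"
      using alg_closed_imp_poly_has_root by blast
    define o' where "o' = (\<lambda>p. order \<rho> (map_poly to_ac p))"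
    have o_mult: "o' (p * q) = o' p + o' q" if "p \<noteq> 0" "q \<noteq> 0" for p q
      using that by (simp add: o'_def hom_distribs order_mult)
    have o_pow: "o' (p ^ n) = n * o' p" if "p \<noteq> 0" for p n
      using that by (simp add: o'_def hom_distribs order_power)
    have o_prod: "o' (\<Prod>j\<in>I. F j) = (\<Sum>j\<in>I. o' (F j))" if "\<And>j. j \<in> I \<Longrightarrow> F j \<noteq> 0" for F
      using that fin by (simp add: o'_def hom_distribs order_prod)
    have "o' (G i) \<noteq> 0" using \<rho> G0[OF i] by (simp add: o'_def order_root)
    moreover have "o' (G i) + (\<Sum>j\<in>I - {i}. o' (G j)) \<le> 1"
      using sqf[of \<rho>] o_prod[of G] G0 fin i by (simp add: o'_def sum.remove)
    ultimately have oi: "o' (G i) = 1" and "(\<Sum>j\<in>I - {i}. o' (G j)) = 0"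
      by linarith+
    then have oj: "o' (G j) = 0" if "j \<in> I - {i}" for j
      using that fin by simp
    have "o' ?f = (\<Sum>j\<in>I. m j * o' (G j))"
      using G0 by (subst o_prod) (simp_all add: o_pow)
    also have "\<dots> = m i" using fin i oi oj by (simp add: sum.remove)
    finally have "o' ?f = m i" .
    then have "o' (u ^ l * ?f ^ k) = l * o' u + k * m i"
      using u0 f0 by (simp add: o_mult o_pow)
    moreover have "o' ([:((-1) ^ l * \<phi>) ^ k:] * v ^ l) = l * o' v"
    proof -
      have "o' [:((-1) ^ l * \<phi>) ^ k:] = 0"
        using c0 by (simp add: o'_def map_poly_pCons order_0I)
      then show ?thesis using c0 v by (subst o_mult) (simp_all add: o_pow)
    qed
    ultimately have "l * o' u + k * m i = l * o' v" using main by simp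
    then show ?thesis by (metis dvd_add_right_iff dvd_triv_left)
  qed
  then have "l dvd Gcd ((*) k ` insert l (m ` I))"
    by (intro Gcd_greatest) auto
  also have "Gcd ((*) k ` insert l (m ` I)) = k"
    by (simp only: Gcd_mult gcd) simp
  finally show False using k by (auto dest: dvd_imp_le)
qed

subsection \<open>Nonvanishing modulo a high power\<close>

lemma poly_eq_sum_multiples:
  fixes p :: "'a::comm_ring_1 poly"
  assumes "\<And>i. \<not> l dvd i \<Longrightarrow> coeff p i = 0" "degree p < l * n"
  shows "poly p x = (\<Sum>i<n. coeff p (l * i) * (x ^ l) ^ i)"
proof -
  have l: "l > 0" using assms(2) by (cases l) auto
  have "poly p x = (\<Sum>i\<le>degree p. coeff p i * x ^ i)" by (rule poly_altdef)
  also have "\<dots> = (\<Sum>i<l * n. coeff p i * x ^ i)"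
    using assms(2) by (intro sum.mono_neutral_left) (auto simp: coeff_eq_0)
  also have "\<dots> = (\<Sum>i\<in>(*) l ` {..<n}. coeff p i * x ^ i)"
  proof (rule sum.mono_neutral_right)
    show "\<forall>i\<in>{..<l * n} - (*) l ` {..<n}. coeff p i * x ^ i = 0"
    proof
      fix i assume i: "i \<in> {..<l * n} - (*) l ` {..<n}"
      have "\<not> l dvd i"
      proof
        assume "l dvd i"
        then obtain j where "i = l * j" ..
        with i l show False by auto
      qed
      then show "coeff p i * x ^ i = 0" using assms(1) by simp
    qed
  qed (use l in auto)
  also have "\<dots> = (\<Sum>i<n. coeff p (l * i) * (x ^ l) ^ i)"
    using l by (subst sum.reindex) (auto simp: inj_on_def power_mult)
  finally show ?thesis .
qed

lemma degree_coeff_mult_le: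
  fixes p q :: "'a::comm_ring_1 poly poly"
  assumes "\<And>i. degree (coeff p i) \<le> a" "\<And>i. degree (coeff q i) \<le> b"
  shows "degree (coeff (p * q) i) \<le> a + b"
  unfolding coeff_mult
  by (intro degree_sum_le) (auto intro!: degree_mult_le[THEN order_trans] add_mono assms)

lemma degree_coeff_prod_le:
  fixes P :: "'b \<Rightarrow> 'a::comm_ring_1 poly poly"
  assumes "\<And>z i. z \<in> A \<Longrightarrow> degree (coeff (P z) i) \<le> d"
  shows "degree (coeff (\<Prod>z\<in>A. P z) i) \<le> card A * d"
  using assms
proof (induction A arbitrary: i rule: infinite_finite_induct)
  case (insert z A)
  have "degree (coeff (P z * (\<Prod>z\<in>A. P z)) i) \<le> d + card A * d"
    by (rule degree_coeff_mult_le) (use insert in auto)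
  then show ?case using insert by simp
qed (auto simp: coeff_1)

text \<open>
  The norm of \<open>\<Sum>R\<^sub>a * Y ^ a\<close> over the twists \<open>Y \<mapsto> z * Y\<close>: a polynomial in \<open>Y ^ l\<close>, so it can be evaluated
  knowing only \<open>y ^ l\<close>.
\<close>

definition twist_norm :: "nat \<Rightarrow> (nat \<Rightarrow> 'a::{finite,field} poly) \<Rightarrow> 'a poly poly" where
  "twist_norm l R = (\<Prod>z\<in>{z. z ^ l = 1}. \<Sum>a<l. monom (smult (z ^ a) (R a)) a)"

text \<open>Substituting \<open>w * Y\<close> for \<open>Y\<close>, with \<open>w\<close> an
  \<open>l\<close>-th root of unity, permutes the factors of the norm, so multiplication by
  \<open>w ^ i\<close> fixes coefficient \<open>i\<close>. Some \<open>w\<close> has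
  \<open>w ^ i \<noteq> 1\<close>: otherwise all \<open>l\<close> of these roots would be
  \<open>gcd l i\<close>-th roots of unity, of which there are fewer.\<close>

lemma coeff_twist_norm_eq_0:
  fixes R :: "nat \<Rightarrow> 'a::{finite,field} poly"
  assumes l: "l dvd CARD('a) - 1" and i: "\<not> l dvd i"
  shows "coeff (twist_norm l R) i = 0"
proof -
  let ?P = "\<lambda>z. \<Sum>a<l. monom (smult (z ^ a) (R a)) a"
  have l0: "l > 0" using l one_less_card_field[where 'a = 'a] by (cases l) auto
  have "\<exists>w::'a. w ^ l = 1 \<and> w ^ i \<noteq> 1"
  proof (rule ccontr)
    assume *: "\<not> ?thesis"
    define g where "g = gcd l i"
    have "{w::'a. w ^ l = 1} \<subseteq> {w. w ^ g = 1}"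
    proof safe
      fix w :: 'a assume w: "w ^ l = 1"
      obtain u v where uv: "l * u = i * v + g"
        using bezout_nat[of l i] l0 by (auto simp: g_def)
      have "w ^ (i * v) = 1" using * w by (simp add: power_mult)
      moreover have "w ^ (l * u) = 1" using w by (simp add: power_mult)
      ultimately show "w ^ g = 1" by (simp add: uv power_add)
    qed
    then have "card {w::'a. w ^ l = 1} \<le> card {w::'a. w ^ g = 1}" by (intro card_mono) auto
    moreover have "g dvd CARD('a) - 1" using l by (auto simp: g_def intro: dvd_trans)
    ultimately have "l \<le> g" using l by (simp add: card_roots_of_unity)
    moreover have "g dvd l" by (simp add: g_def)
    ultimately have "g = l" using l0 by (simp add: dvd_imp_le le_antisym)
    then show False using i by (metis g_def gcd_dvd2)
  qed
  then obtain w :: 'a where w: "w ^ l = 1" "w ^ i \<noteq> 1" by blast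
  from w l0 have w0: "w \<noteq> 0" by (auto simp: zero_power)
  have "pcompose (?P z) [:0, [:w:]:] = ?P (w * z)" for z
    by (rule poly_eqI)
       (simp add: coeff_pcompose_linear coeff_sum sum_distrib_left poly_const_pow power_mult_distrib if_distrib sum.delta mult.commute cong: if_cong)
  then have "pcompose (twist_norm l R) [:0, [:w:]:] = (\<Prod>z\<in>{z. z ^ l = 1}. ?P (w * z))"
    unfolding twist_norm_def by (simp add: pcompose_prod)
  also have "\<dots> = twist_norm l R"
    unfolding twist_norm_def
    by (rule prod.reindex_bij_betw[of "\<lambda>z. w * z"], rule bij_betw_byWitness[where f' = "\<lambda>z. z / w"])
       (use w w0 in \<open>auto simp: power_mult_distrib power_divide\<close>)
  finally have "coeff (pcompose (twist_norm l R) [:0, [:w:]:]) i = coeff (twist_norm l R) i" by simp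
  then have "[:w:] ^ i * coeff (twist_norm l R) i = coeff (twist_norm l R) i"
    by (simp add: coeff_pcompose_linear)
  then have "([:w:] ^ i - 1) * coeff (twist_norm l R) i = 0"
    by (simp add: left_diff_distrib)
  moreover have "[:w:] ^ i - 1 \<noteq> 0" using w by (simp add: poly_const_pow one_pCons)
  ultimately show ?thesis by simp
qed

lemma degree_coeff_twist_norm:
  fixes R :: "nat \<Rightarrow> 'a::{finite,field} poly"
  assumes l: "l dvd CARD('a) - 1" and "\<And>a. a < l \<Longrightarrow> degree (R a) \<le> d"
  shows "degree (coeff (twist_norm l R) i) \<le> l * d"
proof -
  have "degree (coeff (twist_norm l R) i) \<le> card {z::'a. z ^ l = 1} * d"
    unfolding twist_norm_def
  proof (rule degree_coeff_prod_le)
    fix z :: 'a and i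
    show "degree (coeff (\<Sum>a<l. monom (smult (z ^ a) (R a)) a) i) \<le> d"
      unfolding coeff_sum
      by (rule degree_sum_le) (auto simp: assms(2) intro: order_trans[OF degree_smult_le])
  qed
  then show ?thesis by (simp add: card_roots_of_unity[OF l])
qed

lemma degree_twist_norm:
  fixes R :: "nat \<Rightarrow> 'a::{finite,field} poly"
  assumes l: "l dvd CARD('a) - 1"
  shows "degree (twist_norm l R) < l * l"
proof -
  have l0: "l > 0" using l one_less_card_field[where 'a = 'a] by (cases l) auto
  have "degree (twist_norm l R) \<le> (\<Sum>z\<in>{z::'a. z ^ l = 1}. l - 1)"
    unfolding twist_norm_def
  proof (rule order_trans[OF degree_prod_sum_le])
    show "sum (degree \<circ> (\<lambda>z. \<Sum>a<l. monom (smult (z ^ a) (R a)) a)) {z::'a. z ^ l = 1}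
        \<le> (\<Sum>z\<in>{z::'a. z ^ l = 1}. l - 1)"
      by (rule sum_mono) (auto intro!: degree_sum_le degree_monom_le[THEN order_trans])
  qed simp
  also have "\<dots> = l * (l - 1)" by (simp add: card_roots_of_unity[OF l])
  also have "\<dots> < l * l" using l0 by simp
  finally show ?thesis .
qed

lemma mod_sum_cong:
  fixes f g :: "'i \<Rightarrow> 'a::field poly"
  assumes "\<And>i. i \<in> A \<Longrightarrow> f i mod p = g i mod p"
  shows "(\<Sum>i\<in>A. f i) mod p = (\<Sum>i\<in>A. g i) mod p"
  using assms
  by (induction A rule: infinite_finite_induct) (auto intro: mod_add_cong)

lemma mod_prod_cong:
  fixes f g :: "'i \<Rightarrow> 'a::field poly"
  assumes "\<And>i. i \<in> A \<Longrightarrow> f i mod p = g i mod p"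
  shows "(\<Prod>i\<in>A. f i) mod p = (\<Prod>i\<in>A. g i) mod p"
  using assms
  by (induction A rule: infinite_finite_induct) (auto intro: mod_mult_cong)

lemma mod_power_cong:
  fixes x y :: "'a::field poly"
  shows "x mod p = y mod p \<Longrightarrow> x ^ n mod p = y ^ n mod p"
  by (metis power_mod)

lemma prod_const_poly: "(\<Prod>i\<in>A. [:c i:]) = [:\<Prod>i\<in>A. c i:]"
  by (induction A rule: infinite_finite_induct) (simp_all add: one_pCons mult.commute)

lemma degree_prod_power_le:
  assumes "finite I" "\<And>i. i \<in> I \<Longrightarrow> k i \<le> n"
  shows "degree (\<Prod>i\<in>I. G i ^ k i) \<le> n * (\<Sum>i\<in>I. degree (G i))"
proof -
  have "degree (\<Prod>i\<in>I. G i ^ k i) \<le> (\<Sum>i\<in>I. degree (G i ^ k i))"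
    using degree_prod_sum_le[OF assms(1), of "\<lambda>i. G i ^ k i"] by (simp add: o_def)
  also have "\<dots> \<le> (\<Sum>i\<in>I. n * degree (G i))"
    using assms(2) by (intro sum_mono order_trans[OF degree_power_le]) simp
  finally show ?thesis by (simp add: sum_distrib_left)
qed

locale power_residue_family =
  fixes G :: "'i \<Rightarrow> 'a::{finite,field} poly" and m :: "'i \<Rightarrow> nat" and I :: "'i set"
    and l e D :: nat
  assumes fin: "finite I"
    and deg: "\<And>i. i \<in> I \<Longrightarrow> degree (G i) > 0"
    and sqf: "\<And>\<rho>. order \<rho> (map_poly to_ac (\<Prod>i\<in>I. G i)) \<le> 1"
    and gcd: "Gcd (insert l (m ` I)) = 1"
    and m_less: "\<And>i. i \<in> I \<Longrightarrow> m i < l"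
    and card_eq: "CARD('a) - 1 = l * e"
    and D_def: "D = (\<Sum>i\<in>I. degree (G i))"
begin

text \<open>
  Off the zeros of the \<open>G i\<close>, this is the function \<open>(\<Prod>i\<in>I. G i ^ (e * m i)) ^ a\<close>, with exponents reduced
  modulo \<open>CARD('a) - 1\<close>.
\<close>

definition Y :: "nat \<Rightarrow> 'a poly" where
  "Y a = (\<Prod>i\<in>I. G i ^ (e * ((a * m i) mod l)))"

lemma l_pos: "l > 0" and e_pos: "e > 0"
  using card_eq one_less_card_field[where 'a = 'a] by (auto intro: Nat.gr0I)

lemma l_dvd: "l dvd CARD('a) - 1"
  unfolding card_eq by simp

lemma card_Suc: "CARD('a) = Suc (l * e)"
  using card_eq one_less_card_field[where 'a = 'a] by linarith

lemma G_nonzero: "i \<in> I \<Longrightarrow> G i \<noteq> 0"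
  using deg by force

lemma Y_nonzero: "Y a \<noteq> 0"
  using fin G_nonzero by (simp add: Y_def)

text \<open>Modulo \<open>p\<close> the sum becomes \<open>\<Sum>R a * y ^ a\<close> with all
  \<open>R a\<close> of small degree, although \<open>y\<close> itself has large degree. Its twisted
  norm involves only \<open>y ^ l\<close>, which is \<open>\<phi> / f\<close> modulo
  \<open>p\<close>. With denominators cleared this is a polynomial \<open>L\<close> of degree below
  that of \<open>p\<close> and divisible by \<open>p\<close>, hence zero, and an exact root
  \<open>T\<close> of \<open>\<phi> / f\<close> then contradicts Kummer theory.\<close>

lemma zero_estimate:
  fixes r :: "nat \<Rightarrow> 'a poly"
  assumes z0: "\<And>i. i \<in> I \<Longrightarrow> poly (G i) z0 \<noteq> 0"
    and r: "\<And>a. a < l \<Longrightarrow> degree (r a) < B" and a0: "a0 < l" "r a0 \<noteq> 0"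
    and B: "l * B + 2 * l\<^sup>2 * D \<le> CARD('a)"
  shows "\<not> [:-z0, 1:] ^ CARD('a) dvd (\<Sum>a<l. r a * Y a)"
proof
  define Q where "Q = CARD('a)"
  define p where "p = [:-z0, 1:] ^ Q"
  assume "[:-z0, 1:] ^ CARD('a) dvd (\<Sum>a<l. r a * Y a)"
  then have p_dvd: "p dvd (\<Sum>a<l. r a * Y a)" by (simp add: p_def Q_def)
  define \<gamma> where "\<gamma> = (\<lambda>i. poly (G i) z0)"
  have G_pow: "G i ^ Q mod p = [:\<gamma> i:] mod p" for i
    using linear_power_card_dvd[of z0 "G i"] by (simp add: mod_eq_dvd_iff p_def Q_def \<gamma>_def)
  \<comment> \<open>The carry in reducing \<open>a * m i\<close> modulo \<open>l\<close>. Since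
    \<open>l * e = Q - 1\<close>, the factor \<open>G i ^ q a i\<close> completes the difference
    between \<open>y ^ a\<close> and \<open>Y a\<close> to full \<open>Q\<close>-th powers, which
    are constants modulo \<open>p\<close>.\<close>
  define q where "q = (\<lambda>a i. (a * m i) div l)"
  have q_le: "q a i \<le> l - 1" if "a < l" "i \<in> I" for a i
  proof -
    have "a * m i < l * l" using that m_less[OF that(2)] by (intro mult_strict_mono) auto
    then have "q a i < l" by (simp add: q_def less_mult_imp_div_less)
    then show ?thesis by simp
  qed
  define c where "c = (\<lambda>a. \<Prod>i\<in>I. \<gamma> i ^ q a i)"
  have c0: "c a \<noteq> 0" for a using z0 fin by (simp add: c_def \<gamma>_def)
  define y where "y = (\<Prod>i\<in>I. G i ^ (e * m i))"
  define R where "R = (\<lambda>a. smult (inverse (c a)) (r a) * (\<Prod>i\<in>I. G i ^ q a i))"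
  have Ry: "(R a * y ^ a) mod p = (r a * Y a) mod p" for a
  proof -
    have ex: "q a i + e * m i * a = Q * q a i + e * ((a * m i) mod l)" for i
    proof -
      have "e * m i * a = e * (l * q a i + (a * m i) mod l)" by (simp add: q_def)
      then show ?thesis by (simp add: Q_def card_Suc algebra_simps)
    qed
    have "(\<Prod>i\<in>I. G i ^ q a i) * y ^ a = (\<Prod>i\<in>I. G i ^ (q a i + e * m i * a))"
      unfolding y_def by (simp add: power_add power_mult prod.distrib flip: prod_power_distrib)
    also have "\<dots> = (\<Prod>i\<in>I. (G i ^ Q) ^ q a i) * Y a"
      unfolding ex Y_def by (simp add: power_add power_mult prod.distrib)
    finally have eq: "(\<Prod>i\<in>I. G i ^ q a i) * y ^ a = (\<Prod>i\<in>I. (G i ^ Q) ^ q a i) * Y a" .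
    have "(\<Prod>i\<in>I. (G i ^ Q) ^ q a i) mod p = (\<Prod>i\<in>I. [:\<gamma> i:] ^ q a i) mod p"
      by (intro mod_prod_cong mod_power_cong G_pow)
    also have "(\<Prod>i\<in>I. [:\<gamma> i:] ^ q a i) = [:c a:]"
      by (simp add: poly_const_pow prod_const_poly c_def)
    finally have "(smult (inverse (c a)) (r a) * ((\<Prod>i\<in>I. (G i ^ Q) ^ q a i) * Y a)) mod p
        = (smult (inverse (c a)) (r a) * ([:c a:] * Y a)) mod p"
      by (intro mod_mult_cong refl)
    moreover have "R a * y ^ a = smult (inverse (c a)) (r a) * ((\<Prod>i\<in>I. (G i ^ Q) ^ q a i) * Y a)"
      by (simp only: R_def mult.assoc eq)
    ultimately show ?thesis using c0[of a] by simp
  qed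
  have sum0: "p dvd (\<Sum>a<l. R a * y ^ a)"
  proof -
    have "(\<Sum>a<l. R a * y ^ a) mod p = (\<Sum>a<l. r a * Y a) mod p"
      by (intro mod_sum_cong Ry)
    with p_dvd show ?thesis by (simp add: dvd_eq_mod_eq_0)
  qed
  define d where "d = (B - 1) + (l - 1) * D"
  have R_deg: "degree (R a) \<le> d" if "a < l" for a
    unfolding R_def d_def
  proof (rule order_trans[OF degree_mult_le], rule add_mono)
    show "degree (smult (inverse (c a)) (r a)) \<le> B - 1"
      using r[OF that] c0[of a] by simp
    show "degree (\<Prod>i\<in>I. G i ^ q a i) \<le> (l - 1) * D"
      unfolding D_def by (rule degree_prod_power_le[OF fin q_le[OF that]])
  qed
  define f where "f = (\<Prod>i\<in>I. G i ^ m i)"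
  define \<phi> where "\<phi> = (\<Prod>i\<in>I. \<gamma> i ^ m i)"
  have f0: "f \<noteq> 0" using fin G_nonzero by (simp add: f_def)
  have \<phi>0: "\<phi> \<noteq> 0" using fin z0 by (simp add: \<phi>_def \<gamma>_def)
  have fy: "(f * y ^ l) mod p = [:\<phi>:] mod p"
  proof -
    have "f * y ^ l = (\<Prod>i\<in>I. (G i ^ Q) ^ m i)"
    proof -
      have "f * y ^ l = (\<Prod>i\<in>I. G i ^ m i * (G i ^ (e * m i)) ^ l)"
        by (simp add: f_def y_def prod.distrib prod_power_distrib)
      also have "\<dots> = (\<Prod>i\<in>I. (G i ^ Q) ^ m i)"
      proof (rule prod.cong[OF refl])
        fix i
        have "m i + e * m i * l = Q * m i" by (simp add: Q_def card_Suc algebra_simps)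
        then show "G i ^ m i * (G i ^ (e * m i)) ^ l = (G i ^ Q) ^ m i"
          by (metis power_add power_mult)
      qed
      finally show ?thesis .
    qed
    moreover have "(\<Prod>i\<in>I. (G i ^ Q) ^ m i) mod p = (\<Prod>i\<in>I. [:\<gamma> i:] ^ m i) mod p"
      by (intro mod_prod_cong mod_power_cong G_pow)
    moreover have "(\<Prod>i\<in>I. [:\<gamma> i:] ^ m i) = [:\<phi>:]"
      by (simp add: poly_const_pow prod_const_poly \<phi>_def)
    ultimately show ?thesis by simp
  qed
  let ?P = "\<lambda>z. \<Sum>a<l. monom (smult (z ^ a) (R a)) a"
  let ?N = "twist_norm l R"
  \<comment> \<open>The factor for the trivial twist is the given sum, so \<open>p\<close> divides
    the whole norm.\<close>
  have "poly (?P 1) y dvd poly ?N y"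
    unfolding twist_norm_def poly_prod
    by (rule dvd_prodI[of _ 1 "\<lambda>z. poly (?P z) y"]) auto
  then have pN: "p dvd poly ?N y"
    using sum0 by (simp add: poly_sum poly_monom dvd_trans)
  have polyN: "poly ?N x = (\<Sum>i<l. coeff ?N (l * i) * (x ^ l) ^ i)" for x
    by (rule poly_eq_sum_multiples[OF coeff_twist_norm_eq_0[OF l_dvd] degree_twist_norm[OF l_dvd]])
  \<comment> \<open>\<open>f ^ (l - 1) * poly ?N y\<close> with each \<open>f * y ^ l\<close>
    replaced by its residue \<open>\<phi>\<close>; the power \<open>l - 1\<close> suffices because
    the norm has degree below \<open>l\<close> in \<open>y ^ l\<close>.\<close>
  define L where "L = (\<Sum>i<l. coeff ?N (l * i) * (f ^ (l - 1 - i) * [:\<phi>:] ^ i))"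
  have "L mod p = (\<Sum>i<l. coeff ?N (l * i) * (f ^ (l - 1 - i) * (f * y ^ l) ^ i)) mod p"
    unfolding L_def by (intro mod_sum_cong mod_mult_cong mod_power_cong refl fy [symmetric])
  also have "(\<Sum>i<l. coeff ?N (l * i) * (f ^ (l - 1 - i) * (f * y ^ l) ^ i)) = f ^ (l - 1) * poly ?N y"
  proof -
    have "f ^ (l - 1 - i) * (f * y ^ l) ^ i = f ^ (l - 1) * (y ^ l) ^ i" if "i < l" for i
    proof -
      have "f ^ (l - 1) = f ^ (l - 1 - i) * f ^ i" using that by (simp flip: power_add)
      then show ?thesis by (simp add: power_mult_distrib)
    qed
    then show ?thesis unfolding polyN sum_distrib_left by (intro sum.cong) (auto simp: mult_ac)
  qed
  also have "\<dots> mod p = 0" using pN by (simp add: dvd_mult mod_eq_0_iff_dvd)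
  finally have "p dvd L" by (simp add: dvd_eq_mod_eq_0)
  have f_deg: "degree f \<le> (l - 1) * D"
    unfolding f_def D_def using m_less by (intro degree_prod_power_le fin) fastforce
  have "degree L \<le> l * d + (l - 1) * ((l - 1) * D)"
    unfolding L_def
  proof (intro degree_sum_le finite_lessThan)
    fix i assume "i \<in> {..<l}"
    have "degree (f ^ (l - 1 - i) * [:\<phi>:] ^ i) \<le> (l - 1) * ((l - 1) * D) + 0"
    proof (rule order_trans[OF degree_mult_le], rule add_mono)
      show "degree (f ^ (l - 1 - i)) \<le> (l - 1) * ((l - 1) * D)"
        by (rule order_trans[OF degree_power_le], subst mult.commute, rule mult_mono[OF _ f_deg]) auto
    qed (simp add: poly_const_pow)
    moreover have "degree (coeff ?N (l * i)) \<le> l * d"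
      by (rule degree_coeff_twist_norm[OF l_dvd R_deg])
    ultimately show "degree (coeff ?N (l * i) * (f ^ (l - 1 - i) * [:\<phi>:] ^ i)) \<le> l * d + (l - 1) * ((l - 1) * D)"
      using degree_mult_le[of "coeff ?N (l * i)" "f ^ (l - 1 - i) * [:\<phi>:] ^ i"] by linarith
  qed
  \<comment> \<open>The norm contributes \<open>l * (l - 1) * D\<close> and the denominators
    \<open>(l - 1)^2 * D\<close>; together they stay below the summand \<open>2 * l^2 * D\<close>
    reserved in the hypothesis on \<open>B\<close>.\<close>
  moreover have "l * d + (l - 1) * ((l - 1) * D) < Q"
  proof -
    have "B > 0" using r[OF a0(1)] by simp
    then obtain b where b: "B = Suc b" by (cases B) auto
    obtain k where k: "l = Suc k" using l_pos by (cases l) auto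
    show ?thesis using B by (simp add: d_def Q_def b k power2_eq_square algebra_simps)
  qed
  ultimately have "degree L < degree p" by (simp add: p_def degree_power_eq)
  with \<open>p dvd L\<close> have L0: "L = 0" by (metis dvd_imp_degree_le not_le)
  let ?emb = "\<lambda>x::'a poly. to_ac (to_fract x)"
  define c' where "c' = to_fract [:\<phi>:] / to_fract f"
  \<comment> \<open>\<open>T\<close> satisfies exactly the equation that \<open>y\<close> satisfies
    modulo \<open>p\<close>. Because \<open>L\<close> is zero and not merely divisible by
    \<open>p\<close>, the norm vanishes at \<open>T\<close>.\<close>
  obtain T where T: "T ^ l = to_ac c'" using nth_root_exists[OF l_pos] by blast
  have emb_f: "?emb f \<noteq> 0" using f0 by simp
  have "poly (map_poly ?emb ?N) T = 0"
  proof -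
    have deg_eq: "degree (map_poly ?emb ?N) = degree ?N" by (rule degree_map_poly) simp
    have "poly (map_poly ?emb ?N) T = (\<Sum>i<l. coeff (map_poly ?emb ?N) (l * i) * (T ^ l) ^ i)"
      by (rule poly_eq_sum_multiples)
         (simp_all add: deg_eq coeff_map_poly coeff_twist_norm_eq_0[OF l_dvd] degree_twist_norm[OF l_dvd])
    also have "\<dots> = (\<Sum>i<l. ?emb (coeff ?N (l * i)) * (?emb [:\<phi>:] / ?emb f) ^ i)"
      by (simp add: T c'_def coeff_map_poly)
    also have "\<dots> = (\<Sum>i<l. ?emb (coeff ?N (l * i) * (f ^ (l - 1 - i) * [:\<phi>:] ^ i)) / ?emb f ^ (l - 1))"
    proof (rule sum.cong[OF refl])
      fix i assume "i \<in> {..<l}"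
      then have "?emb f ^ (l - 1) = ?emb f ^ (l - 1 - i) * ?emb f ^ i" by (simp flip: power_add)
      then show "?emb (coeff ?N (l * i)) * (?emb [:\<phi>:] / ?emb f) ^ i =
          ?emb (coeff ?N (l * i) * (f ^ (l - 1 - i) * [:\<phi>:] ^ i)) / ?emb f ^ (l - 1)"
        using emb_f by (simp add: power_divide to_fract.hom_mult to_fract.hom_power)
    qed
    also have "\<dots> = ?emb L / ?emb f ^ (l - 1)"
      by (simp add: L_def to_fract.hom_sum to_ac_sum sum_divide_distrib)
    finally show ?thesis by (simp add: L0)
  qed
  moreover have "map_poly ?emb p = map_poly to_ac (map_poly to_fract p)" for p
    by (simp add: map_poly_map_poly o_def)
  moreover have "map_poly to_fract ?N = (\<Prod>z\<in>{z. z ^ l = 1}. map_poly to_fract (?P z))"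
    unfolding twist_norm_def by (rule to_fract_poly.hom_prod)
  ultimately have "(\<Prod>z\<in>{z. z ^ l = 1}. poly (map_poly to_ac (map_poly to_fract (?P z))) T) = 0"
    by (simp add: to_ac_poly.hom_prod poly_prod)
  then obtain z where z: "z ^ l = 1" "poly (map_poly to_ac (map_poly to_fract (?P z))) T = 0"
    by auto
  have coeffP: "coeff (?P z) a = smult (z ^ a) (R a)" if "a < l" for a
    using that by (simp add: coeff_sum sum.delta)
  from z l_pos have "z \<noteq> 0" by (auto simp: zero_power)
  moreover have "R a0 \<noteq> 0" using a0 c0 G_nonzero fin by (simp add: R_def)
  ultimately have "?P z \<noteq> 0" using coeffP[OF a0(1)] by force
  moreover have "degree (?P z) < l"
    by (rule degree_sum_less) (auto simp: l_pos intro: le_less_trans[OF degree_monom_le])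
  moreover have "b ^ l \<noteq> ((-1) ^ l * c') ^ k" if "0 < k" "k < l" for k b
    unfolding c'_def f_def by (rule ratio_power_not_power[OF fin deg sqf gcd \<phi>0 that])
  ultimately have "poly (map_poly to_ac (map_poly to_fract (?P z))) T \<noteq> 0"
    by (intro kummer_no_root[of l c' T, OF _ T]) simp_all
  with z(2) show False by contradiction
qed

end

subsection \<open>The auxiliary polynomial\<close>

text \<open>Stated by coefficients and not by degree: \<open>n = 0\<close> then gives
  \<open>{0}\<close>, so the set is always closed under subtraction and the count
  \<open>Q ^ n\<close> has no exception.\<close>

definition polys_below :: "nat \<Rightarrow> 'a::zero poly set" where
  "polys_below n = {p. \<forall>i\<ge>n. coeff p i = 0}"

lemma polys_belowI: "degree p < n \<Longrightarrow> p \<in> polys_below n"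
  by (simp add: polys_below_def coeff_eq_0)

lemma degree_polys_below: "p \<in> polys_below n \<Longrightarrow> 0 < n \<Longrightarrow> degree p < n"
proof (rule ccontr)
  assume "p \<in> polys_below n" "0 < n" "\<not> degree p < n"
  then have "coeff p (degree p) = 0" by (simp add: polys_below_def)
  with \<open>0 < n\<close> \<open>\<not> degree p < n\<close> show False by simp
qed

lemma polys_below_diff: "p \<in> polys_below n \<Longrightarrow> q \<in> polys_below n \<Longrightarrow> p - q \<in> polys_below n"
  for p :: "'a::ab_group_add poly"
  by (simp add: polys_below_def)

lemma bij_betw_polys_below:
  "bij_betw (\<lambda>p. restrict (coeff p) {..<n}) (polys_below n :: 'a::comm_monoid_add poly set) ({..<n} \<rightarrow>\<^sub>E UNIV)"
proof (rule bij_betw_byWitness[where f' = "\<lambda>f. \<Sum>i<n. monom (f i) i"])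
  show "\<forall>p\<in>polys_below n :: 'a poly set. (\<Sum>i<n. monom (restrict (coeff p) {..<n} i) i) = p"
  proof
    fix p :: "'a poly" assume p: "p \<in> polys_below n"
    have "(\<Sum>i<n. monom (restrict (coeff p) {..<n} i) i) = (\<Sum>i<n. monom (coeff p i) i)"
      by (rule sum.cong) auto
    also have "\<dots> = p"
      using p by (intro poly_eqI) (auto simp: polys_below_def coeff_sum not_less)
    finally show "(\<Sum>i<n. monom (restrict (coeff p) {..<n} i) i) = p" .
  qed
  show "\<forall>f\<in>{..<n} \<rightarrow>\<^sub>E (UNIV :: 'a set). restrict (coeff (\<Sum>i<n. monom (f i) i)) {..<n} = f"
    by (auto simp: coeff_sum fun_eq_iff restrict_def PiE_def extensional_def)
  show "(\<lambda>p. restrict (coeff p) {..<n}) ` (polys_below n :: 'a poly set) \<subseteq> ({..<n} \<rightarrow>\<^sub>E UNIV)"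
    by (rule image_subsetI) simp
  show "(\<lambda>f. \<Sum>i<n. monom (f i) i) ` ({..<n} \<rightarrow>\<^sub>E (UNIV :: 'a set)) \<subseteq> polys_below n"
    by (rule image_subsetI) (simp add: polys_below_def coeff_sum)
qed

lemma card_polys_below:
  "card (polys_below n :: 'a::{finite,comm_monoid_add} poly set) = CARD('a) ^ n"
  using bij_betw_same_card[OF bij_betw_polys_below[where 'a = 'a]] by (simp add: card_funcsetE)

lemma finite_polys_below: "finite (polys_below n :: 'a::{finite,comm_monoid_add} poly set)"
  using bij_betw_finite[OF bij_betw_polys_below[where 'a = 'a]] by (simp add: finite_PiE)

lemma card_mult_le_degree:
  fixes p :: "'a::field poly"
  assumes "finite A" "p \<noteq> 0" "\<And>x. x \<in> A \<Longrightarrow> [:-x, 1:] ^ M dvd p"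
  shows "M * card A \<le> degree p"
  using assms
proof (induction A arbitrary: p rule: finite_induct)
  case (insert x A)
  from insert.prems(2)[of x] obtain u where u: "p = [:-x, 1:] ^ M * u" by auto
  with insert.prems have u0: "u \<noteq> 0" by auto
  have "M * card A \<le> degree u"
  proof (rule insert.IH[OF u0])
    fix y assume y: "y \<in> A"
    then have "M \<le> order y p" using insert.prems by (auto simp: order_divides)
    also have "order y p = order y ([:-x, 1:] ^ M) + order y u"
      unfolding u by (rule order_mult) (use u0 in simp)
    also have "order y ([:-x, 1:] ^ M) = 0" using y insert.hyps by (intro order_0I) auto
    finally show "[:-y, 1:] ^ M dvd u" by (simp add: order_divides)
  qed
  then show ?case using insert.hyps u0 by (simp add: u degree_mult_eq degree_power_eq)
qed simp

lemma coeff_mult_const_plus_monom_power: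
  fixes U :: "'a::comm_ring_1 poly"
  assumes "k < n"
  shows "coeff (U * ([:c:] + monom 1 n) ^ j) k = c ^ j * coeff U k"
proof -
  have "\<exists>V. ([:c:] + monom 1 n) ^ j = [:c ^ j:] + monom 1 n * V" for j
  proof (induction j)
    case 0
    then show ?case by (intro exI[of _ 0]) (simp add: one_pCons)
  next
    case (Suc j)
    then obtain V where "([:c:] + monom 1 n) ^ j = [:c ^ j:] + monom 1 n * V" by blast
    then have "([:c:] + monom 1 n) ^ Suc j = [:c ^ Suc j:] + monom 1 n * ([:c:] * V + [:c ^ j:] + monom 1 n * V)"
      by (simp add: algebra_simps)
    then show ?case by blast
  qed
  then obtain V where V: "([:c:] + monom 1 n) ^ j = [:c ^ j:] + monom 1 n * V" by blast
  have "U * ([:c:] + monom 1 n) ^ j = smult (c ^ j) U + monom 1 n * (V * U)"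
    unfolding V by (simp add: algebra_simps)
  then show ?thesis using assms by (simp add: coeff_monom_mult)
qed

text \<open>The \<open>A j\<close> are not reduced modulo \<open>p\<close>, so this is no unique
  expansion in powers of \<open>p\<close>; only the lowest nonzero coefficient can be controlled.
  After cancelling \<open>p ^ j0\<close> every other term still contains a factor
  \<open>p\<close>.\<close>

lemma dvd_coeff_if_expansion_eq_0:
  fixes p :: "'a::idom"
  assumes "p \<noteq> 0" "(\<Sum>j<n. A j * p ^ j) = 0" "j0 < n" "\<And>j. j < j0 \<Longrightarrow> A j = 0"
  shows "p dvd A j0"
proof -
  have "(\<Sum>j<n. A j * p ^ j) = (\<Sum>j\<in>{j0..<n}. A j * p ^ j)"
    using assms by (intro sum.mono_neutral_right) auto
  also have "\<dots> = A j0 * p ^ j0 + (\<Sum>j\<in>{Suc j0..<n}. A j * p ^ j)"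
    using assms(3) by (simp add: sum.atLeast_Suc_lessThan)
  also have "(\<Sum>j\<in>{Suc j0..<n}. A j * p ^ j) = p ^ Suc j0 * (\<Sum>j\<in>{Suc j0..<n}. A j * p ^ (j - Suc j0))"
    unfolding sum_distrib_left
  proof (rule sum.cong[OF refl])
    fix j assume "j \<in> {Suc j0..<n}"
    then have "p ^ j = p ^ Suc j0 * p ^ (j - Suc j0)" by (simp flip: power_add del: power_Suc)
    then show "A j * p ^ j = p ^ Suc j0 * (A j * p ^ (j - Suc j0))" by (simp add: mult_ac)
  qed
  finally have "p ^ j0 * (A j0 + p * (\<Sum>j\<in>{Suc j0..<n}. A j * p ^ (j - Suc j0))) = 0"
    using assms(2) by (simp add: algebra_simps)
  then have "A j0 = p * - (\<Sum>j\<in>{Suc j0..<n}. A j * p ^ (j - Suc j0))"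
    using assms(1) by (simp add: eq_neg_iff_add_eq_0)
  then show ?thesis by (rule dvdI)
qed

text \<open>Pair \<open>a\<close> with \<open>l - a\<close>: the two residues add up to 0 or
  \<open>l\<close>. The average residue is thus below \<open>l / 2\<close>, half of what the trivial
  bound gives, and this halving reappears in \<open>card_index_set\<close>.\<close>

lemma sum_mult_mod_le:
  fixes l m :: nat
  assumes "l > 0"
  shows "2 * (\<Sum>a<l. (a * m) mod l) \<le> l * (l - 1)"
proof -
  have "(\<Sum>a<l. (a * m) mod l) = (\<Sum>a\<in>{0<..<l}. (a * m) mod l)"
    by (rule sum.mono_neutral_right) (auto simp: not_less)
  moreover have "(\<Sum>a\<in>{0<..<l}. (a * m) mod l) = (\<Sum>a\<in>{0<..<l}. ((l - a) * m) mod l)"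
    by (rule sum.reindex_bij_witness[where i = "\<lambda>a. l - a" and j = "\<lambda>a. l - a"]) auto
  ultimately have "2 * (\<Sum>a<l. (a * m) mod l) = (\<Sum>a\<in>{0<..<l}. (a * m) mod l + ((l - a) * m) mod l)"
    by (simp add: sum.distrib)
  also have "\<dots> \<le> (\<Sum>a\<in>{0<..<l}. l)"
  proof (rule sum_mono)
    fix a assume a: "a \<in> {0<..<l}"
    define x y where "x = (a * m) mod l" and "y = ((l - a) * m) mod l"
    have "(x + y) mod l = (a * m + (l - a) * m) mod l" by (simp add: x_def y_def mod_add_eq)
    also have "a * m + (l - a) * m = l * m" using a by (simp flip: add_mult_distrib)
    finally have "l dvd x + y" by (simp add: mod_eq_0_iff_dvd)
    moreover have "x < l" "y < l" using assms by (simp_all add: x_def y_def)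
    ultimately have "x + y \<le> l"
    proof -
      obtain q where q: "x + y = l * q" using \<open>l dvd x + y\<close> ..
      with \<open>x < l\<close> \<open>y < l\<close> have "l * q < l * 2" by linarith
      then have "q \<le> 1" using assms by simp
      then have "l * q \<le> l * 1" by (rule mult_le_mono2)
      with q show ?thesis by simp
    qed
    then show "(a * m) mod l + ((l - a) * m) mod l \<le> l" by (simp add: x_def y_def)
  qed
  also have "\<dots> = l * (l - 1)" by simp
  finally show ?thesis .
qed

section \<open>Hasse derivatives of the auxiliary polynomial and the count of conditions\<close>

context power_residue_family
begin

definition GG :: "'a poly" where "GG = (\<Prod>i\<in>I. G i)"

definition power_product :: "'a poly" where "power_product = (\<Prod>i\<in>I. G i ^ (e * m i))"

lemma degree_GG: "degree GG = D"
  unfolding GG_def D_def using G_nonzero by (intro degree_prod_eq_sum_degree) auto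

lemma GG_nonzero: "GG \<noteq> 0"
  using fin G_nonzero by (simp add: GG_def)

lemma poly_Y:
  assumes "poly GG x \<noteq> 0"
  shows "poly (Y a) x = poly power_product x ^ a"
  unfolding Y_def power_product_def poly_prod prod_power_distrib poly_power
proof (rule prod.cong[OF refl])
  fix i assume i: "i \<in> I"
  then have "poly (G i) x \<noteq> 0" using assms fin by (auto simp: GG_def poly_prod)
  then have unit: "poly (G i) x ^ (l * e) = 1"
    by (metis card_eq finite_field_power_card_minus_1)
  have "e * m i * a = e * (l * (a * m i div l) + a * m i mod l)" by simp
  also have "\<dots> = l * e * (a * m i div l) + e * (a * m i mod l)" by (simp only: algebra_simps)
  finally have "poly (G i) x ^ (e * m i * a) = poly (G i) x ^ (e * (a * m i mod l))"
    by (simp only: power_add power_mult[of _ "l * e"] unit power_one mult_1)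
  then show "poly (G i) x ^ (e * (a * m i mod l)) = (poly (G i) x ^ (e * m i)) ^ a"
    by (simp add: power_mult)
qed

text \<open>A derivative of order \<open>k\<close> lowers the multiplicity of each
  \<open>G i\<close> by at most \<open>k\<close>, and \<open>GG ^ k\<close> restores it.\<close>

lemma Y_dvd_taylor: "Y a dvd GG ^ k * coeff (taylor (r * Y a)) k"
proof -
  \<comment> \<open>This property passes to products, because \<open>taylor\<close> is
    multiplicative and \<open>GG ^ k\<close> splits as \<open>GG ^ i * GG ^ (k - i)\<close>; hence
    only the single factors \<open>G i\<close> need checking.\<close>
  define adm where "adm = (\<lambda>y. \<forall>k. y dvd GG ^ k * coeff (taylor y) k)"
  have mult: "adm (x * y)" if "adm x" "adm y" for x y
    unfolding adm_def
  proof
    fix k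
    have "GG ^ k * coeff (taylor (x * y)) k
        = (\<Sum>i\<le>k. (GG ^ i * coeff (taylor x) i) * (GG ^ (k - i) * coeff (taylor y) (k - i)))"
      unfolding taylor_mult coeff_mult sum_distrib_left
    proof (rule sum.cong[OF refl])
      fix i assume "i \<in> {..k}"
      then have "GG ^ k = GG ^ i * GG ^ (k - i)" by (simp flip: power_add)
      then show "GG ^ k * (coeff (taylor x) i * coeff (taylor y) (k - i)) =
          GG ^ i * coeff (taylor x) i * (GG ^ (k - i) * coeff (taylor y) (k - i))"
        by (simp add: mult_ac)
    qed
    then show "x * y dvd GG ^ k * coeff (taylor (x * y)) k"
      using that by (auto simp: adm_def intro!: dvd_sum mult_dvd_mono)
  qed
  have one: "adm 1" by (simp add: adm_def)
  have G: "adm (G i)" if "i \<in> I" for i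
    unfolding adm_def
  proof
    fix k
    have "G i dvd GG" using that fin by (simp add: GG_def dvd_prodI)
    then show "G i dvd GG ^ k * coeff (taylor (G i)) k"
      by (cases k) (auto simp: coeff_taylor_0 intro: dvd_mult2)
  qed
  have power: "adm (x ^ n)" if "adm x" for x n
    by (induction n) (use that one mult in auto)
  have "adm (\<Prod>i\<in>J. G i ^ f i)" if "finite J" "J \<subseteq> I" for J f
    using that by (induction J rule: finite_induct) (use G power mult one in auto)
  then have Y: "adm (Y a)" using fin by (simp add: Y_def)
  have "GG ^ k * coeff (taylor (r * Y a)) k
      = (\<Sum>i\<le>k. (GG ^ i * coeff (taylor r) i) * (GG ^ (k - i) * coeff (taylor (Y a)) (k - i)))"
    unfolding taylor_mult coeff_mult sum_distrib_left
  proof (rule sum.cong[OF refl])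
    fix i assume "i \<in> {..k}"
    then have "GG ^ k = GG ^ i * GG ^ (k - i)" by (simp flip: power_add)
    then show "GG ^ k * (coeff (taylor r) i * coeff (taylor (Y a)) (k - i)) =
        GG ^ i * coeff (taylor r) i * (GG ^ (k - i) * coeff (taylor (Y a)) (k - i))"
      by (simp add: mult_ac)
  qed
  then show ?thesis using Y by (auto simp: adm_def intro!: dvd_sum dvd_mult[of _ _ "GG ^ _ * coeff (taylor r) _"])
qed

definition taylor_cofactor :: "nat \<Rightarrow> nat \<Rightarrow> 'a poly \<Rightarrow> 'a poly" where
  "taylor_cofactor k a r = (GG ^ k * coeff (taylor (r * Y a)) k) div Y a"

lemma taylor_cofactor_mult: "Y a * taylor_cofactor k a r = GG ^ k * coeff (taylor (r * Y a)) k"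
  unfolding taylor_cofactor_def by (rule dvd_mult_div_cancel[OF Y_dvd_taylor])

lemma taylor_cofactor_diff: "taylor_cofactor k a (r - r') = taylor_cofactor k a r - taylor_cofactor k a r'"
proof -
  have "taylor (x - y) = taylor x - taylor y" for x y :: "'a poly"
    using taylor_add[of "x - y" y] by simp
  then have "Y a * taylor_cofactor k a (r - r') = Y a * (taylor_cofactor k a r - taylor_cofactor k a r')"
    by (simp add: right_diff_distrib taylor_cofactor_mult left_diff_distrib)
  then show ?thesis using Y_nonzero by simp
qed

text \<open>The large degree of \<open>Y a\<close> cancels: differentiation lowers the degree by
  \<open>k\<close>, the factor \<open>GG ^ k\<close> adds \<open>k * D\<close>. This is what makes
  the conditions cheap.\<close>

lemma degree_taylor_cofactor: "degree (taylor_cofactor k a r) \<le> degree r + k * (D - 1)"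
proof (cases "taylor_cofactor k a r = 0")
  case False
  have "coeff (taylor (r * Y a)) k \<noteq> 0"
    using taylor_cofactor_mult[of a k r] False Y_nonzero by auto
  then have "degree (coeff (taylor (r * Y a)) k) + k \<le> degree (r * Y a)" by (rule degree_coeff_taylor)
  also have "\<dots> \<le> degree r + degree (Y a)" by (rule degree_mult_le)
  finally have "degree (coeff (taylor (r * Y a)) k) + k \<le> degree r + degree (Y a)" .
  moreover have "degree (Y a) + degree (taylor_cofactor k a r) = k * D + degree (coeff (taylor (r * Y a)) k)"
    using arg_cong[OF taylor_cofactor_mult[of a k r], of degree] False Y_nonzero GG_nonzero \<open>coeff _ k \<noteq> 0\<close>
    by (simp add: degree_mult_eq degree_power_eq degree_GG)
  ultimately show ?thesis by (simp add: diff_mult_distrib2)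
qed simp

definition weight :: "nat \<Rightarrow> nat" where
  "weight a = (\<Sum>i\<in>I. degree (G i) * ((a * m i) mod l))"

text \<open>Since \<open>Y a\<close> has degree \<open>e * weight a\<close> and
  \<open>l * e = Q - 1\<close>, these are essentially the pairs for which
  \<open>Y a * (X - z0) ^ (Q * j)\<close> has degree below \<open>Q * t / l\<close>. A common degree
  bound uses more pairs than a common bound on \<open>j\<close> would.\<close>

definition index_set :: "nat \<Rightarrow> (nat \<times> nat) set" where
  "index_set t = (SIGMA a:{..<l}. {j. l * j + weight a < t})"

lemma finite_index_fibre: "finite {j. l * j + w < (t::nat)}"
proof (rule finite_subset)
  show "{j. l * j + w < t} \<subseteq> {..<t}"
  proof safe
    fix j assume "l * j + w < t"
    moreover have "j \<le> l * j" using l_pos by simp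
    ultimately show "j < t" by linarith
  qed
qed simp

lemma finite_index_set: "finite (index_set t)"
  unfolding index_set_def by (intro finite_SigmaI finite_lessThan finite_index_fibre)

lemma degree_Y: "degree (Y a) = e * weight a"
proof -
  have "degree (Y a) = (\<Sum>i\<in>I. degree (G i ^ (e * (a * m i mod l))))"
    unfolding Y_def using G_nonzero by (intro degree_prod_eq_sum_degree) auto
  then show ?thesis
    by (simp add: weight_def sum_distrib_left degree_power_eq G_nonzero mult_ac)
qed

text \<open>Each \<open>a\<close> contributes at least \<open>(t - weight a) / l\<close> values of
  \<open>j\<close>, and by \<open>sum_mult_mod_le\<close> the average of \<open>weight a\<close> is
  at most \<open>(l - 1) * D / 2\<close>.\<close>

lemma card_index_set: "2 * t \<le> 2 * card (index_set t) + (l - 1) * D"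
proof -
  have fibre: "t \<le> l * card {j. l * j + w < t} + w" for w
  proof -
    define k where "k = card {j. l * j + w < t}"
    \<comment> \<open>The quotient is \<open>(t - w) / l\<close> rounded up; for
      \<open>t \<le> w\<close> truncated subtraction makes it 0 and the left side empty.\<close>
    have "{..<(t - w + (l - 1)) div l} \<subseteq> {j. l * j + w < t}"
    proof safe
      fix j assume "j < (t - w + (l - 1)) div l"
      then have "Suc j * l \<le> (t - w + (l - 1))"
        using l_pos by (metis Suc_leI less_eq_div_iff_mult_less_eq)
      then show "l * j + w < t" using l_pos by (simp add: mult.commute)
    qed
    then have "card {..<(t - w + (l - 1)) div l} \<le> k"
      unfolding k_def by (intro card_mono finite_index_fibre)
    then have "(t - w + (l - 1)) div l < Suc k" by simp
    then have "t - w + (l - 1) < Suc k * l" using l_pos by (simp add: div_less_iff_less_mult)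
    then show ?thesis using l_pos unfolding k_def [symmetric] by (simp add: mult.commute)
  qed
  have "l * (2 * t) = 2 * (\<Sum>a<l. t)" by simp
  also have "\<dots> \<le> 2 * (\<Sum>a<l. l * card {j. l * j + weight a < t} + weight a)"
    by (intro mult_le_mono2 sum_mono fibre)
  also have "\<dots> = l * (2 * card (index_set t)) + 2 * (\<Sum>a<l. weight a)"
  proof -
    have "card (index_set t) = (\<Sum>a<l. card {j. l * j + weight a < t})"
      unfolding index_set_def by (rule card_SigmaI) (auto intro: finite_index_fibre)
    then show ?thesis by (simp add: sum.distrib sum_distrib_left mult_ac)
  qed
  also have "2 * (\<Sum>a<l. weight a) = (\<Sum>i\<in>I. degree (G i) * (2 * (\<Sum>a<l. (a * m i) mod l)))"
    unfolding weight_def by (subst sum.swap) (simp add: sum_distrib_left mult_ac)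
  also have "\<dots> \<le> (\<Sum>i\<in>I. degree (G i) * (l * (l - 1)))"
    by (intro sum_mono mult_le_mono2 sum_mult_mod_le l_pos)
  also have "\<dots> = l * ((l - 1) * D)"
    by (simp add: D_def sum_distrib_left mult_ac)
  finally have "l * (2 * t) \<le> l * (2 * card (index_set t)) + l * ((l - 1) * D)"
    by simp
  then have "l * (2 * t) \<le> l * (2 * card (index_set t) + (l - 1) * D)"
    by (simp only: distrib_left)
  then show ?thesis using l_pos by simp
qed

text \<open>
  At a point where \<open>power_product\<close> takes the value \<open>z\<close>, and up to a factor \<open>GG ^ k\<close>, this is the \<open>k\<close>-th Hasse
  derivative of the auxiliary polynomial: there \<open>Y a = z ^ a\<close> and \<open>(x - z0) ^ CARD('a) = x - z0\<close>. Its
  degree is small, so it is cheap to require that it vanishes identically.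
\<close>

definition condition :: "nat \<Rightarrow> 'a \<Rightarrow> nat \<Rightarrow> 'a \<Rightarrow> (nat \<times> nat \<Rightarrow> 'a poly) \<Rightarrow> 'a poly" where
  "condition t z0 k z r = (\<Sum>(a, j)\<in>index_set t. smult (z ^ a) (taylor_cofactor k a (r (a, j)) * [:-z0, 1:] ^ j))"

lemma condition_diff:
  "condition t z0 k z (\<lambda>x. r x - r' x) = condition t z0 k z r - condition t z0 k z r'"
  unfolding condition_def
  by (simp add: taylor_cofactor_diff left_diff_distrib smult_diff_right case_prod_unfold sum_subtractf)

lemma condition_below:
  assumes "\<And>x. x \<in> index_set t \<Longrightarrow> degree (r x) < B" "B > 0"
  shows "condition t z0 k z r \<in> polys_below (B + (t - 1) div l + k * (D - 1))"
  unfolding condition_def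
proof (rule polys_belowI, rule degree_sum_less)
  fix x assume "x \<in> index_set t"
  then obtain a j where x: "x = (a, j)" "a < l" "l * j + weight a < t" "degree (r (a, j)) < B"
    using assms(1) by (cases x) (auto simp: index_set_def)
  have "j * l \<le> t - 1" using x by (simp add: mult.commute)
  then have j: "j \<le> (t - 1) div l" using l_pos by (simp add: less_eq_div_iff_mult_less_eq)
  have "degree (taylor_cofactor k a (r (a, j)) * [:-z0, 1:] ^ j)
      \<le> degree (r (a, j)) + k * (D - 1) + j"
    by (rule order_trans[OF degree_mult_le], intro add_mono degree_taylor_cofactor)
       (simp add: degree_power_eq)
  with x(4) j show "degree (case x of (a, j) \<Rightarrow> smult (z ^ a) (taylor_cofactor k a (r (a, j)) * [:-z0, 1:] ^ j))
      < B + (t - 1) div l + k * (D - 1)"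
    unfolding x(1) prod.case by (intro le_less_trans[OF degree_smult_le]) linarith
qed (use assms in simp)

text \<open>A pigeonhole in place of linear algebra: \<open>count\<close> says that the families
  \<open>r\<close> have more free coefficients than the conditions have, so two families share all
  condition polynomials. Since \<open>condition\<close> is additive in \<open>r\<close>, their
  difference satisfies every condition and is not zero.\<close>

lemma exists_auxiliary:
  assumes Z: "finite Z" and B: "B > 0"
    and count: "card Z * (\<Sum>k<M. B + (t - 1) div l + k * (D - 1)) < B * card (index_set t)"
  obtains r x where "\<And>x. x \<in> index_set t \<Longrightarrow> degree (r x) < B"
    "x \<in> index_set t" "r x \<noteq> 0"
    "\<And>k z. k < M \<Longrightarrow> z \<in> Z \<Longrightarrow> condition t z0 k z r = 0"
proof -
  let ?Dom = "index_set t \<rightarrow>\<^sub>E (polys_below B :: 'a poly set)"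
  let ?T = "\<lambda>(k, z::'a). polys_below (B + (t - 1) div l + k * (D - 1)) :: 'a poly set"
  let ?Cod = "PiE ({..<M} \<times> Z) ?T"
  let ?\<Phi> = "\<lambda>r. restrict (\<lambda>(k, z). condition t z0 k z r) ({..<M} \<times> Z)"
  have deg: "degree (r x) < B" if "r \<in> ?Dom" "x \<in> index_set t" for r x
    using that B by (intro degree_polys_below) auto
  have sub: "?\<Phi> ` ?Dom \<subseteq> ?Cod"
  proof (rule image_subsetI, rule restrict_PiE_iff[THEN iffD2], clarify)
    fix r k z assume r: "r \<in> ?Dom"
    show "condition t z0 k z r \<in> polys_below (B + (t - 1) div l + k * (D - 1))"
      by (rule condition_below[OF deg[OF r] B])
  qed
  have "finite ?Cod"
    using Z by (intro finite_PiE) (auto simp: finite_polys_below)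
  then have "card (?\<Phi> ` ?Dom) \<le> card ?Cod" using sub by (rule card_mono)
  also have "card ?Cod = (\<Prod>x\<in>{..<M} \<times> Z. CARD('a) ^ (B + (t - 1) div l + fst x * (D - 1)))"
    using Z by (simp add: card_PiE case_prod_unfold card_polys_below)
  also have "\<dots> = CARD('a) ^ (\<Sum>x\<in>{..<M} \<times> Z. B + (t - 1) div l + fst x * (D - 1))"
    by (rule power_sum [symmetric])
  also have "(\<Sum>x\<in>{..<M} \<times> Z. B + (t - 1) div l + fst x * (D - 1))
      = (\<Sum>k<M. \<Sum>z\<in>Z. B + (t - 1) div l + k * (D - 1))"
    by (simp only: sum.cartesian_product case_prod_unfold)
  also have "\<dots> = card Z * (\<Sum>k<M. B + (t - 1) div l + k * (D - 1))"
    by (simp add: sum_distrib_left)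
  also have "CARD('a) ^ (card Z * (\<Sum>k<M. B + (t - 1) div l + k * (D - 1))) < CARD('a) ^ (B * card (index_set t))"
    by (rule power_strict_increasing[OF count one_less_card_field])
  also have "CARD('a) ^ (B * card (index_set t)) = card ?Dom"
    by (simp add: card_funcsetE finite_index_set card_polys_below power_mult)
  finally have "\<not> inj_on ?\<Phi> ?Dom" by (rule pigeonhole)
  then obtain r r' where r: "r \<in> ?Dom" "r' \<in> ?Dom" "r \<noteq> r'" "?\<Phi> r = ?\<Phi> r'"
    unfolding inj_on_def by blast
  then obtain x where x: "r x \<noteq> r' x" by (auto simp: fun_eq_iff)
  then have "x \<in> index_set t" using PiE_arb[OF r(1)] PiE_arb[OF r(2)] by metis
  show ?thesis
  proof (rule that[of "\<lambda>x. r x - r' x" x])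
    show "degree (r x - r' x) < B" if "x \<in> index_set t" for x
      using deg[OF r(1) that] deg[OF r(2) that] by (rule degree_diff_less)
    show "condition t z0 k z (\<lambda>x. r x - r' x) = 0" if "k < M" "z \<in> Z" for k z
      using fun_cong[OF r(4), of "(k, z)"] that by (simp add: condition_diff)
  qed (use x \<open>x \<in> index_set t\<close> in auto)
qed

lemma stepanov:
  assumes z0: "poly GG z0 \<noteq> 0"
    and B: "B > 0" "l * B + 2 * l\<^sup>2 * D \<le> CARD('a)" and M: "M \<le> CARD('a)"
    and count: "card Z * (\<Sum>k<M. B + (t - 1) div l + k * (D - 1)) < B * card (index_set t)"
  shows "l * (M * card {x. poly GG x \<noteq> 0 \<and> poly power_product x \<in> Z}) < CARD('a) * t"
proof -
  define Q where "Q = CARD('a)"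
  define \<pi> where "\<pi> = [:-z0, 1:] ^ Q"
  obtain r x0 where r: "\<And>x. x \<in> index_set t \<Longrightarrow> degree (r x) < B"
    "x0 \<in> index_set t" "r x0 \<noteq> 0"
    "\<And>k z. k < M \<Longrightarrow> z \<in> Z \<Longrightarrow> condition t z0 k z r = 0"
    by (rule exists_auxiliary[OF _ B(1) count]) auto
  define P where "P = (\<Sum>(a, j)\<in>index_set t. r (a, j) * Y a * \<pi> ^ j)"
  define r' where "r' = (\<lambda>a j. if (a, j) \<in> index_set t then r (a, j) else 0)"
  have z0': "poly (G i) z0 \<noteq> 0" if "i \<in> I" for i
    using z0 that fin by (auto simp: GG_def poly_prod)
  have idx_sub: "index_set t \<subseteq> {..<l} \<times> {..<t}"
  proof safe
    fix a j assume "(a, j) \<in> index_set t"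
    then have "a < l" "l * j + weight a < t" by (auto simp: index_set_def)
    moreover have "j \<le> l * j" using l_pos by simp
    ultimately show "a < l" "j < t" by linarith+
  qed
  have P_eq: "P = (\<Sum>j<t. (\<Sum>a<l. r' a j * Y a) * \<pi> ^ j)"
  proof -
    have "P = (\<Sum>(a, j)\<in>index_set t. r' a j * Y a * \<pi> ^ j)"
      unfolding P_def by (rule sum.cong) (auto simp: r'_def)
    also have "\<dots> = (\<Sum>(a, j)\<in>{..<l} \<times> {..<t}. r' a j * Y a * \<pi> ^ j)"
      using idx_sub by (intro sum.mono_neutral_left) (auto simp: r'_def)
    also have "\<dots> = (\<Sum>a<l. \<Sum>j<t. r' a j * Y a * \<pi> ^ j)"
      by (simp add: sum.cartesian_product)
    finally show ?thesis by (subst (asm) sum.swap) (simp add: sum_distrib_right)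
  qed
  have "P \<noteq> 0"
  proof
    assume "P = 0"
    \<comment> \<open>If \<open>P\<close> were zero, \<open>\<pi>\<close> would divide the lowest
      nonzero row of the expansion in powers of \<open>\<pi>\<close>, which
      \<open>zero_estimate\<close> forbids.\<close>
    define j0 where "j0 = (LEAST j. \<exists>a<l. r' a j \<noteq> 0)"
    obtain a j where "x0 = (a, j)" by force
    then have "a < l" "r' a j \<noteq> 0" using r(2,3) idx_sub by (auto simp: r'_def)
    then have "\<exists>j. \<exists>a<l. r' a j \<noteq> 0" by blast
    then have "\<exists>a<l. r' a j0 \<noteq> 0" unfolding j0_def by (rule LeastI_ex)
    then obtain a0 where a0: "a0 < l" "r' a0 j0 \<noteq> 0" by blast
    have below: "r' a j = 0" if "j < j0" "a < l" for a j
      using not_less_Least[of j "\<lambda>j. \<exists>a<l. r' a j \<noteq> 0"] that unfolding j0_def by blast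
    have "j0 < t" using a0 idx_sub by (auto simp: r'_def split: if_splits)
    have "\<pi> dvd (\<Sum>a<l. r' a j0 * Y a)"
      using \<open>P = 0\<close> below
      by (intro dvd_coeff_if_expansion_eq_0[OF _ _ \<open>j0 < t\<close>, where A = "\<lambda>j. \<Sum>a<l. r' a j * Y a"])
         (auto simp: P_eq \<pi>_def)
    moreover have "\<not> [:-z0, 1:] ^ CARD('a) dvd (\<Sum>a<l. r' a j0 * Y a)"
      by (rule zero_estimate[where r = "\<lambda>a. r' a j0" and ?a0.0 = a0, OF z0' _ a0 B(2)]) (auto simp: r'_def r(1) B(1))
    ultimately show False by (simp add: \<pi>_def Q_def)
  qed
  have root: "[:-x, 1:] ^ M dvd P" if x: "poly GG x \<noteq> 0" "poly power_product x \<in> Z" for x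
  proof (rule linear_power_dvd_if_taylor)
    fix k assume k: "k < M"
    have "k < Q" using k M by (simp add: Q_def)
    let ?c = "x - z0"
    \<comment> \<open>Expanded around \<open>x\<close>, \<open>\<pi>\<close> is a constant plus
      \<open>X ^ Q\<close>. Coefficients below \<open>Q\<close>, and \<open>k < M \<le> Q\<close>,
      see only the constant, so differentiation leaves the factors \<open>\<pi> ^ j\<close>
      alone.\<close>
    have \<pi>: "pcompose \<pi> [:x, 1:] = [:?c:] + monom 1 Q"
    proof -
      have "pcompose \<pi> [:x, 1:] = ([:?c:] + [:0, 1:]) ^ Q"
        by (simp add: \<pi>_def pcompose_hom.hom_power pcompose_pCons)
      also have "\<dots> = [:?c:] + monom 1 Q"
        unfolding Q_def poly_add_power_card
        by (simp add: poly_const_pow finite_field_power_card monom_altdef)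
      finally show ?thesis .
    qed
    have "poly (coeff (taylor P) k) x = coeff (pcompose P [:x, 1:]) k"
      by (simp flip: map_poly_taylor add: coeff_map_poly)
    also have "pcompose P [:x, 1:] =
        (\<Sum>(a, j)\<in>index_set t. pcompose (r (a, j) * Y a) [:x, 1:] * ([:?c:] + monom 1 Q) ^ j)"
      unfolding P_def
      by (simp add: pcompose_sum case_prod_unfold pcompose_mult pcompose_hom.hom_power \<pi>)
    also have "coeff \<dots> k = (\<Sum>(a, j)\<in>index_set t. ?c ^ j * coeff (pcompose (r (a, j) * Y a) [:x, 1:]) k)"
      by (simp add: coeff_sum case_prod_unfold coeff_mult_const_plus_monom_power[OF \<open>k < Q\<close>])
    also have "\<dots> = (\<Sum>(a, j)\<in>index_set t. ?c ^ j * poly (coeff (taylor (r (a, j) * Y a)) k) x)"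
      by (simp flip: map_poly_taylor add: coeff_map_poly)
    finally have eq: "poly (coeff (taylor P) k) x =
        (\<Sum>(a, j)\<in>index_set t. ?c ^ j * poly (coeff (taylor (r (a, j) * Y a)) k) x)" .
    \<comment> \<open>The nonzero factor \<open>poly GG x ^ k\<close> brings in the cofactors; with
      \<open>Y a\<close> evaluated to \<open>poly power_product x ^ a\<close>, what remains is the
      value of \<open>condition\<close> at \<open>x\<close>.\<close>
    have "poly GG x ^ k * poly (coeff (taylor P) k) x =
        (\<Sum>(a, j)\<in>index_set t. ?c ^ j * poly (GG ^ k * coeff (taylor (r (a, j) * Y a)) k) x)"
      unfolding eq by (simp add: sum_distrib_left case_prod_unfold mult_ac)
    also have "\<dots> = (\<Sum>(a, j)\<in>index_set t. ?c ^ j * (poly power_product x ^ a * poly (taylor_cofactor k a (r (a, j))) x))"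
      by (simp only: flip: taylor_cofactor_mult) (simp add: poly_Y[OF x(1)])
    also have "\<dots> = poly (condition t z0 k (poly power_product x) r) x"
      by (simp add: condition_def poly_sum case_prod_unfold mult_ac)
    also have "\<dots> = 0" using r(4)[OF k x(2)] by simp
    finally show "poly (coeff (taylor P) k) x = 0" using x(1) by simp
  qed
  have "M * card {x. poly GG x \<noteq> 0 \<and> poly power_product x \<in> Z} \<le> degree P"
    by (rule card_mult_le_degree[OF _ \<open>P \<noteq> 0\<close>]) (auto intro: root)
  then have "l * (M * card {x. poly GG x \<noteq> 0 \<and> poly power_product x \<in> Z}) \<le> l * degree P"
    by (rule mult_le_mono2)
  also have "\<dots> < Q * t"
  proof -
    have "degree (r (a, j) * Y a * \<pi> ^ j) \<le> (Q * t - 1) div l" if "(a, j) \<in> index_set t" for a j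
    proof -
      have "degree (r (a, j) * Y a * \<pi> ^ j) \<le> (B - 1) + e * weight a + Q * j"
        using r(1)[OF that] degree_mult_le[of "r (a, j)" "Y a"] degree_mult_le[of "r (a, j) * Y a" "\<pi> ^ j"]
        by (simp add: degree_Y \<pi>_def degree_power_eq mult.commute)
      moreover have "((B - 1) + e * weight a + Q * j) * l < Q * t"
      proof -
        \<comment> \<open>The strict inequality in \<open>index_set\<close> leaves one spare
          \<open>Q\<close>, which covers \<open>l * (B - 1)\<close>, the share of
          \<open>r (a, j)\<close>.\<close>
        have "l * j + weight a + 1 \<le> t" using that by (auto simp: index_set_def)
        then have "Q * (l * j + weight a + 1) \<le> Q * t" by (rule mult_le_mono2)
        moreover have "l * e * weight a \<le> Q * weight a"
          by (rule mult_le_mono1) (simp add: Q_def card_Suc)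
        moreover have "l * (B - 1) < Q"
        proof -
          have "l * (B - 1) < l * B" "l * B \<le> Q" using B l_pos by (auto simp: Q_def)
          then show ?thesis by linarith
        qed
        moreover have "Q * (l * j + weight a + 1) = Q * (l * j) + Q * weight a + Q"
          by (simp add: algebra_simps)
        ultimately have "l * (B - 1) + l * e * weight a + Q * (l * j) < Q * t" by linarith
        moreover have "(b + e * weight a + Q * j) * l = l * b + l * e * weight a + Q * (l * j)" for b
          by (simp add: algebra_simps)
        ultimately show ?thesis by (simp only:)
      qed
      ultimately have "degree (r (a, j) * Y a * \<pi> ^ j) * l \<le> Q * t - 1"
        by (metis Suc_diff_1 gr_implies_not0 le_less_trans less_Suc_eq_le mult_le_mono1 neq0_conv)
      then show ?thesis using l_pos by (simp add: less_eq_div_iff_mult_less_eq)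
    qed
    then have "degree P \<le> (Q * t - 1) div l"
      unfolding P_def by (intro degree_sum_le finite_index_set) auto
    then have "degree P * l \<le> Q * t - 1" using l_pos by (simp add: less_eq_div_iff_mult_less_eq)
    moreover have "0 < Q * t"
      using r(2) one_less_card_field[where 'a = 'a] by (auto simp: Q_def index_set_def)
    ultimately have "degree P * l < Q * t" by linarith
    then show ?thesis by (simp add: mult.commute)
  qed
  finally show ?thesis by (simp add: Q_def)
qed

end

section \<open>Choice of the parameters in Stepanov's bound\<close>

text \<open>Twice the inequality \<open>count\<close> of \<open>stepanov\<close>, with
  \<open>\<kappa> = card Z\<close>, \<open>b = B\<close> and \<open>J = (t - 1) div l\<close>. After
  multiplication by \<open>l\<close> the leading term \<open>2 * \<kappa> * M * l * b\<close> occurs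
  on both sides. With \<open>b\<close> near \<open>M^2\<close> and \<open>t\<close> near
  \<open>\<kappa> * M\<close>, what remains is, per factor \<open>l - 1\<close> and in units of
  \<open>M^2\<close>, \<open>2 * (l - 1) + l * (D - 1) < l * (D + 1)\<close>. The gap of
  \<open>2 * M^2\<close> pays for the lower order terms once \<open>M > l^2 * D\<close>.\<close>

lemma stepanov_parameters:
  fixes l D M \<kappa> b J t :: real
  assumes l: "l \<ge> 2" and D: "D \<ge> 1" and \<kappa>: "0 \<le> \<kappa>" "\<kappa> \<le> l - 1" and M: "M \<ge> l\<^sup>2 * D + 1"
    and b: "b \<ge> M\<^sup>2 - 2 * l * D"
    and J: "l * J \<le> t"
    and t: "2 * t \<ge> 2 * \<kappa> * M + (l - 1) * (2 * D + 1)" "2 * t \<le> 2 * \<kappa> * M + 2 * (l - 1) * D + l"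
  shows "\<kappa> * (2 * M * (b + J) + (D - 1) * (M * (M - 1))) < b * (2 * t - (l - 1) * D)"
proof -
  have l2D: "2 * l * D \<le> l\<^sup>2 * D" using l D by (simp add: power2_eq_square mult_right_mono)
  have M0: "M > 0" using M l D by (smt (verit) mult_nonneg_nonneg zero_le_power2)
  have lD: "l \<le> l * D" using l D by (simp add: mult_le_cancel_left1)
  have M1: "2 * (l - 1) * D + l \<le> M"
  proof -
    have "0 \<le> (l - 2) * (l * D)" using l D by simp
    then have "2 * (l * D) \<le> l\<^sup>2 * D" by (simp add: power2_eq_square algebra_simps)
    have "l - 1 \<le> ((l - 1)\<^sup>2 + 1) * D"
    proof -
      have "l - 1 \<le> (l - 1)\<^sup>2 + 1" using l by (smt (verit) sum_squares_bound power2_eq_square mult_left_mono one_le_power self_le_power mult_le_cancel_right1)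
      also have "\<dots> \<le> ((l - 1)\<^sup>2 + 1) * D"
      proof -
        have "0 \<le> (l - 1)\<^sup>2 + 1" by (intro add_nonneg_nonneg) simp_all
        from mult_left_mono[OF D this] show ?thesis by (simp only: mult_1_right)
      qed
      finally show ?thesis .
    qed
    then show ?thesis using M by (simp add: power2_eq_square algebra_simps)
  qed
  \<comment> \<open>The shortfall \<open>2 * l * D\<close> of \<open>b\<close> against
    \<open>M^2\<close>, weighted by \<open>l * (D + 1)\<close>, uses up one \<open>M^2\<close> of
    the gap; \<open>M1\<close> accounts for the other.\<close>
  have M2: "2 * l\<^sup>2 * D * (D + 1) < M\<^sup>2"
  proof -
    have "(l\<^sup>2 * D)\<^sup>2 < M\<^sup>2"
      using M l D by (intro power_strict_mono) auto
    moreover have "2 * D * (D + 1) \<le> l\<^sup>2 * D\<^sup>2"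
    proof -
      have "2 * D * (D + 1) \<le> 2 * D * (2 * D)" using D by (intro mult_left_mono) auto
      also have "\<dots> = 2\<^sup>2 * D\<^sup>2" by (simp add: power2_eq_square)
      also have "\<dots> \<le> l\<^sup>2 * D\<^sup>2" using l by (intro mult_right_mono power_mono) auto
      finally show ?thesis .
    qed
    then have "l\<^sup>2 * (2 * D * (D + 1)) \<le> l\<^sup>2 * (l\<^sup>2 * D\<^sup>2)" by (intro mult_left_mono) auto
    ultimately show ?thesis by (simp add: power_mult_distrib power2_eq_square mult_ac)
  qed
  have main: "M * (2 * (l - 1) * M + 2 * (l - 1) * D + l) + l * (D - 1) * M\<^sup>2 < l * b * (D + 1)"
  proof -
    have "M * (2 * (l - 1) * D + l) \<le> M * M" using M1 M0 by (intro mult_left_mono) auto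
    then have "M * (2 * (l - 1) * D + l) + 2 * l\<^sup>2 * D * (D + 1) < 2 * M\<^sup>2"
      using M2 by (simp add: power2_eq_square)
    then have "M * (2 * (l - 1) * M + 2 * (l - 1) * D + l) + l * (D - 1) * M\<^sup>2
        < l * (D + 1) * (M\<^sup>2 - 2 * l * D)"
      by (simp add: power2_eq_square algebra_simps)
    also have "\<dots> \<le> l * (D + 1) * b" using b l D by (intro mult_left_mono) auto
    finally show ?thesis by (simp add: mult_ac)
  qed
  have b0: "b > 0"
  proof -
    have "2 * l * D \<le> 2 * l\<^sup>2 * D * (D + 1)"
    proof -
      have "l * 1 \<le> l\<^sup>2 * (D + 1)" unfolding power2_eq_square mult.assoc
        using l D by (intro mult_left_mono) (auto intro: order_trans[OF _ mult_mono[of 1 l 1 "D + 1"]])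
      then have "(2 * D) * (l * 1) \<le> (2 * D) * (l\<^sup>2 * (D + 1))" using D by (intro mult_left_mono) auto
      then show ?thesis by (simp add: mult_ac)
    qed
    then show ?thesis using b M2 by linarith
  qed
  have t0: "t \<ge> 0"
  proof -
    have "0 \<le> 2 * \<kappa> * M" "0 \<le> (l - 1) * (2 * D + 1)" using \<kappa> M0 l D by auto
    then show ?thesis using t by linarith
  qed
  have "l * (\<kappa> * (2 * M * (b + J) + (D - 1) * (M * (M - 1))))
      = \<kappa> * (2 * M * l * b + 2 * M * (l * J) + l * (D - 1) * (M * (M - 1)))"
    by (simp add: algebra_simps)
  also have "\<dots> \<le> \<kappa> * (2 * M * l * b + 2 * M * t + l * (D - 1) * M\<^sup>2)"
    using J \<kappa> M0 l D by (intro mult_left_mono add_mono order_refl) (auto simp: power2_eq_square)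
  also have "\<dots> = 2 * \<kappa> * M * l * b + \<kappa> * (2 * M * t + l * (D - 1) * M\<^sup>2)"
    by (simp add: algebra_simps)
  also have "\<kappa> * (2 * M * t + l * (D - 1) * M\<^sup>2) \<le> (l - 1) * (2 * M * t + l * (D - 1) * M\<^sup>2)"
    using \<kappa> M0 t0 l D by (intro mult_right_mono) auto
  also have "(l - 1) * (2 * M * t + l * (D - 1) * M\<^sup>2)
      \<le> (l - 1) * (M * (2 * (l - 1) * M + 2 * (l - 1) * D + l) + l * (D - 1) * M\<^sup>2)"
  proof (intro mult_left_mono add_right_mono)
    have "2 * \<kappa> * M \<le> 2 * (l - 1) * M" using \<kappa> M0 by (intro mult_right_mono) auto
    then have "2 * t \<le> 2 * (l - 1) * M + 2 * (l - 1) * D + l" using t by linarith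
    then have "M * (2 * t) \<le> M * (2 * (l - 1) * M + 2 * (l - 1) * D + l)"
      using M0 by (intro mult_left_mono) auto
    then show "2 * M * t \<le> M * (2 * (l - 1) * M + 2 * (l - 1) * D + l)" by (simp add: mult_ac)
  qed (use l in simp)
  also have "(l - 1) * (M * (2 * (l - 1) * M + 2 * (l - 1) * D + l) + l * (D - 1) * M\<^sup>2)
      < (l - 1) * (l * b * (D + 1))"
    using main l by (intro mult_strict_left_mono) auto
  also have "2 * \<kappa> * M * l * b + (l - 1) * (l * b * (D + 1))
      = l * (b * (2 * \<kappa> * M + (l - 1) * (2 * D + 1) - (l - 1) * D))"
    by (simp add: algebra_simps)
  also have "\<dots> \<le> l * (b * (2 * t - (l - 1) * D))"
    using t b0 l by (intro mult_left_mono) auto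
  finally show ?thesis using l by simp
qed

lemma double_sum_arith: "2 * (\<Sum>k<M. c + k * d) = M * (2 * c) + d * (M * (M - 1))" for M c d :: nat
proof (induction M)
  case (Suc M)
  then show ?case by (cases M) (simp_all add: algebra_simps)
qed simp

context power_residue_family
begin

lemma stepanov_bound:
  assumes l2: "l \<ge> 2" and M: "l\<^sup>2 * D < M" "l * M\<^sup>2 \<le> CARD('a)" and Z: "card Z < l"
  shows "l * (M * card {x. poly GG x \<noteq> 0 \<and> poly power_product x \<in> Z})
    < CARD('a) * (card Z * M + (l - 1) * D + l div 2)"
proof -
  \<comment> \<open>Up to rounding the largest value that \<open>zero_estimate\<close> admits, and
    at least \<open>M^2 - 2 * l * D\<close>.\<close>
  define B where "B = CARD('a) div l - 2 * l * D"
  \<comment> \<open>\<open>card Z * M\<close> yields the expected share \<open>card Z / l\<close> of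
    all points. Of the surplus, \<open>(l - 1) * D / 2\<close> makes up for the loss in
    \<open>card_index_set\<close>, and the rest pays for the degrees of the conditions.\<close>
  define t where "t = card Z * M + (l - 1) * D + l div 2"
  have "I \<noteq> {}" using gcd l2 by auto
  then obtain i where "i \<in> I" by blast
  then have "0 < degree (G i)" "degree (G i) \<le> D" using deg fin by (auto simp: D_def intro: member_le_sum)
  then have D1: "D \<ge> 1" by simp
  have M2: "M\<^sup>2 \<le> CARD('a) div l" using M(2) l_pos by (simp add: less_eq_div_iff_mult_less_eq mult.commute)
  have "l * D < M" "0 < M"
    using M(1) l_pos by (auto simp: power2_eq_square intro: le_less_trans[rotated])
  have "2 * l * D < M\<^sup>2"
  proof -
    have "2 * (l * D) \<le> l * (l * D)" using l2 by (rule mult_le_mono1)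
    also have "\<dots> < M * 1" using M(1) by (simp add: power2_eq_square mult_ac)
    also have "\<dots> \<le> M * M" using \<open>0 < M\<close> by (intro mult_le_mono2) simp
    finally show ?thesis by (simp add: power2_eq_square mult_ac)
  qed
  then have B0: "B > 0" and BM: "M\<^sup>2 \<le> B + 2 * l * D" using M2 by (auto simp: B_def)
  have B: "l * B + 2 * l\<^sup>2 * D \<le> CARD('a)"
  proof -
    have "l * (B + 2 * l * D) = l * (CARD('a) div l)"
      using \<open>2 * l * D < M\<^sup>2\<close> M2 by (simp add: B_def)
    also have "\<dots> \<le> CARD('a)" by simp
    finally show ?thesis by (simp add: power2_eq_square algebra_simps)
  qed
  have MQ: "M \<le> CARD('a)"
  proof -
    have "M * 1 \<le> l * M\<^sup>2" using l_pos \<open>0 < M\<close> by (simp add: power2_eq_square mult_le_mono Suc_leI)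
    then show ?thesis using M(2) by simp
  qed
  have "\<exists>z0. poly GG z0 \<noteq> 0"
  proof (rule ccontr)
    assume "\<not> ?thesis"
    then have "CARD('a) \<le> D"
      using card_poly_roots_bound[OF GG_nonzero] by (simp add: degree_GG)
    moreover have "D * 1 \<le> l * D" using l_pos by simp
    ultimately show False using \<open>l * D < M\<close> MQ by linarith
  qed
  then obtain z0 where z0: "poly GG z0 \<noteq> 0" by blast
  have "card Z * (\<Sum>k<M. B + (t - 1) div l + k * (D - 1)) < B * card (index_set t)"
  proof -
    define J where "J = (t - 1) div l"
    have "l * J \<le> t - 1" by (simp add: J_def)
    then have lJ: "l * J \<le> t" by linarith
    have tau: "2 * (l div 2) \<ge> l - 1" "2 * (l div 2) \<le> l" by linarith+
    have nat1: "2 * t \<ge> 2 * card Z * M + (l - 1) * (2 * D + 1)" "2 * t \<le> 2 * card Z * M + 2 * (l - 1) * D + l"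
      using tau by (simp_all add: t_def algebra_simps)
    have sub: "real (l - 1) = real l - 1" "real (D - 1) = real D - 1" "real (M - 1) = real M - 1"
      using l2 D1 \<open>0 < M\<close> by (simp_all add: of_nat_diff)
    have "real (card Z) * (2 * real M * (real B + real J) + (real D - 1) * (real M * (real M - 1)))
        < real B * (2 * real t - (real l - 1) * real D)"
    proof (rule stepanov_parameters)
      show "real (card Z) \<le> real l - 1" using Z by linarith
      have "real (l\<^sup>2 * D + 1) \<le> real M" using M(1) by (simp only: of_nat_le_iff)
      then show "(real l)\<^sup>2 * real D + 1 \<le> real M" by simp
      have "real (M\<^sup>2) \<le> real (B + 2 * l * D)" using BM by (simp only: of_nat_le_iff)
      then show "(real M)\<^sup>2 - 2 * real l * real D \<le> real B" by simp
      have "real (l * J) \<le> real t" using lJ by (simp only: of_nat_le_iff)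
      then show "real l * real J \<le> real t" by simp
      have "real (2 * card Z * M + (l - 1) * (2 * D + 1)) \<le> real (2 * t)" using nat1(1) by (simp only: of_nat_le_iff)
      then show "2 * real (card Z) * real M + (real l - 1) * (2 * real D + 1) \<le> 2 * real t"
        by (simp only: of_nat_add of_nat_mult of_nat_numeral of_nat_1 sub)
      have "real (2 * t) \<le> real (2 * card Z * M + 2 * (l - 1) * D + l)" using nat1(2) by (simp only: of_nat_le_iff)
      then show "2 * real t \<le> 2 * real (card Z) * real M + 2 * (real l - 1) * real D + real l"
        by (simp only: of_nat_add of_nat_mult of_nat_numeral of_nat_1 sub)
    qed (use l2 D1 in auto)
    also have "real B * (2 * real t - (real l - 1) * real D) \<le> real B * (2 * real (card (index_set t)))"
    proof (intro mult_left_mono)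
      have "real (2 * t) \<le> real (2 * card (index_set t) + (l - 1) * D)"
        using card_index_set by (simp only: of_nat_le_iff)
      then show "2 * real t - (real l - 1) * real D \<le> 2 * real (card (index_set t))"
        unfolding of_nat_add of_nat_mult of_nat_numeral sub by simp
    qed simp
    finally have "real (card Z * (2 * (\<Sum>k<M. (B + J) + k * (D - 1)))) < real (B * (2 * card (index_set t)))"
      unfolding double_sum_arith of_nat_mult of_nat_add of_nat_numeral sub by (simp only: mult_ac)
    then have "card Z * (2 * (\<Sum>k<M. (B + J) + k * (D - 1))) < B * (2 * card (index_set t))"
      by (simp only: of_nat_less_iff)
    then show ?thesis by (simp add: J_def)
  qed
  from stepanov[OF z0 B0 B MQ this] show ?thesis by (simp add: t_def)
qed

end

subsection \<open>Primary polynomials and elements of smaller degree\<close>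

text \<open>Fermat's argument in the residue ring: unless \<open>g\<close> divides \<open>X\<close>,
  multiplication by \<open>X\<close> permutes the \<open>q ^ degree g - 1\<close> nonzero residues,
  and the product of all of them can be cancelled.\<close>

lemma irreducible_dvd_X_power_card:
  fixes g :: "'a::{finite,field} poly"
  assumes g: "irreducible g"
  shows "g dvd [:0, 1:] ^ (CARD('a) ^ degree g) - [:0, 1:]"
proof (cases "g dvd [:0, 1:]")
  case True
  then show ?thesis
    by (intro dvd_diff dvd_trans[OF True dvd_power]) simp_all
next
  case False
  let ?X = "[:0, 1:] :: 'a poly" and ?R = "polys_below (degree g) - {0 :: 'a poly}"
  have prime: "prime_elem g" using g by (rule field_poly_irreducible_imp_prime)
  have g0: "g \<noteq> 0" and deg: "degree g > 0"
    using g by (auto simp: irreducible_def is_unit_iff_degree intro: Nat.gr0I)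
  have not_dvd: "\<not> g dvd r" if "r \<in> ?R" for r
    using that deg degree_polys_below[of r "degree g"] dvd_imp_degree_le[of g r] by auto
  have fin: "finite ?R" by (simp add: finite_polys_below)
  have bij: "bij_betw (\<lambda>r. (?X * r) mod g) ?R ?R"
  proof -
    have sub: "(\<lambda>r. (?X * r) mod g) ` ?R \<subseteq> ?R"
    proof (rule image_subsetI)
      fix r assume r: "r \<in> ?R"
      have "\<not> g dvd ?X * r" using False not_dvd[OF r] prime by (simp add: prime_elem_dvd_mult_iff del: mult_pCons_left)
      then have "(?X * r) mod g \<noteq> 0" by (simp add: dvd_eq_mod_eq_0 del: mult_pCons_left)
      moreover from this have "degree ((?X * r) mod g) < degree g"
        using g0 by (rule degree_mod_less'[rotated])
      ultimately show "(?X * r) mod g \<in> ?R" by (auto intro: polys_belowI)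
    qed
    moreover have "inj_on (\<lambda>r. (?X * r) mod g) ?R"
    proof (rule inj_onI)
      fix r s assume rs: "r \<in> ?R" "s \<in> ?R" "(?X * r) mod g = (?X * s) mod g"
      then have "g dvd ?X * (r - s)" by (simp only: mod_eq_dvd_iff right_diff_distrib)
      then have "g dvd r - s" using False prime by (simp add: prime_elem_dvd_mult_iff del: mult_pCons_left)
      moreover have "r - s \<in> polys_below (degree g)" using rs by (auto intro: polys_below_diff)
      ultimately show "r = s" using not_dvd[of "r - s"] by auto
    qed
    ultimately show ?thesis using fin by (simp add: bij_betw_def card_subset_eq card_image)
  qed
  have "(?X ^ card ?R * (\<Prod>r\<in>?R. r)) mod g = (\<Prod>r\<in>?R. ?X * r) mod g"
    by (simp add: prod.distrib del: mult_pCons_left)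
  also have "\<dots> = (\<Prod>r\<in>?R. (?X * r) mod g) mod g"
    by (rule mod_prod_cong) simp
  also have "(\<Prod>r\<in>?R. (?X * r) mod g) = (\<Prod>r\<in>?R. r)"
    by (rule prod.reindex_bij_betw[OF bij])
  finally have "g dvd ?X ^ card ?R * (\<Prod>r\<in>?R. r) - (\<Prod>r\<in>?R. r)"
    by (simp only: mod_eq_dvd_iff)
  then have "g dvd (?X ^ card ?R - 1) * (\<Prod>r\<in>?R. r)"
    by (simp only: left_diff_distrib mult_1_left)
  moreover have "\<not> g dvd (\<Prod>r\<in>?R. r)"
  proof -
    have "\<not> g dvd (\<Prod>r\<in>A. r)" if "finite A" "A \<subseteq> ?R" for A
      using that
    proof (induction A rule: finite_induct)
      case empty
      then show ?case using prime_elem_not_unit[OF prime] by (simp only: prod.empty not_False_eq_True)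
    next
      case (insert r A)
      then show ?case using not_dvd[of r] prime by (simp add: prime_elem_dvd_mult_iff)
    qed
    then show ?thesis using fin by blast
  qed
  ultimately have "g dvd ?X ^ card ?R - 1" using prime by (simp add: prime_elem_dvd_mult_iff)
  then have "g dvd ?X * (?X ^ card ?R - 1)" by (rule dvd_mult)
  also have "?X * (?X ^ card ?R - 1) = ?X ^ Suc (card ?R) - ?X"
    by (simp only: right_diff_distrib power_Suc mult_1_right)
  also have "Suc (card ?R) = CARD('a) ^ degree g"
  proof -
    have "(0 :: 'a poly) \<in> polys_below (degree g)" by (simp add: polys_below_def)
    then have "Suc (card ?R) = card (polys_below (degree g) :: 'a poly set)"
      by (simp only: card.remove[OF finite_polys_below])
    then show ?thesis by (simp add: card_polys_below)
  qed
  finally show ?thesis .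
qed

lemma X_power_iterate:
  fixes g :: "'a::{finite,field} poly"
  assumes "g dvd [:0, 1:] ^ N - [:0, 1:]"
  shows "g dvd [:0, 1:] ^ (N ^ c) - [:0, 1:]"
proof (induction c)
  case (Suc c)
  have "[:0, 1:] ^ N mod g = [:0, 1:] mod g" using assms by (simp only: mod_eq_dvd_iff)
  then have "([:0, 1:] ^ N) ^ (N ^ c) mod g = [:0, 1:] ^ (N ^ c) mod g" by (rule mod_power_cong)
  also have "\<dots> = [:0, 1:] mod g" using Suc.IH by (simp only: mod_eq_dvd_iff)
  finally show ?case by (simp only: mod_eq_dvd_iff power_mult [symmetric] power_Suc)
qed simp

lemma prod_dvd_if_irreducible_dvd:
  fixes f :: "'i \<Rightarrow> 'a::field poly"
  assumes "finite A" "\<And>i. i \<in> A \<Longrightarrow> irreducible (f i)" "\<And>i. i \<in> A \<Longrightarrow> lead_coeff (f i) = 1"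
    and "inj_on f A" "\<And>i. i \<in> A \<Longrightarrow> f i dvd t"
  shows "(\<Prod>i\<in>A. f i) dvd t"
  using assms
proof (induction A rule: finite_induct)
  case (insert a A)
  then obtain u where u: "t = (\<Prod>i\<in>A. f i) * u" by (auto elim!: dvdE)
  have prime: "prime_elem (f a)" using insert by (intro field_poly_irreducible_imp_prime) auto
  have neq: "\<not> f a dvd f i" if "i \<in> A" for i
  proof
    assume "f a dvd f i"
    then obtain v where v: "f i = f a * v" ..
    moreover have "irreducible (f i)" "\<not> is_unit (f a)"
      using insert.prems(1) that irreducible_not_unit by blast+
    ultimately have "is_unit v" using irreducibleD by blast
    then have "degree v = 0" by (auto simp: is_unit_iff_degree)
    then obtain c where c: "v = [:c:]" by (rule degree_eq_zeroE)
    have "lead_coeff (f i) = lead_coeff (f a) * lead_coeff v" by (simp only: v lead_coeff_mult)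
    then have "c = 1" using insert.prems that by (simp add: c)
    with v c have "f i = f a" by simp
    then show False using insert.prems(3) insert.hyps that by (metis inj_onD insertCI)
  qed
  have "\<not> f a dvd (\<Prod>i\<in>B. f i)" if "finite B" "B \<subseteq> A" for B
    using that
  proof (induction B rule: finite_induct)
    case empty
    then show ?case using prime_elem_not_unit[OF prime] by (simp only: prod.empty not_False_eq_True)
  next
    case (insert i B)
    then show ?case using neq prime by (simp add: prime_elem_dvd_mult_iff)
  qed
  then have "\<not> f a dvd (\<Prod>i\<in>A. f i)" using insert.hyps by blast
  moreover have "f a dvd (\<Prod>i\<in>A. f i) * u" using insert.prems(4)[of a] u by simp
  ultimately have "f a dvd u" using prime by (simp add: prime_elem_dvd_mult_iff)
  then show ?case using insert.hyps u by (auto simp: mult_ac elim!: dvdE)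
qed simp

text \<open>As \<open>N\<close> is zero in the field, the derivative is the constant -1, so no root
  can be multiple.\<close>

lemma order_X_power_card_diff_X:
  fixes \<rho> :: "'a::{finite,field} alg_closure"
  assumes "d > 0" "of_nat N = (0 :: 'a)"
  shows "order \<rho> ([:0, 1:] ^ (N ^ d) - [:0, 1:]) \<le> 1"
proof (rule ccontr)
  let ?T = "[:0, 1:] ^ (N ^ d) - [:0, 1:] :: 'a alg_closure poly"
  assume "\<not> order \<rho> ?T \<le> 1"
  then have "[:-\<rho>, 1:] ^ 2 dvd ?T" by (intro order_divides[THEN iffD2]) auto
  then obtain u where u: "?T = [:-\<rho>, 1:] ^ 2 * u" by auto
  have "poly (pderiv ([:-\<rho>, 1:] ^ 2 * u)) \<rho> = 0"
    by (simp only: power2_eq_square mult.assoc pderiv_mult poly_add poly_mult) simp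
  moreover have "(of_nat N :: 'a alg_closure) = 0"
    using assms(2) by (metis to_ac_of_nat to_ac_0)
  then have "(of_nat (N ^ d) :: 'a alg_closure) = 0" using assms(1) by simp
  then have "pderiv ?T = -1"
    by (simp add: pderiv_diff pderiv_power pderiv_pCons one_pCons flip: of_nat_power)
  ultimately show False unfolding u [symmetric] by simp
qed

section \<open>Minimal polynomials and elements of proper subfields\<close>

locale finite_field_extension = field_hom h
  for h :: "'k::{finite,field} \<Rightarrow> 'l::{finite,field}" +
  fixes n :: nat
  assumes card_ext: "CARD('l) = CARD('k) ^ n" and n_pos: "n > 0"
begin

sublocale hp: map_poly_inj_idom_hom h ..


lemma eval_simps:
  "eval_over h (p + r) x = eval_over h p x + eval_over h r x"
  "eval_over h (p - r) x = eval_over h p x - eval_over h r x"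
  "eval_over h (p * r) x = eval_over h p x * eval_over h r x"
  "eval_over h (p ^ k) x = eval_over h p x ^ k"
  "eval_over h [:0, 1:] x = x"
  by (simp_all add: eval_over_def hp.hom_add hp.hom_minus hp.hom_mult hp.hom_power map_poly_pCons)

lemma eval_eq_0_if_dvd: "p dvd r \<Longrightarrow> eval_over h p x = 0 \<Longrightarrow> eval_over h r x = 0"
  by (auto simp: eval_simps elim!: dvdE)

lemma X_power_diff_X_nonzero: "N > 1 \<Longrightarrow> [:0, 1:] ^ N - [:0, 1:] \<noteq> (0 :: 'c::field poly)"
proof
  assume N: "N > 1" and "[:0, 1:] ^ N - [:0, 1:] = (0 :: 'c poly)"
  then have "[:0, 1:] ^ N = ([:0, 1:] :: 'c poly)" by simp
  then have "degree ([:0, 1:] ^ N :: 'c poly) = degree ([:0, 1:] :: 'c poly)" by (rule arg_cong)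
  then show False using N by (simp add: degree_power_eq)
qed

lemma min_poly_exists: obtains m where "is_min_poly h \<alpha> m"
proof -
  define A where "A = (\<lambda>p. p \<noteq> 0 \<and> eval_over h p \<alpha> = 0)"
  have "A ([:0, 1:] ^ CARD('l) - [:0, 1:])"
    using X_power_diff_X_nonzero[OF one_less_card_field[where 'a = 'l]]
    by (simp only: A_def eval_simps finite_field_power_card) simp
  then obtain p where p: "A p" "\<And>r. A r \<Longrightarrow> degree p \<le> degree r"
    using exists_least_iff[of "\<lambda>k. \<exists>p. A p \<and> degree p = k"] by (metis not_le)
  have lc: "lead_coeff p \<noteq> 0" using p(1) by (simp add: A_def)
  have "is_min_poly h \<alpha> (smult (inverse (lead_coeff p)) p)"
    unfolding is_min_poly_def
  proof (intro conjI allI impI)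
    show "lead_coeff (smult (inverse (lead_coeff p)) p) = 1" using lc by simp
    show "eval_over h (smult (inverse (lead_coeff p)) p) \<alpha> = 0"
      using p(1) by (simp add: eval_over_def A_def hom_distribs)
    show "degree (smult (inverse (lead_coeff p)) p) \<le> degree r" if "r \<noteq> 0 \<and> eval_over h r \<alpha> = 0" for r
      using p(2)[of r] that lc by (simp add: A_def)
  qed
  then show ?thesis by (rule that)
qed

lemma min_poly_degree_pos:
  assumes "is_min_poly h \<alpha> m" shows "degree m > 0"
proof (rule ccontr)
  assume "\<not> degree m > 0"
  then obtain c where "m = [:c:]" by (auto elim: degree_eq_zeroE)
  then have "m = 1" using assms by (simp add: is_min_poly_def one_pCons)
  then show False using assms by (simp add: is_min_poly_def eval_over_def)
qed

lemma min_poly_irreducible: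
  assumes m: "is_min_poly h \<alpha> m" shows "irreducible m"
proof (rule irreducibleI)
  show "m \<noteq> 0" using m by (auto simp: is_min_poly_def)
  then show "\<not> is_unit m" using min_poly_degree_pos[OF m] by (simp add: is_unit_iff_degree)
  fix a b assume ab: "m = a * b"
  then have ab0: "a \<noteq> 0" "b \<noteq> 0" using \<open>m \<noteq> 0\<close> by auto
  have "eval_over h a \<alpha> = 0 \<or> eval_over h b \<alpha> = 0"
    using m by (simp add: ab is_min_poly_def eval_simps)
  then have "degree m \<le> degree a \<or> degree m \<le> degree b"
    using m ab0 by (auto simp: is_min_poly_def)
  then have "degree a = 0 \<or> degree b = 0" using ab0 by (auto simp: ab degree_mult_eq)
  then show "is_unit a \<or> is_unit b" using ab0 by (auto simp: is_unit_iff_degree)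
qed

text \<open>Polynomials of degree below that of \<open>m\<close> take distinct values at
  \<open>\<alpha>\<close>, and only \<open>q ^ n\<close> values are available.\<close>

lemma min_poly_degree_le:
  assumes m: "is_min_poly h \<alpha> m" shows "degree m \<le> n"
proof -
  let ?S = "polys_below (degree m) :: 'k poly set"
  have "inj_on (\<lambda>p. eval_over h p \<alpha>) ?S"
  proof (rule inj_onI)
    fix p r assume pr: "p \<in> ?S" "r \<in> ?S" "eval_over h p \<alpha> = eval_over h r \<alpha>"
    show "p = r"
    proof (rule ccontr)
      assume "p \<noteq> r"
      then have "degree m \<le> degree (p - r)"
        using m pr by (simp add: is_min_poly_def eval_simps)
      moreover have "p - r \<in> ?S" using pr by (intro polys_below_diff)
      ultimately show False using degree_polys_below[OF _ min_poly_degree_pos[OF m]] by fastforce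
    qed
  qed
  then have "card ?S \<le> CARD('l)" by (rule card_inj_on_le) auto
  then have "CARD('k) ^ degree m \<le> CARD('k) ^ n" by (simp add: card_polys_below card_ext)
  then show ?thesis by (rule power_le_imp_le_exp[OF one_less_card_field])
qed

lemma min_poly_power:
  assumes m: "is_min_poly h \<alpha> m" shows "\<alpha> ^ (CARD('k) ^ degree m) = \<alpha>"
proof -
  have "eval_over h ([:0, 1:] ^ (CARD('k) ^ degree m) - [:0, 1:]) \<alpha> = 0"
    using m by (intro eval_eq_0_if_dvd[OF irreducible_dvd_X_power_card[OF min_poly_irreducible[OF m]]])
               (simp add: is_min_poly_def)
  then show ?thesis by (simp only: eval_simps) simp
qed

lemma power_card_mod:
  assumes "\<alpha> ^ (CARD('k) ^ g) = \<alpha>" "\<alpha> ^ (CARD('k) ^ i) = (\<alpha> :: 'l)"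
  shows "\<alpha> ^ (CARD('k) ^ (i mod g)) = \<alpha>"
proof -
  have iter: "\<alpha> ^ (CARD('k) ^ (g * c)) = \<alpha>" for c
  proof (induction c)
    case (Suc c)
    have "\<alpha> ^ (CARD('k) ^ (g * Suc c)) = (\<alpha> ^ (CARD('k) ^ g)) ^ (CARD('k) ^ (g * c))"
      by (simp only: mult_Suc_right power_add power_mult)
    then show ?case using Suc by (simp add: assms)
  qed simp
  have "\<alpha> = \<alpha> ^ (CARD('k) ^ (g * (i div g) + i mod g))" using assms(2) by simp
  also have "\<dots> = (\<alpha> ^ (CARD('k) ^ (g * (i div g)))) ^ (CARD('k) ^ (i mod g))"
    by (simp only: power_add power_mult)
  finally show ?thesis by (simp only: iter)
qed

text \<open>Take the least positive \<open>g\<close> with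
  \<open>\<alpha> ^ (q ^ g) = \<alpha>\<close>. Exponents with this property are closed under
  remainders and include \<open>n\<close>, so \<open>g\<close> divides \<open>n\<close>; they also
  include the degree of the minimal polynomial, which is below \<open>n\<close>.\<close>

lemma in_subfield_if_degree_less:
  assumes "\<not> has_degree_over h \<alpha> n"
  obtains g where "g dvd n" "g < n" "0 < g" "\<alpha> ^ (CARD('k) ^ g) = \<alpha>"
proof -
  obtain m where m: "is_min_poly h \<alpha> m" by (rule min_poly_exists)
  define P where "P = (\<lambda>i. 0 < i \<and> \<alpha> ^ (CARD('k) ^ i) = \<alpha>)"
  have Pm: "P (degree m)" using min_poly_power[OF m] min_poly_degree_pos[OF m] by (simp add: P_def)
  define g where "g = (LEAST i. P i)"
  have g: "P g" unfolding g_def using Pm by (rule LeastI)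
  have "degree m \<noteq> n" using assms m by (auto simp: has_degree_over_def)
  then have "degree m < n" using min_poly_degree_le[OF m] by simp
  moreover have "g \<le> degree m" unfolding g_def using Pm by (rule Least_le)
  ultimately have "g < n" by simp
  have "\<alpha> ^ (CARD('k) ^ n) = \<alpha>" using finite_field_power_card[of \<alpha>] by (simp only: card_ext)
  then have "\<alpha> ^ (CARD('k) ^ (n mod g)) = \<alpha>" using g by (intro power_card_mod) (auto simp: P_def)
  moreover have "\<not> P (n mod g)"
  proof -
    have "n mod g < g" using g by (simp add: P_def)
    then show ?thesis unfolding g_def by (rule not_less_Least)
  qed
  ultimately have "n mod g = 0" by (simp add: P_def)
  then show ?thesis using that[of g] \<open>g < n\<close> g by (auto simp: P_def)
qed

lemma card_fixed_le: "g > 0 \<Longrightarrow> card {\<alpha>::'l. \<alpha> ^ (CARD('k) ^ g) = \<alpha>} \<le> CARD('k) ^ g"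
proof -
  assume g: "g > 0"
  let ?T = "[:0, 1:] ^ (CARD('k) ^ g) - [:0, 1:] :: 'l poly"
  have N: "CARD('k) ^ g > 1" using one_less_power[OF one_less_card_field[where 'a = 'k] g] .
  then have "?T \<noteq> 0" by (rule X_power_diff_X_nonzero)
  moreover have "{\<alpha>::'l. \<alpha> ^ (CARD('k) ^ g) = \<alpha>} = {\<alpha>. poly ?T \<alpha> = 0}" by auto
  moreover have "degree ?T \<le> CARD('k) ^ g"
    using N by (intro degree_diff_le order_trans[OF degree_power_le]) auto
  ultimately show ?thesis using card_poly_roots_bound[of ?T] by simp
qed

lemma sum_power_le: "b \<ge> 2 \<Longrightarrow> (\<Sum>i\<in>{1..k}. b ^ i) \<le> 2 * b ^ k" for b :: nat
proof (induction k)
  case (Suc k)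
  have "2 * b ^ k \<le> b ^ Suc k" using mult_le_mono1[OF Suc.prems] by (simp only: power_Suc)
  moreover have "(\<Sum>i\<in>{1..Suc k}. b ^ i) = (\<Sum>i\<in>{1..k}. b ^ i) + b ^ Suc k" by simp
  ultimately show ?case using Suc.IH[OF Suc.prems] by linarith
qed simp

text \<open>A proper divisor of \<open>n\<close> is \<open>n / 2\<close> or at most
  \<open>n / 3\<close>. The first accounts for the square root; a geometric sum over all exponents
  up to \<open>n div 3\<close> covers the others.\<close>

lemma card_lower_degree_le:
  "real (card {\<alpha>. \<not> has_degree_over h \<alpha> n}) \<le> sqrt (CARD('l)) + 2 * real (CARD('k) ^ (n div 3))"
proof -
  let ?D = "{g. g dvd n \<and> g < n \<and> 0 < g}"
  have fin: "finite ?D" by (rule finite_subset[of _ "{..<n}"]) auto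
  have "{\<alpha>. \<not> has_degree_over h \<alpha> n} \<subseteq> (\<Union>g\<in>?D. {\<alpha>. \<alpha> ^ (CARD('k) ^ g) = \<alpha>})"
    using in_subfield_if_degree_less by blast
  then have "card {\<alpha>. \<not> has_degree_over h \<alpha> n} \<le> card (\<Union>g\<in>?D. {\<alpha>::'l. \<alpha> ^ (CARD('k) ^ g) = \<alpha>})"
    by (intro card_mono) auto
  also have "\<dots> \<le> (\<Sum>g\<in>?D. card {\<alpha>::'l. \<alpha> ^ (CARD('k) ^ g) = \<alpha>})"
    by (rule card_UN_le[OF fin])
  also have "\<dots> \<le> (\<Sum>g\<in>?D. CARD('k) ^ g)"
    by (intro sum_mono card_fixed_le) auto
  also have "\<dots> \<le> (\<Sum>g\<in>{g. 2 * g = n} \<union> {1..n div 3}. CARD('k) ^ g)"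
  proof (rule sum_mono2)
    show "?D \<subseteq> {g. 2 * g = n} \<union> {1..n div 3}"
    proof
      fix g assume "g \<in> ?D"
      then obtain c where c: "n = g * c" "g < n" "0 < g" by auto
      then have "c \<noteq> 0" "c \<noteq> 1" by auto
      then consider "c = 2" | "c \<ge> 3" by linarith
      then show "g \<in> {g. 2 * g = n} \<union> {1..n div 3}"
      proof cases
        case 2
        then have "g * 3 \<le> n" unfolding c(1) by (rule mult_le_mono2)
        then have "g \<le> n div 3" by (simp add: less_eq_div_iff_mult_less_eq)
        then show ?thesis using c(3) by simp
      qed (use c in auto)
    qed
    have "finite {g. 2 * g = n}" by (rule finite_subset[of _ "{..n}"]) auto
    then show "finite ({g. 2 * g = n} \<union> {1..n div 3})" by simp
  qed simp
  also have "\<dots> \<le> (\<Sum>g\<in>{g. 2 * g = n}. CARD('k) ^ g) + (\<Sum>g\<in>{1..n div 3}. CARD('k) ^ g)"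
    by (subst sum_Un_nat) (auto intro: finite_subset[of _ "{..n}"])
  also have "(\<Sum>g\<in>{1..n div 3}. CARD('k) ^ g) \<le> 2 * CARD('k) ^ (n div 3)"
    using one_less_card_field[where 'a = 'k] by (intro sum_power_le) simp
  finally have le: "card {\<alpha>. \<not> has_degree_over h \<alpha> n} \<le> (\<Sum>g\<in>{g. 2 * g = n}. CARD('k) ^ g) + 2 * CARD('k) ^ (n div 3)"
    by simp
  have "real (\<Sum>g\<in>{g. 2 * g = n}. CARD('k) ^ g) \<le> sqrt (CARD('l))"
  proof (cases "even n")
    case True
    then obtain c where c: "n = 2 * c" by (auto elim: evenE)
    then have "{g. 2 * g = n} = {c}" by auto
    moreover have "real (CARD('l)) = (real CARD('k) ^ c)\<^sup>2" by (simp add: card_ext c power_mult mult.commute)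
    ultimately show ?thesis by simp
  next
    case False
    then have "{g. 2 * g = n} = {}" by auto
    then show ?thesis by simp
  qed
  moreover have "real (card {\<alpha>. \<not> has_degree_over h \<alpha> n}) \<le> real ((\<Sum>g\<in>{g. 2 * g = n}. CARD('k) ^ g) + 2 * CARD('k) ^ (n div 3))"
    using le by (simp only: of_nat_le_iff)
  ultimately show ?thesis by simp
qed

section \<open>Radicals of primary polynomials\<close>

definition radical :: "'k poly \<Rightarrow> 'k poly" where
  "radical p = (SOME g. irreducible g \<and> lead_coeff g = 1 \<and> (\<exists>k. p = g ^ k))"

lemma radical_props:
  assumes "p \<in> monic_primary_polys d"
  shows "irreducible (radical p)" "lead_coeff (radical p) = 1" "\<exists>k. p = radical p ^ k"
proof -
  obtain g k where g: "irreducible g" "p = g ^ k" and p: "lead_coeff p = 1"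
    using assms by (auto simp: monic_primary_polys_def primary_poly_def)
  define c where "c = lead_coeff g"
  have c0: "c \<noteq> 0" using g by (auto simp: c_def)
  have ck: "c ^ k = 1" using p by (simp add: g(2) c_def lead_coeff_power)
  have "irreducible ([:inverse c:] * g)"
    using g(1) c0 by (subst irreducible_mult_unit_left) (auto simp: is_unit_iff_degree)
  moreover have "lead_coeff ([:inverse c:] * g) = 1" using c0 by (simp add: c_def)
  moreover have "p = ([:inverse c:] * g) ^ k"
    using ck by (simp add: g(2) power_mult_distrib poly_const_pow power_inverse smult_power)
  ultimately have "\<exists>g. irreducible g \<and> lead_coeff g = 1 \<and> (\<exists>k. p = g ^ k)" by blast
  from someI_ex[OF this]
  show "irreducible (radical p)" "lead_coeff (radical p) = 1" "\<exists>k. p = radical p ^ k"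
    by (simp_all add: radical_def)
qed

lemma degree_radical_pos: "p \<in> monic_primary_polys d \<Longrightarrow> degree (radical p) > 0"
  using radical_props(1)[of p d] by (auto simp: irreducible_def is_unit_iff_degree intro: Nat.gr0I)

lemma radical_power:
  assumes "p \<in> monic_primary_polys d"
  obtains k where "p = radical p ^ k" "d = degree (radical p) * k"
proof -
  obtain k where k: "p = radical p ^ k" using radical_props(3)[OF assms] ..
  moreover have "degree p = degree (radical p) * k"
    by (subst k, subst degree_power_eq) (use degree_radical_pos[OF assms] in auto)
  moreover have "degree p = d" using assms by (simp add: monic_primary_polys_def)
  ultimately show ?thesis using that by simp
qed

text \<open>The common degree \<open>d\<close> determines the exponent, so nothing is lost in
  passing to radicals; their product therefore has no repeated factor.\<close>

lemma inj_on_radical: "inj_on radical (monic_primary_polys d)"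
proof (rule inj_onI)
  fix p r assume pr: "p \<in> monic_primary_polys d" "r \<in> monic_primary_polys d" "radical p = radical r"
  obtain k where k: "p = radical p ^ k" "d = degree (radical p) * k" by (rule radical_power[OF pr(1)])
  obtain k' where k': "r = radical r ^ k'" "d = degree (radical r) * k'" by (rule radical_power[OF pr(2)])
  have "k = k'" using k(2) k'(2) pr(3) degree_radical_pos[OF pr(1)] by simp
  then show "p = r" using k(1) k'(1) pr(3) by simp
qed

lemma finite_monic_primary_polys: "finite (monic_primary_polys d :: 'k poly set)"
  by (rule finite_subset[OF _ finite_polys_below[of "Suc d"]])
     (auto simp: monic_primary_polys_def intro: polys_belowI)

text \<open>The powers \<open>(X + c) ^ d\<close> are witnesses. The bound serves the numerical
  estimates, where it makes \<open>W\<close> at least \<open>l ^ q\<close>.\<close>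

lemma card_monic_primary_polys_ge:
  assumes d: "d \<ge> 1"
  shows "CARD('k) \<le> card (monic_primary_polys d :: 'k poly set)"
proof -
  have "inj (\<lambda>c::'k. [:c, 1:] ^ d)"
  proof (rule injI)
    fix a b :: 'k assume ab: "[:a, 1:] ^ d = [:b, 1:] ^ d"
    have "poly ([:a, 1:] ^ d) (-a) = poly ([:b, 1:] ^ d) (-a)" by (simp only: ab)
    then have "(b - a) ^ d = 0" using d by (simp add: zero_power)
    then show "a = b" by simp
  qed
  moreover have "range (\<lambda>c::'k. [:c, 1:] ^ d) \<subseteq> monic_primary_polys d"
  proof (rule image_subsetI)
    fix c :: 'k
    have "degree ([:c, 1:] ^ d) = d" by (simp add: degree_power_eq)
    moreover have "irreducible [:c, 1:]"
    proof (rule irreducibleI)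
      fix a b assume ab: "[:c, 1:] = a * b"
      then have "a \<noteq> 0" "b \<noteq> 0" by auto
      then have "degree a + degree b = 1" using arg_cong[OF ab, of degree] by (simp add: degree_mult_eq)
      then show "is_unit a \<or> is_unit b" using \<open>a \<noteq> 0\<close> \<open>b \<noteq> 0\<close> by (auto simp: is_unit_iff_degree)
    qed (simp_all add: is_unit_iff_degree)
    moreover have "lead_coeff ([:c, 1:] ^ d) = 1" unfolding lead_coeff_power by simp
    ultimately show "[:c, 1:] ^ d \<in> monic_primary_polys d"
      unfolding monic_primary_polys_def primary_poly_def using d by auto
  qed
  ultimately show ?thesis by (intro card_inj_on_le[OF _ _ finite_monic_primary_polys]) auto
qed

lemma card_monic_primary_polys_le:
  "card (monic_primary_polys d :: 'k poly set) \<le> CARD('k) ^ d"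
proof -
  have "inj_on (\<lambda>p. p - monom 1 d) (monic_primary_polys d :: 'k poly set)"
    by (rule inj_onI) simp
  moreover have "(\<lambda>p. p - monom 1 d) ` (monic_primary_polys d :: 'k poly set) \<subseteq> polys_below d"
    by (auto simp: monic_primary_polys_def polys_below_def coeff_eq_0)
  ultimately have "card (monic_primary_polys d :: 'k poly set) \<le> card (polys_below d :: 'k poly set)"
    by (intro card_inj_on_le[OF _ _ finite_polys_below])
  then show ?thesis by (simp add: card_polys_below)
qed

text \<open>The degree of each radical divides \<open>d\<close>, so each radical divides
  \<open>X ^ (q ^ d) - X\<close>. This one separable multiple supplies both the squarefreeness
  needed for Kummer theory and the bound \<open>q ^ d\<close> on the total degree.\<close>

lemma prod_radical_dvd:
  assumes "S \<subseteq> monic_primary_polys d"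
  shows "(\<Prod>p\<in>S. radical p) dvd [:0, 1:] ^ (CARD('k) ^ d) - [:0, 1:]"
proof (rule prod_dvd_if_irreducible_dvd)
  show "finite S" using assms finite_monic_primary_polys by (rule finite_subset)
  show "inj_on radical S" using inj_on_radical assms by (rule inj_on_subset)
  fix p assume "p \<in> S"
  then have p: "p \<in> monic_primary_polys d" using assms by blast
  show "irreducible (radical p)" "lead_coeff (radical p) = 1" using radical_props[OF p] by auto
  obtain k where "d = degree (radical p) * k" by (rule radical_power[OF p])
  then show "radical p dvd [:0, 1:] ^ (CARD('k) ^ d) - [:0, 1:]"
    using X_power_iterate[OF irreducible_dvd_X_power_card[OF radical_props(1)[OF p]], of k]
    by (simp only: power_mult)
qed

lemma sum_degree_radical_le:
  assumes "d > 0"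
  shows "(\<Sum>p\<in>monic_primary_polys d. degree (radical p)) \<le> CARD('k) ^ d"
proof -
  let ?T = "[:0, 1:] ^ (CARD('k) ^ d) - [:0, 1:] :: 'k poly"
  have N: "CARD('k) ^ d > 1" using one_less_power[OF one_less_card_field[where 'a = 'k] assms] .
  then have T0: "?T \<noteq> 0" by (rule X_power_diff_X_nonzero)
  have nz: "radical p \<noteq> 0" if "p \<in> monic_primary_polys d" for p
    using degree_radical_pos[OF that] by auto
  have "(\<Sum>p\<in>monic_primary_polys d. degree (radical p)) = degree (\<Prod>p\<in>monic_primary_polys d. radical p)"
    by (rule degree_prod_eq_sum_degree [symmetric]) (use nz in auto)
  also have "\<dots> \<le> degree ?T" by (rule dvd_imp_degree_le[OF prod_radical_dvd T0]) simp
  also have "\<dots> \<le> CARD('k) ^ d"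
    using N by (intro degree_diff_le order_trans[OF degree_power_le]) auto
  finally show ?thesis .
qed

lemma of_nat_card_base: "of_nat CARD('k) = (0 :: 'l)"
proof -
  have "of_nat CARD('k) = (0 :: 'k)"
    using finite_field_of_nat_binomial[of 1, where 'a = 'k] one_less_card_field[where 'a = 'k] by simp
  moreover have "h (of_nat k) = of_nat k" for k by (induction k) (simp_all add: hom_distribs)
  ultimately show ?thesis by (metis hom_zero)
qed

text \<open>A proper power would destroy squarefreeness, so \<open>p\<close> is replaced by its
  radical. Since \<open>p\<close> is a power of it, the condition that the \<open>e\<close>-th power
  of the value is 1 carries over from the radical to \<open>p\<close>.\<close>

definition residue_poly :: "'k poly \<Rightarrow> 'l poly" where
  "residue_poly p = map_poly h (radical p)"

lemma degree_residue_poly: "degree (residue_poly p) = degree (radical p)"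
  by (simp add: residue_poly_def)

lemma order_residue_poly_le:
  assumes "S \<subseteq> monic_primary_polys d" "d > 0"
  shows "order \<rho> (map_poly to_ac (\<Prod>p\<in>S. residue_poly p)) \<le> 1"
proof -
  let ?T = "[:0, 1:] ^ (CARD('k) ^ d) - [:0, 1:] :: 'k poly"
  have "map_poly to_ac (map_poly h (\<Prod>p\<in>S. radical p)) dvd map_poly to_ac (map_poly h ?T)"
    by (intro to_ac_poly.hom_dvd hp.hom_dvd prod_radical_dvd assms)
  moreover have "map_poly h (\<Prod>p\<in>S. radical p) = (\<Prod>p\<in>S. residue_poly p)"
    by (simp add: residue_poly_def hp.hom_prod)
  moreover have "map_poly to_ac (map_poly h ?T) = [:0, 1:] ^ (CARD('k) ^ d) - [:0, 1:]"
    by (simp add: hp.hom_minus hp.hom_power to_ac_poly.hom_minus to_ac_poly.hom_power map_poly_pCons)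
  moreover have "[:0, 1:] ^ (CARD('k) ^ d) - [:0, 1:] \<noteq> (0 :: 'l alg_closure poly)"
    using one_less_power[OF one_less_card_field[where 'a = 'k] assms(2)] by (rule X_power_diff_X_nonzero)
  ultimately have "order \<rho> (map_poly to_ac (\<Prod>p\<in>S. residue_poly p))
      \<le> order \<rho> ([:0, 1:] ^ (CARD('k) ^ d) - [:0, 1:])"
    by (metis dvd_imp_order_le)
  also have "\<dots> \<le> 1"
    using assms(2) of_nat_card_base by (rule order_X_power_card_diff_X)
  finally show ?thesis .
qed

text \<open>
  A character tuple may have smaller order than \<open>l\<close>; dividing by the common divisor \<open>\<delta>\<close> restores the
  coprimality needed for Kummer theory.
\<close>

lemma residue_family:
  fixes a :: "'k poly \<Rightarrow> nat"
  assumes l: "l > 0" and e: "CARD('l) - 1 = l * e" and d: "d > 0"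
    and a: "\<And>p. p \<in> monic_primary_polys d \<Longrightarrow> a p < l"
  defines "S \<equiv> {p \<in> monic_primary_polys d. a p \<noteq> 0}"
  defines "\<delta> \<equiv> Gcd (insert l (a ` S))"
  shows "power_residue_family residue_poly (\<lambda>p. a p div \<delta>) S (l div \<delta>) (e * \<delta>) (\<Sum>p\<in>S. degree (radical p))"
    and "\<And>p. p \<in> S \<Longrightarrow> e * \<delta> * (a p div \<delta>) = e * a p"
    and "S \<noteq> {} \<Longrightarrow> l div \<delta> \<ge> 2"
proof -
  have \<delta>_dvd: "\<delta> dvd l" "\<And>p. p \<in> S \<Longrightarrow> \<delta> dvd a p"
    unfolding \<delta>_def by (rule Gcd_dvd, simp)+
  have \<delta>0: "\<delta> > 0" using \<delta>_dvd(1) l by (auto intro: Nat.gr0I)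
  have l': "l = \<delta> * (l div \<delta>)" using \<delta>_dvd by simp
  have a': "a p = \<delta> * (a p div \<delta>)" if "p \<in> S" for p using \<delta>_dvd(2)[OF that] by simp
  have gcd1: "Gcd (insert (l div \<delta>) ((\<lambda>p. a p div \<delta>) ` S)) = 1"
  proof -
    have "(*) \<delta> ` insert (l div \<delta>) ((\<lambda>p. a p div \<delta>) ` S) = insert l (a ` S)"
      unfolding image_insert image_image using l' a' by (intro arg_cong2[where f = insert] image_cong) auto
    then have "Gcd ((*) \<delta> ` insert (l div \<delta>) ((\<lambda>p. a p div \<delta>) ` S)) = \<delta>"
      by (simp only: \<delta>_def [symmetric])
    then have "\<delta> * Gcd (insert (l div \<delta>) ((\<lambda>p. a p div \<delta>) ` S)) = \<delta>"
      by (metis Gcd_mult normalize_nat_def id_apply)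
    then show ?thesis using \<delta>0 by simp
  qed
  have "a p div \<delta> < l div \<delta>" if "p \<in> S" for p
  proof -
    have "\<delta> * (a p div \<delta>) < \<delta> * (l div \<delta>)"
      using a[of p] that l' a'[OF that] by (simp add: S_def)
    then show ?thesis by simp
  qed
  then show "power_residue_family residue_poly (\<lambda>p. a p div \<delta>) S (l div \<delta>) (e * \<delta>) (\<Sum>p\<in>S. degree (radical p))"
  proof -
    have "l * e = l div \<delta> * (e * \<delta>)" by (subst l') (simp only: mult_ac)
    then have "CARD('l) - 1 = l div \<delta> * (e * \<delta>)" by (simp only: e)
    moreover have "finite S" "S \<subseteq> monic_primary_polys d"
      using finite_monic_primary_polys by (auto simp: S_def)
    ultimately show ?thesis
      using gcd1 order_residue_poly_le[of S d] d \<open>\<And>p. p \<in> S \<Longrightarrow> a p div \<delta> < l div \<delta>\<close>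
      by unfold_locales (auto simp: degree_residue_poly intro: degree_radical_pos)
  qed
  show "e * \<delta> * (a p div \<delta>) = e * a p" if "p \<in> S" for p
    using a'[OF that] by (simp add: mult.assoc)
  show "l div \<delta> \<ge> 2" if ne: "S \<noteq> {}"
  proof (rule ccontr)
    assume "\<not> l div \<delta> \<ge> 2"
    moreover have "l div \<delta> \<noteq> 0" using l l' by (metis mult_0_right not_less_zero)
    ultimately have "l div \<delta> = 1" by linarith
    with l' have "\<delta> = l" by simp
    obtain p where p: "p \<in> S" using ne by blast
    then have "l dvd a p" using \<delta>_dvd(2)[OF p] \<open>\<delta> = l\<close> by simp
    with p a[of p] show False by (auto simp: S_def dest: dvd_imp_le)
  qed
qed

end

subsection \<open>Character sums\<close>

lemma faithful_character_exists:
  obtains E :: "'a::{finite,field} \<Rightarrow> complex"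
  where "E 1 = 1" "\<And>x y. x \<noteq> 0 \<Longrightarrow> y \<noteq> 0 \<Longrightarrow> E (x * y) = E x * E y"
    "\<And>x. x \<noteq> 0 \<Longrightarrow> norm (E x) = 1" "\<And>x. x \<noteq> 0 \<Longrightarrow> E x = 1 \<Longrightarrow> x = 1"
proof -
  define N where "N = CARD('a) - 1"
  have N: "N > 0" using one_less_card_field[where 'a = 'a] by (simp add: N_def)
  obtain g :: 'a where g0: "g \<noteq> 0" and g: "bij_betw (\<lambda>i. g ^ i) {..<N} (UNIV - {0})"
    unfolding N_def by (rule finite_field_generator)
  define dlog where "dlog = inv_into {..<N} (\<lambda>i. g ^ i)"
  have dlog: "dlog x < N" "g ^ dlog x = x" if "x \<noteq> 0" for x
    using that bij_betw_inv_into_right[OF g, of x] bij_betwE[OF bij_betw_inv_into[OF g], rule_format, of x]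
    by (auto simp: dlog_def)
  define w where "w = cis (2 * pi / real N)"
  have wpow: "w ^ i = cis (2 * pi * real i / real N)" for i
    by (simp add: w_def DeMoivre mult_ac)
  have wN: "w ^ N = 1" using N by (simp add: wpow)
  have w_mod: "w ^ (i mod N) = w ^ i" for i
  proof -
    have "w ^ i = w ^ (N * (i div N) + i mod N)" by simp
    also have "\<dots> = w ^ (i mod N)" by (simp only: power_add power_mult wN power_one mult_1)
    finally show ?thesis by simp
  qed
  have g_mod: "g ^ (i mod N) = g ^ i" for i
  proof -
    have "g ^ i = g ^ (N * (i div N) + i mod N)" by simp
    also have "\<dots> = g ^ (i mod N)"
      by (simp only: power_add power_mult N_def finite_field_power_card_minus_1[OF g0] power_one mult_1)
    finally show ?thesis by simp
  qed
  define E where "E = (\<lambda>x. w ^ dlog x)"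
  have E_pow: "E (g ^ i) = w ^ i" for i
  proof -
    have "dlog (g ^ i) = dlog (g ^ (i mod N))" by (simp only: g_mod)
    also have "\<dots> = i mod N"
      unfolding dlog_def by (rule bij_betw_inv_into_left[OF g]) (use N in simp)
    finally show ?thesis by (simp add: E_def w_mod)
  qed
  show ?thesis
  proof (rule that[of E])
    show "E 1 = 1" using E_pow[of 0] by simp
    show "E (x * y) = E x * E y" if "x \<noteq> 0" "y \<noteq> 0" for x y
      using E_pow[of "dlog x + dlog y"] dlog[OF that(1)] dlog[OF that(2)]
      by (simp add: power_add E_def)
    show "norm (E x) = 1" if "x \<noteq> 0" for x by (simp add: E_def wpow)
    show "x = 1" if "x \<noteq> 0" "E x = 1" for x
    proof -
      have inj: "inj_on (\<lambda>k. cis (2 * pi * real k / real N)) {..<N}"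
        using bij_betw_roots_unity[OF N] by (rule bij_betw_imp_inj_on)
      have eq: "cis (2 * pi * real (dlog x) / real N) = cis (2 * pi * real 0 / real N)"
        using that(2) by (simp add: E_def wpow)
      have "dlog x = 0" by (rule inj_onD[OF inj eq]) (use dlog(1)[OF that(1)] N in auto)
      then show ?thesis using dlog(2)[OF that(1)] by simp
    qed
  qed
qed

text \<open>The value at 0 is left open, so zeros of the arguments have to be removed before
  characters are applied.\<close>

locale faithful_character =
  fixes E :: "'a::{finite,field} \<Rightarrow> complex"
  assumes E_1: "E 1 = 1" and E_mult: "\<And>x y. x \<noteq> 0 \<Longrightarrow> y \<noteq> 0 \<Longrightarrow> E (x * y) = E x * E y"
    and norm_E: "\<And>x. x \<noteq> 0 \<Longrightarrow> norm (E x) = 1" and E_faithful: "\<And>x. x \<noteq> 0 \<Longrightarrow> E x = 1 \<Longrightarrow> x = 1"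
begin

lemma E_power: "x \<noteq> 0 \<Longrightarrow> E (x ^ n) = E x ^ n"
  by (induction n) (simp_all add: E_1 E_mult)

lemma E_prod: "(\<And>i. i \<in> A \<Longrightarrow> f i \<noteq> 0) \<Longrightarrow> E (\<Prod>i\<in>A. f i) = (\<Prod>i\<in>A. E (f i))"
proof (induction A rule: infinite_finite_induct)
  case (insert i A)
  then show ?case by (subst prod.insert, simp, simp, subst E_mult) auto
qed (simp_all add: E_1)

lemma abs_Re_E: "x \<noteq> 0 \<Longrightarrow> \<bar>Re (E x)\<bar> \<le> 1"
  using abs_Re_le_cmod[of "E x"] by (simp add: norm_E)

lemma sum_E_roots_of_unity:
  assumes "l \<ge> 2" "l dvd CARD('a) - 1"
  shows "(\<Sum>z\<in>{z. z ^ l = 1}. E z) = 0"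
proof -
  have l0: "l > 0" using assms by simp
  have "\<not> {z::'a. z ^ l = 1} \<subseteq> {1}"
  proof
    assume "{z::'a. z ^ l = 1} \<subseteq> {1}"
    then have "card {z::'a. z ^ l = 1} \<le> card {1::'a}" by (intro card_mono) auto
    then show False using assms by (simp add: card_roots_of_unity)
  qed
  then obtain w :: 'a where w: "w ^ l = 1" "w \<noteq> 1" by blast
  then have w0: "w \<noteq> 0" using l0 by (auto simp: zero_power)
  have nz: "z \<noteq> 0" if "z ^ l = 1" for z :: 'a using that l0 by (auto simp: zero_power)
  have "(\<Sum>z\<in>{z. z ^ l = 1}. E z) = (\<Sum>z\<in>{z. z ^ l = 1}. E (w * z))"
    by (rule sum.reindex_bij_betw[symmetric], rule bij_betw_byWitness[where f' = "\<lambda>z. z / w"])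
       (use w w0 in \<open>auto simp: power_mult_distrib power_divide\<close>)
  also have "\<dots> = E w * (\<Sum>z\<in>{z. z ^ l = 1}. E z)"
    unfolding sum_distrib_left by (intro sum.cong refl E_mult w0) (use nz in auto)
  finally have "(E w - 1) * (\<Sum>z\<in>{z. z ^ l = 1}. E z) = 0" by (simp add: left_diff_distrib)
  then show ?thesis using E_faithful[OF w0] w(2) by auto
qed

end

text \<open>
  If all partial sums of \<open>u\<close> are at most \<open>B\<close> and the total is \<open>- c\<close>, then
  \<open>- \<Sum>u w = \<Sum>u (1 - w) - \<Sum>u\<close> with \<open>0 \<le> 1 - w \<le> 2\<close>.
\<close>

lemma weighted_sum_ge:
  fixes u w :: "'b \<Rightarrow> real"
  assumes "finite A" "\<And>z. z \<in> A \<Longrightarrow> \<bar>w z\<bar> \<le> 1"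
    and "(\<Sum>z\<in>{z\<in>A. u z > 0}. u z) \<le> B" "(\<Sum>z\<in>A. u z) \<ge> - c"
  shows "(\<Sum>z\<in>A. u z * w z) \<ge> - (2 * B + c)"
proof -
  have "(\<Sum>z\<in>A. u z * (1 - w z)) \<le> (\<Sum>z\<in>A. if u z > 0 then 2 * u z else 0)"
  proof (rule sum_mono)
    fix z assume "z \<in> A"
    then have w: "0 \<le> 1 - w z" "1 - w z \<le> 2" using assms(2)[of z] by auto
    show "u z * (1 - w z) \<le> (if u z > 0 then 2 * u z else 0)"
    proof (cases "u z > 0")
      case True
      then have "u z * (1 - w z) \<le> u z * 2" using w by (intro mult_left_mono) auto
      then show ?thesis using True by simp
    next
      case False
      then show ?thesis using w by (simp add: mult_nonpos_nonneg)
    qed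
  qed
  also have "\<dots> = 2 * (\<Sum>z\<in>{z\<in>A. u z > 0}. u z)"
    unfolding sum.inter_filter[OF assms(1)] sum_distrib_left by (rule sum.cong) auto
  also have "\<dots> \<le> 2 * B" using assms(3) by simp
  finally have "(\<Sum>z\<in>A. u z) - (\<Sum>z\<in>A. u z * w z) \<le> 2 * B"
    by (simp add: right_diff_distrib sum_subtractf)
  then show ?thesis using assms(4) by linarith
qed

context power_residue_family
begin

text \<open>Group the points by the value of the power product. The values taken more than
  \<open>Q / l\<close> times form one set \<open>Z\<close>, to which \<open>stepanov_bound\<close>
  applies as a whole; the main term \<open>card Z * Q / l\<close> cancels and the remaining excess
  is bounded independently of \<open>Z\<close>. The constant \<open>c\<close> accounts for the
  points missing from \<open>V\<close>.\<close>

lemma character_sum_ge: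
  assumes E: "faithful_character E"
    and l2: "l \<ge> 2" and M: "l\<^sup>2 * D < M" "l * M\<^sup>2 \<le> CARD('a)"
    and V: "V \<subseteq> {x. poly GG x \<noteq> 0}" "CARD('a) \<le> card V + c"
  shows "(\<Sum>x\<in>V. Re (E (poly power_product x)))
    \<ge> - (2 * (real CARD('a) * (real ((l - 1) * D) + real l / 2) / (real l * real M)) + real c)"
proof -
  interpret faithful_character E by (rule E)
  define Q where "Q = real CARD('a)"
  let ?U = "{z::'a. z ^ l = 1}"
  define y where "y = (\<lambda>x. poly power_product x)"
  define u where "u = (\<lambda>z. real (card {x\<in>V. y x = z}) - Q / real l)"
  have M0: "M > 0" using M by simp
  have card_U: "card ?U = l" using l_dvd by (rule card_roots_of_unity)
  have nz: "z \<noteq> 0" if "z \<in> ?U" for z using that l_pos by (auto simp: zero_power)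
  have yU: "y x \<in> ?U" if "x \<in> V" for x
  proof -
    have "poly (G i) x ^ (e * m i * l) = 1" if "i \<in> I" for i
    proof -
      have "poly (G i) x \<noteq> 0" using V(1) \<open>x \<in> V\<close> that fin by (auto simp: GG_def poly_prod)
      then have "poly (G i) x ^ (l * e) = 1"
        using finite_field_power_card_minus_1[of "poly (G i) x"] unfolding card_eq by blast
      then have "(poly (G i) x ^ (l * e)) ^ m i = 1" by (simp only: power_one)
      then show ?thesis by (simp only: power_mult [symmetric] mult_ac)
    qed
    then show ?thesis
      by (simp add: y_def power_product_def poly_prod prod_power_distrib power_mult [symmetric])
  qed
  have y_img: "y ` V \<subseteq> ?U" using yU by blast
  have sum_card: "(\<Sum>z\<in>Z. real (card {x\<in>V. y x = z})) = real (card {x\<in>V. y x \<in> Z})" for Z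
  proof -
    have "{x\<in>{x\<in>V. y x \<in> Z}. y x = z} = {x\<in>V. y x = z}" if "z \<in> Z" for z using that by auto
    then have "(\<Sum>z\<in>Z. card {x\<in>V. y x = z}) = (\<Sum>z\<in>Z. card {x\<in>{x\<in>V. y x \<in> Z}. y x = z})"
      by simp
    also have "\<dots> = card {x\<in>V. y x \<in> Z}"
      using sum.group[of "{x\<in>V. y x \<in> Z}" Z y "\<lambda>_. 1::nat"] by (simp add: image_subset_iff)
    finally show ?thesis by (simp flip: of_nat_sum)
  qed
  have total: "(\<Sum>z\<in>?U. u z) = real (card V) - Q"
  proof -
    have "{x\<in>V. y x \<in> ?U} = V" using yU by blast
    then have "(\<Sum>z\<in>?U. real (card {x\<in>V. y x = z})) = real (card V)"
      by (simp only: sum_card)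
    then show ?thesis using l_pos by (simp add: u_def sum_subtractf card_U)
  qed
  have "(\<Sum>x\<in>V. Re (E (y x))) = (\<Sum>z\<in>?U. \<Sum>x\<in>{x\<in>V. y x = z}. Re (E (y x)))"
    using y_img by (intro sum.group[symmetric]) auto
  also have "\<dots> = (\<Sum>z\<in>?U. real (card {x\<in>V. y x = z}) * Re (E z))"
    by (intro sum.cong) auto
  \<comment> \<open>Subtracting the mean \<open>Q / l\<close> from every fibre is free, because
    \<open>E\<close> sums to zero over the roots of unity.\<close>
  also have "\<dots> = (\<Sum>z\<in>?U. u z * Re (E z)) + Q / real l * Re (\<Sum>z\<in>?U. E z)"
    unfolding u_def Re_sum by (simp add: left_diff_distrib sum_subtractf sum_distrib_left)
  also have "(\<Sum>z\<in>?U. E z) = 0" using l2 l_dvd by (rule sum_E_roots_of_unity)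
  finally have S: "(\<Sum>x\<in>V. Re (E (y x))) = (\<Sum>z\<in>?U. u z * Re (E z))" by simp
  have "- (2 * (Q * (real ((l - 1) * D) + real l / 2) / (real l * real M)) + real c) \<le> (\<Sum>z\<in>?U. u z * Re (E z))"
  proof (rule weighted_sum_ge)
    show "\<bar>Re (E z)\<bar> \<le> 1" if "z \<in> ?U" for z by (rule abs_Re_E[OF nz[OF that]])
    have "real CARD('a) \<le> real (card V + c)" using V(2) by (simp only: of_nat_le_iff)
    then show "- real c \<le> (\<Sum>z\<in>?U. u z)" by (simp add: total Q_def)
    define Z where "Z = {z\<in>?U. u z > 0}"
    define A where "A = {x. poly GG x \<noteq> 0 \<and> poly power_product x \<in> Z}"
    have "card V \<le> CARD('a)" by (rule card_mono) auto
    then have "(\<Sum>z\<in>?U. u z) \<le> 0" by (simp add: total Q_def)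
    \<comment> \<open>\<open>stepanov_bound\<close> needs a proper subset. Not every deviation can
      be positive, since they add up to \<open>card V - Q \<le> 0\<close>.\<close>
    have "Z \<noteq> ?U"
    proof
      assume "Z = ?U"
      then have pos: "u z > 0" if "z \<in> ?U" for z using that by (auto simp: Z_def)
      have "(\<Sum>z\<in>?U. u z) > 0" by (rule sum_pos) (use pos in \<open>auto intro: exI[of _ 1]\<close>)
      with \<open>(\<Sum>z\<in>?U. u z) \<le> 0\<close> show False by simp
    qed
    then have "Z \<subset> ?U" by (auto simp: Z_def)
    then have "card Z < card ?U" by (intro psubset_card_mono) auto
    then have "card Z < l" by (simp only: card_U)
    from stepanov_bound[OF l2 M this]
    have "real (l * (M * card A)) \<le> real (CARD('a) * (card Z * M + (l - 1) * D + l div 2))"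
      unfolding A_def by (subst of_nat_le_iff) simp
    also have "\<dots> \<le> Q * (real (card Z) * real M + (real ((l - 1) * D) + real l / 2))"
    proof -
      have "real (2 * (l div 2)) \<le> real l" by (subst of_nat_le_iff) simp
      then have "real (l div 2) \<le> real l / 2" by simp
      then show ?thesis unfolding Q_def of_nat_mult of_nat_add by (intro mult_left_mono) auto
    qed
    finally have "real (card A) * (real l * real M) \<le> Q * (real (card Z) * real M + (real ((l - 1) * D) + real l / 2))"
      by (simp add: mult_ac)
    then have "real (card A) \<le> Q * (real (card Z) * real M + (real ((l - 1) * D) + real l / 2)) / (real l * real M)"
      using l_pos M0 by (simp add: pos_le_divide_eq)
    also have "\<dots> = real (card Z) * (Q / real l) + Q * (real ((l - 1) * D) + real l / 2) / (real l * real M)"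
      using l_pos M0 by (simp add: field_simps)
    finally have A: "real (card A) \<le> real (card Z) * (Q / real l) + Q * (real ((l - 1) * D) + real l / 2) / (real l * real M)" .
    have "card {x\<in>V. y x \<in> Z} \<le> card A"
      using V(1) by (intro card_mono) (auto simp: A_def y_def)
    then have "(\<Sum>z\<in>Z. u z) \<le> real (card A) - real (card Z) * (Q / real l)"
      by (simp add: u_def sum_subtractf sum_card)
    also have "\<dots> \<le> Q * (real ((l - 1) * D) + real l / 2) / (real l * real M)" using A by linarith
    finally show "(\<Sum>z\<in>{z\<in>?U. u z > 0}. u z) \<le> Q * (real ((l - 1) * D) + real l / 2) / (real l * real M)"
      by (simp only: Z_def)
  qed simp
  then show ?thesis by (simp only: S[unfolded y_def] Q_def)
qed

end

lemma card_PiE_nonzero_at: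
  assumes "finite P" "p \<in> P" "l > 0"
  shows "real (card {a \<in> P \<rightarrow>\<^sub>E {..<l}. a p \<noteq> (0::nat)}) = real (l ^ card P) * (1 - 1 / real l)"
proof -
  have "{a \<in> P \<rightarrow>\<^sub>E {..<l}. a p \<noteq> 0} = PiE P (\<lambda>r. if r = p then {0<..<l} else {..<l})"
    using assms(2) by (auto simp: PiE_def Pi_def split: if_splits)
  then have "card {a \<in> P \<rightarrow>\<^sub>E {..<l}. a p \<noteq> 0} = (\<Prod>r\<in>P. card (if r = p then {0<..<l} else {..<l}))"
    using assms(1) by (simp add: card_PiE)
  also have "\<dots> = card {0<..<l} * (\<Prod>r\<in>P - {p}. card (if r = p then {0<..<l} else {..<l}))"
    using assms by (subst prod.remove[of _ p]) auto
  also have "(\<Prod>r\<in>P - {p}. card (if r = p then {0<..<l} else {..<l})) = (\<Prod>r\<in>P - {p}. l)"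
    by (rule prod.cong) auto
  finally have 1: "card {a \<in> P \<rightarrow>\<^sub>E {..<l}. a p \<noteq> 0} = (l - 1) * l ^ card (P - {p})" by simp
  have "card P = Suc (card (P - {p}))" using assms(1,2) by (rule card.remove)
  then have "real (l ^ card P) * (1 - 1 / real l) = (real l - 1) * real l ^ card (P - {p})"
    using assms(3) by (simp only: power_Suc of_nat_mult of_nat_power) (simp add: algebra_simps)
  with 1 assms(3) show ?thesis by (simp add: of_nat_diff)
qed

context finite_field_extension
begin

text \<open>The zero tuple gives the main term, every other tuple an error. The factor
  \<open>\<kappa>\<close> enters twice: the degree factor \<open>(l' - 1) / l'\<close> for a tuple
  of order \<open>l'\<close> is at most \<open>\<kappa>\<close>, and each radical occurs in only a
  fraction \<open>\<kappa>\<close> of all tuples, so the degree \<open>Da a\<close> averages at most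
  \<open>\<kappa> * D\<close>. With a single \<open>\<kappa>\<close> the inequality of
  \<open>main_term_bound\<close> would fail, for instance at \<open>l = 5\<close>,
  \<open>D = 2\<close>.\<close>

lemma residue_count_ge:
  fixes l e d M :: nat
  assumes l2: "l \<ge> 2" and e: "CARD('l) - 1 = l * e" and d: "d > 0"
    and M: "l\<^sup>2 * CARD('k) ^ d < M" "l * M\<^sup>2 \<le> CARD('l)"
  defines "P \<equiv> monic_primary_polys d :: 'k poly set"
  defines "W \<equiv> real (l ^ card P)" and "Q \<equiv> real CARD('l)" and "D \<equiv> real (CARD('k) ^ d)"
    and "\<kappa> \<equiv> 1 - 1 / real l"
  shows "W * real (card {x. \<forall>p\<in>P. poly (residue_poly p) x ^ e = 1})
    \<ge> Q - W * (D + Q / real M * (1 + 2 * \<kappa>\<^sup>2 * D))"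
proof -
  obtain E :: "'l \<Rightarrow> complex"
    where E: "E 1 = 1" "\<And>x y. x \<noteq> 0 \<Longrightarrow> y \<noteq> 0 \<Longrightarrow> E (x * y) = E x * E y"
      "\<And>x. x \<noteq> 0 \<Longrightarrow> norm (E x) = 1" "\<And>x. x \<noteq> 0 \<Longrightarrow> E x = 1 \<Longrightarrow> x = 1"
    by (rule faithful_character_exists) blast
  interpret E: faithful_character E by unfold_locales (rule E; assumption)+
  have finP: "finite P" by (simp add: P_def finite_monic_primary_polys)
  have l0: "l > 0" using l2 by simp
  have e0: "e > 0" using e one_less_card_field[where 'a = 'l] by (auto intro: Nat.gr0I)
  have M0: "M > 0" using M by simp
  define A where "A = P \<rightarrow>\<^sub>E {..<l}"
  have finA: "finite A" using finP by (simp add: A_def finite_PiE)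
  have cardA: "real (card A) = W" using finP by (simp add: A_def W_def card_funcsetE)
  define V where "V = {x::'l. \<forall>p\<in>P. poly (residue_poly p) x \<noteq> 0}"
  have nz: "residue_poly p \<noteq> 0" if "p \<in> P" for p
    using degree_radical_pos[of p d] that by (metis P_def degree_residue_poly degree_0 less_irrefl)
  have cardV: "CARD('l) \<le> card V + CARD('k) ^ d"
  proof -
    let ?H = "\<Prod>p\<in>P. residue_poly p"
    have "?H \<noteq> 0" using nz finP by simp
    have "UNIV - V = {x. poly ?H x = 0}" using finP by (auto simp: V_def poly_prod)
    then have "card (UNIV - V) \<le> degree ?H" using card_poly_roots_bound[OF \<open>?H \<noteq> 0\<close>] by simp
    also have "\<dots> = (\<Sum>p\<in>P. degree (radical p))"
      using nz by (subst degree_prod_eq_sum_degree) (simp_all add: degree_residue_poly)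
    also have "\<dots> \<le> CARD('k) ^ d" unfolding P_def by (rule sum_degree_radical_le[OF d])
    finally show ?thesis by (simp add: card_Diff_subset)
  qed
  define y where "y = (\<lambda>p x. poly (residue_poly p) x ^ e)"
  have y0: "y p x \<noteq> 0" if "x \<in> V" "p \<in> P" for p x using that by (simp add: y_def V_def)
  define F where "F = (\<lambda>a. \<Sum>x\<in>V. Re (\<Prod>p\<in>P. E (y p x) ^ a p))"
  let ?good = "{x. \<forall>p\<in>P. poly (residue_poly p) x ^ e = 1}"
  have good: "?good = {x\<in>V. \<forall>p\<in>P. y p x = 1}"
    using e0 by (auto simp: V_def y_def zero_power)
  have sumF: "(\<Sum>a\<in>A. F a) = W * real (card ?good)"
  proof -
    have "(\<Sum>a\<in>A. F a) = (\<Sum>x\<in>V. Re (\<Sum>a\<in>A. \<Prod>p\<in>P. E (y p x) ^ a p))"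
      unfolding F_def Re_sum by (rule sum.swap)
    also have "\<dots> = (\<Sum>x\<in>V. if \<forall>p\<in>P. y p x = 1 then W else 0)"
    proof (rule sum.cong[OF refl])
      fix x assume x: "x \<in> V"
      have inner: "(\<Sum>j<l. E (y p x) ^ j) = (if y p x = 1 then of_nat l else 0)" if p: "p \<in> P" for p
      proof (cases "y p x = 1")
        case True
        then show ?thesis by (simp add: E)
      next
        case False
        then have ne: "E (y p x) \<noteq> 1" using E(4)[OF y0[OF x p]] by blast
        have "poly (residue_poly p) x ^ (CARD('l) - 1) = 1"
          using x p by (intro finite_field_power_card_minus_1) (simp add: V_def)
        then have "y p x ^ l = 1" unfolding e y_def by (simp only: power_mult [symmetric] mult.commute)
        then have "E (y p x) ^ l = 1" using E.E_power[OF y0[OF x p], of l] E(1) by simp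
        then have "(E (y p x) - 1) * (\<Sum>j<l. E (y p x) ^ j) = 0"
          by (simp flip: power_diff_1_eq)
        then show ?thesis using ne False by simp
      qed
      have "(\<Sum>a\<in>A. \<Prod>p\<in>P. E (y p x) ^ a p) = (\<Prod>p\<in>P. \<Sum>j<l. E (y p x) ^ j)"
        unfolding A_def by (rule prod_sum_PiE[symmetric]) (use finP in auto)
      also have "\<dots> = (\<Prod>p\<in>P. if y p x = 1 then of_nat l else 0)"
        by (rule prod.cong) (simp_all add: inner)
      also have "\<dots> = (if \<forall>p\<in>P. y p x = 1 then of_nat l ^ card P else 0)"
        using finP by (auto intro!: prod_zero)
      finally have "(\<Sum>a\<in>A. \<Prod>p\<in>P. E (y p x) ^ a p) = (if \<forall>p\<in>P. y p x = 1 then of_nat (l ^ card P) else 0)"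
        by simp
      then show "Re (\<Sum>a\<in>A. \<Prod>p\<in>P. E (y p x) ^ a p) = (if \<forall>p\<in>P. y p x = 1 then W else 0)"
        by (simp add: W_def del: of_nat_power)
    qed
    also have "\<dots> = (\<Sum>x\<in>?good. W)"
      unfolding good by (rule sum.inter_filter[symmetric]) simp
    finally show ?thesis by (simp add: mult.commute)
  qed
  define S where "S = (\<lambda>a::'k poly \<Rightarrow> nat. {p \<in> P. a p \<noteq> 0})"
  define Da where "Da = (\<lambda>a. \<Sum>p\<in>S a. degree (radical p))"
  define B where "B = (\<lambda>a. 2 * (Q / real M * (\<kappa> * real (Da a) + 1 / 2)) + D)"
  have \<kappa>: "0 \<le> \<kappa>" using l2 by (simp add: \<kappa>_def)
  \<comment> \<open>This lets the zero tuple join the uniform bound: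
    \<open>F a0 = card V \<ge> Q - D \<ge> Q - B a0\<close>.\<close>
  have B_ge: "B a \<ge> D" for a
  proof -
    have "0 \<le> Q / real M * (\<kappa> * real (Da a) + 1 / 2)"
      using \<kappa> by (intro mult_nonneg_nonneg add_nonneg_nonneg) (auto simp: Q_def)
    then show ?thesis by (simp add: B_def)
  qed
  have F_ge: "F a \<ge> - B a" if a: "a \<in> A" "S a \<noteq> {}" for a
  proof -
    define \<delta> where "\<delta> = Gcd (insert l (a ` S a))"
    have a_less: "a p < l" if "p \<in> monic_primary_polys d" for p
      using a(1) that by (auto simp: A_def P_def)
    have Sa: "{p \<in> monic_primary_polys d. a p \<noteq> 0} = S a" by (simp add: S_def P_def)
    note fam = residue_family[of l e d a, OF l0 e d a_less, unfolded Sa, folded \<delta>_def]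
    interpret fam: power_residue_family residue_poly "\<lambda>p. a p div \<delta>" "S a" "l div \<delta>" "e * \<delta>" "Da a"
      unfolding Da_def by (rule fam(1))
    have l': "l div \<delta> \<ge> 2" by (rule fam(3)) (use a(2) in simp_all)
    have l'_le: "l div \<delta> \<le> l" by simp
    have sub: "S a \<subseteq> P" by (auto simp: S_def)
    have Da_le: "Da a \<le> CARD('k) ^ d"
    proof -
      have "Da a \<le> (\<Sum>p\<in>P. degree (radical p))"
        unfolding Da_def using sub finP by (intro sum_mono2) auto
      also have "\<dots> \<le> CARD('k) ^ d" unfolding P_def by (rule sum_degree_radical_le[OF d])
      finally show ?thesis .
    qed
    \<comment> \<open>Both requirements on \<open>M\<close> are monotone in the order and the
      degree, so one \<open>M\<close> serves tuples of every order
      \<open>l div \<delta>\<close>.\<close>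
    have "(l div \<delta>)\<^sup>2 * Da a \<le> l\<^sup>2 * CARD('k) ^ d"
      using Da_le l'_le by (intro mult_le_mono power_mono) auto
    then have M1: "(l div \<delta>)\<^sup>2 * Da a < M" using M(1) by linarith
    have M2: "l div \<delta> * M\<^sup>2 \<le> CARD('l)"
      using mult_le_mono1[OF l'_le, of "M\<^sup>2"] M(2) by linarith
    have V1: "V \<subseteq> {x. poly fam.GG x \<noteq> 0}"
      using sub finite_subset[OF sub finP] by (auto simp: V_def fam.GG_def poly_prod)
    have "F a = (\<Sum>x\<in>V. Re (E (poly fam.power_product x)))"
      unfolding F_def
    proof (rule sum.cong[OF refl])
      fix x assume x: "x \<in> V"
      have "(\<Prod>p\<in>P. E (y p x) ^ a p) = (\<Prod>p\<in>S a. E (y p x) ^ a p)"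
        using finP sub by (intro prod.mono_neutral_right) (auto simp: S_def)
      also have "\<dots> = (\<Prod>p\<in>S a. E (y p x ^ a p))"
        using x sub y0 by (intro prod.cong) (auto simp: E.E_power)
      also have "\<dots> = E (\<Prod>p\<in>S a. y p x ^ a p)"
        using x sub y0 by (subst E.E_prod) auto
      also have "(\<Prod>p\<in>S a. y p x ^ a p) = poly fam.power_product x"
        unfolding fam.power_product_def poly_prod
        by (rule prod.cong) (simp_all add: fam(2) y_def power_mult)
      finally show "Re (\<Prod>p\<in>P. E (y p x) ^ a p) = Re (E (poly fam.power_product x))" by simp
    qed
    also have "\<dots> \<ge> - (2 * (real CARD('l) * (real ((l div \<delta> - 1) * Da a) + real (l div \<delta>) / 2) / (real (l div \<delta>) * real M)) + real (CARD('k) ^ d))"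
      by (rule fam.character_sum_ge[OF E.faithful_character_axioms l' M1 M2 V1 cardV])
    finally have F: "F a \<ge> - (2 * (Q * (real ((l div \<delta> - 1) * Da a) + real (l div \<delta>) / 2) / (real (l div \<delta>) * real M)) + D)"
      by (simp only: Q_def D_def)
    have "Q * (real ((l div \<delta> - 1) * Da a) + real (l div \<delta>) / 2) / (real (l div \<delta>) * real M)
        = Q / real M * ((1 - 1 / real (l div \<delta>)) * real (Da a) + 1 / 2)"
    proof -
      define k where "k = real (l div \<delta>)"
      have k: "k > 0" "real (l div \<delta> - 1) = k - 1" using l' by (simp_all add: k_def of_nat_diff)
      show ?thesis unfolding of_nat_mult k(2) unfolding k_def [symmetric]
        using k(1) M0 by (simp add: field_simps)
    qed
    also have "\<dots> \<le> Q / real M * (\<kappa> * real (Da a) + 1 / 2)"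
    proof -
      have "0 < real (l div \<delta>)" "real (l div \<delta>) \<le> real l" using l' l'_le by linarith+
      then have "1 / real l \<le> 1 / real (l div \<delta>)" by (intro frac_le) auto
      then have "1 - 1 / real (l div \<delta>) \<le> \<kappa>" by (simp add: \<kappa>_def)
      then show ?thesis by (intro mult_left_mono add_right_mono mult_right_mono) (auto simp: Q_def)
    qed
    finally show ?thesis using F by (simp add: B_def)
  qed
  define a0 where "a0 = (\<lambda>p\<in>P. 0::nat)"
  have a0: "a0 \<in> A" using l0 by (auto simp: a0_def A_def)
  have F0: "F a0 = real (card V)" by (simp add: F_def a0_def)
  have S0: "S a \<noteq> {}" if "a \<in> A" "a \<noteq> a0" for a
  proof
    assume "S a = {}"
    then have "a = a0" using that(1)
      by (intro ext) (auto simp: S_def a0_def A_def PiE_def extensional_def)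
    with that(2) show False by simp
  qed
  have sumD: "(\<Sum>a\<in>A. real (Da a)) \<le> W * \<kappa> * D"
  proof -
    have "(\<Sum>a\<in>A. real (Da a)) = (\<Sum>a\<in>A. \<Sum>p\<in>P. if a p \<noteq> 0 then real (degree (radical p)) else 0)"
      unfolding Da_def S_def of_nat_sum by (intro sum.cong refl sum.inter_filter finP)
    also have "\<dots> = (\<Sum>p\<in>P. \<Sum>a\<in>A. if a p \<noteq> 0 then real (degree (radical p)) else 0)"
      by (rule sum.swap)
    also have "\<dots> = (\<Sum>p\<in>P. real (card {a\<in>A. a p \<noteq> 0}) * real (degree (radical p)))"
      by (intro sum.cong refl) (simp flip: sum.inter_filter[OF finA])
    also have "\<dots> = (\<Sum>p\<in>P. W * \<kappa> * real (degree (radical p)))"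
      unfolding A_def W_def \<kappa>_def
      by (intro sum.cong refl arg_cong2[where f = "(*)"] card_PiE_nonzero_at finP l0)
    also have "\<dots> = W * \<kappa> * real (\<Sum>p\<in>P. degree (radical p))" by (simp add: sum_distrib_left)
    also have "\<dots> \<le> W * \<kappa> * D"
    proof (intro mult_left_mono)
      show "real (\<Sum>p\<in>P. degree (radical p)) \<le> D"
        unfolding D_def P_def by (subst of_nat_le_iff) (rule sum_degree_radical_le[OF d])
    qed (use \<kappa> in \<open>auto simp: W_def\<close>)
    finally show ?thesis .
  qed
  have "Q - (\<Sum>a\<in>A. B a) \<le> (\<Sum>a\<in>A. F a)"
  proof -
    have "real CARD('l) \<le> real (card V + CARD('k) ^ d)" using cardV by (simp only: of_nat_le_iff)
    then have "Q - B a0 \<le> F a0" using B_ge[of a0] by (simp add: F0 Q_def D_def)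
    moreover have "(\<Sum>a\<in>A - {a0}. - B a) \<le> (\<Sum>a\<in>A - {a0}. F a)"
      by (intro sum_mono F_ge) (auto dest: S0)
    ultimately show ?thesis
      using finA a0 by (simp add: sum.remove[of A a0] sum_negf)
  qed
  also have "(\<Sum>a\<in>A. B a) = 2 * (Q / real M) * \<kappa> * (\<Sum>a\<in>A. real (Da a)) + W * (Q / real M + D)"
  proof -
    have "B a = 2 * (Q / real M) * \<kappa> * real (Da a) + (Q / real M + D)" for a
      by (simp add: B_def algebra_simps)
    then show ?thesis
      by (simp only: sum.distrib sum_distrib_left [symmetric] sum_constant cardA distrib_left)
  qed
  finally have "Q - (2 * (Q / real M) * \<kappa> * (\<Sum>a\<in>A. real (Da a)) + W * (Q / real M + D)) \<le> W * real (card ?good)"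
    by (simp only: sumF)
  moreover have "2 * (Q / real M) * \<kappa> * (\<Sum>a\<in>A. real (Da a)) \<le> 2 * (Q / real M) * \<kappa> * (W * \<kappa> * D)"
    using sumD \<kappa> by (intro mult_left_mono) (auto simp: Q_def)
  ultimately have "Q - (2 * (Q / real M) * \<kappa> * (W * \<kappa> * D) + W * (Q / real M + D)) \<le> W * real (card ?good)"
    by linarith
  moreover have "2 * (Q / real M) * \<kappa> * (W * \<kappa> * D) + W * (Q / real M + D) = W * (D + Q / real M * (1 + 2 * \<kappa>\<^sup>2 * D))"
    by (simp add: power2_eq_square algebra_simps)
  ultimately show ?thesis by simp
qed

end

subsection \<open>Connected components\<close>

text \<open>Multiplication by a nonzero \<open>c\<close> is an automorphism of the Cayley digraph;
  this is its action on subgraphs. Tail and head are the projections, as in every subgraph of a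
  \<open>with_proj\<close> digraph.\<close>

definition scale_digraph :: "'a::field \<Rightarrow> ('a, 'a \<times> 'a) pre_digraph \<Rightarrow> ('a, 'a \<times> 'a) pre_digraph" where
  "scale_digraph c H = \<lparr> verts = (*) c ` verts H, arcs = map_prod ((*) c) ((*) c) ` arcs H,
     tail = fst, head = snd \<rparr>"

lemma scale_digraph_simps [simp]:
  "verts (scale_digraph c H) = (*) c ` verts H"
  "arcs (scale_digraph c H) = map_prod ((*) c) ((*) c) ` arcs H"
  "tail (scale_digraph c H) = fst" "head (scale_digraph c H) = snd"
  by (simp_all add: scale_digraph_def)

lemma scale_digraph_inverse:
  assumes "c \<noteq> 0" "tail H = fst" "head H = snd"
  shows "scale_digraph (inverse c) (scale_digraph c H) = H"
proof (rule pre_digraph.equality)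
  show "verts (scale_digraph (inverse c) (scale_digraph c H)) = verts H"
    using assms(1) by (simp add: image_image mult.assoc [symmetric])
  show "arcs (scale_digraph (inverse c) (scale_digraph c H)) = arcs H"
    using assms(1) by (force simp: image_image map_prod_def case_prod_unfold mult.assoc [symmetric])
qed (use assms in auto)

lemma wf_scale_digraph:
  assumes "wf_digraph H" "tail H = fst" "head H = snd"
  shows "wf_digraph (scale_digraph c H)"
proof -
  interpret wf_digraph H by (rule assms(1))
  show ?thesis
    using tail_in_verts head_in_verts by unfold_locales (auto simp: assms(2,3))
qed

lemma subgraph_scale_digraph:
  assumes "subgraph H K" "tail K = fst" "head K = snd"
  shows "subgraph (scale_digraph c H) (scale_digraph c K)"
  using assms unfolding subgraph_def
  by (auto simp: compatible_def intro!: wf_scale_digraph)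

lemma rtrancl_on_map:
  assumes "(u, v) \<in> rtrancl_on A R"
  shows "(f u, f v) \<in> rtrancl_on (f ` A) (map_prod f f ` R)"
  using assms
proof (induction rule: rtrancl_on_induct)
  case base
  then show ?case by auto
next
  case (step y z)
  have "(f y, f z) \<in> map_prod f f ` R" using step(2) by force
  then show ?case using step by (auto intro: rtrancl_on_into_rtrancl_on)
qed

lemma connected_scale_digraph:
  assumes "Digraph_Component.connected H" "tail H = fst" "head H = snd"
  shows "Digraph_Component.connected (scale_digraph c H)"
proof -
  have arcs: "parcs (mk_symmetric (scale_digraph c H)) = map_prod ((*) c) ((*) c) ` parcs (mk_symmetric H)"
    using assms(2,3) by (force simp: mk_symmetric_def map_prod_def case_prod_unfold image_UN)
  have verts: "pverts (mk_symmetric (scale_digraph c H)) = (*) c ` pverts (mk_symmetric H)"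
    by (simp add: mk_symmetric_def)
  show ?thesis
    using assms(1) unfolding Digraph_Component.connected_def strongly_connected_def reachable_def with_proj_simps verts arcs
    by (auto intro: rtrancl_on_map)
qed

lemma connected_constant:
  assumes "Digraph_Component.connected H" "\<And>a. a \<in> arcs H \<Longrightarrow> f (tail H a) = f (head H a)"
    and "u \<in> verts H" "v \<in> verts H"
  shows "f u = f v"
proof -
  have "(u, v) \<in> rtrancl_on (verts H) (parcs (mk_symmetric H))"
    using assms by (simp add: Digraph_Component.connected_def strongly_connected_def reachable_def mk_symmetric_def)
  then show ?thesis
  proof (induction rule: rtrancl_on_induct)
    case (step y z)
    then show ?case using assms(2) by (auto simp: mk_symmetric_def)
  qed simp
qed

text \<open>Write \<open>z = g ^ i\<close> with a generator \<open>g\<close>. From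
  \<open>g ^ (i * l) = 1\<close> it follows that \<open>l * e\<close> divides \<open>i * l\<close>,
  hence \<open>e\<close> divides \<open>i\<close>.\<close>

lemma surj_power_roots_of_unity:
  fixes z :: "'a::{finite,field}"
  assumes e: "CARD('a) - 1 = l * e" and z: "z ^ l = 1"
  obtains x where "x \<noteq> 0" "x ^ e = z"
proof -
  define N where "N = CARD('a) - 1"
  have N: "N = l * e" "N > 0" unfolding N_def using e one_less_card_field[where 'a = 'a] by linarith+
  obtain g :: 'a where g0: "g \<noteq> 0" and g: "bij_betw (\<lambda>i. g ^ i) {..<N} (UNIV - {0})"
    unfolding N_def by (rule finite_field_generator)
  have "l > 0" using N by (auto intro: Nat.gr0I)
  then have "z \<noteq> 0" using z by (auto simp: zero_power)
  then obtain i where i: "z = g ^ i" using g by (auto simp: bij_betw_def)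
  have "g ^ (i * l) = 1" using z by (simp add: i power_mult)
  moreover have "g ^ (i * l) = g ^ (N * ((i * l) div N) + (i * l) mod N)" by simp
  then have "g ^ (i * l) = g ^ ((i * l) mod N)"
    by (simp only: power_add power_mult[of g "CARD('a) - 1"] N_def finite_field_power_card_minus_1[OF g0] power_one mult_1)
  ultimately have "g ^ ((i * l) mod N) = g ^ 0" by simp
  then have "(i * l) mod N = 0"
    using g N(2) by (intro inj_onD[of "\<lambda>i. g ^ i" "{..<N}"]) (auto simp: bij_betw_def)
  then have "e dvd i" using \<open>l > 0\<close> N(1) by (auto simp: mod_eq_0_iff_dvd mult.commute)
  then obtain j where "i = e * j" ..
  then have "(g ^ j) ^ e = z" by (simp add: i power_mult [symmetric] mult.commute)
  then show ?thesis using g0 by (intro that[of "g ^ j"]) auto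
qed

lemma dvd_card_connected_components:
  fixes h :: "'k::field \<Rightarrow> 'l::{finite,field}"
  assumes e: "CARD('l) - 1 = l * e"
    and power: "\<And>\<beta>. \<beta> \<in> connection_set h d \<alpha> \<Longrightarrow> \<beta> ^ e = 1"
  shows "l dvd card (connected_components (with_proj (cayley_digraph h d \<alpha>)))"
proof -
  define G where "G = with_proj (cayley_digraph h d \<alpha>)"
  interpret G: wf_digraph G unfolding G_def by (rule wf_cayley_digraph)
  have G_simps: "verts G = {\<beta>. \<beta> \<noteq> 0}" "tail G = fst" "head G = snd"
    "arcs G = {(x, y). x \<noteq> 0 \<and> y \<noteq> 0 \<and> y / x \<in> connection_set h d \<alpha>}"
    by (simp_all add: G_def cayley_digraph_def)
  let ?CC = "connected_components G"
  have scale_G: "scale_digraph c G = G" if "c \<noteq> 0" for c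
  proof (rule pre_digraph.equality)
    have "x \<in> (*) c ` verts G" if "x \<in> verts G" for x
      using that \<open>c \<noteq> 0\<close> by (intro image_eqI[of _ _ "x / c"]) (auto simp: G_simps)
    then show "verts (scale_digraph c G) = verts G" using \<open>c \<noteq> 0\<close> by (auto simp: G_simps)
    have "a \<in> map_prod ((*) c) ((*) c) ` arcs G" if "a \<in> arcs G" for a
      using that \<open>c \<noteq> 0\<close>
      by (intro image_eqI[of _ _ "(fst a / c, snd a / c)"]) (auto simp: G_simps)
    then show "arcs (scale_digraph c G) = arcs G" using \<open>c \<noteq> 0\<close> by (auto simp: G_simps)
  qed (simp_all add: G_simps)
  have CC: "subgraph H G" "tail H = fst" "head H = snd" "Digraph_Component.connected H" if "H \<in> ?CC" for H
    using that by (auto simp: connected_components_def G.max_subgraph_def subgraph_def compatible_def G_simps)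
  have tails: "tail K = fst" "head K = snd" if "subgraph H K" "tail H = fst" "head H = snd" for H K :: "('l, 'l \<times> 'l) pre_digraph"
    using that by (auto simp: subgraph_def compatible_def)
  \<comment> \<open>Maximality is pulled back: a larger connected subgraph around the scaled
    component, scaled by \<open>inverse c\<close>, would properly contain \<open>H\<close>.\<close>
  have scale_CC: "scale_digraph c H \<in> ?CC" if c: "c \<noteq> 0" and H: "H \<in> ?CC" for c H
    unfolding connected_components_def mem_Collect_eq G.max_subgraph_def
  proof (intro conjI allI impI notI)
    show "subgraph (scale_digraph c H) G"
      using subgraph_scale_digraph[OF CC(1)[OF H], of c] by (simp add: scale_G[OF c] G_simps)
    show "Digraph_Component.connected (scale_digraph c H)"
      by (rule connected_scale_digraph[OF CC(4)[OF H] CC(2)[OF H] CC(3)[OF H]])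
    fix H' assume H': "H' \<noteq> scale_digraph c H \<and> subgraph (scale_digraph c H) H'"
      "subgraph H' G \<and> Digraph_Component.connected H'"
    have t: "tail H' = fst" "head H' = snd" using tails[of "scale_digraph c H" H'] H' by auto
    let ?K = "scale_digraph (inverse c) H'"
    have "scale_digraph (inverse c) (scale_digraph c H) = H"
      by (rule scale_digraph_inverse[OF c CC(2)[OF H] CC(3)[OF H]])
    then have "subgraph H ?K"
      using subgraph_scale_digraph[of "scale_digraph c H" H' "inverse c"] H' t by simp
    moreover have "subgraph ?K G"
      using subgraph_scale_digraph[of H' G "inverse c"] H' c by (simp add: scale_G G_simps)
    moreover have "Digraph_Component.connected ?K"
      using H' t by (intro connected_scale_digraph) auto
    moreover have "?K \<noteq> H"
    proof
      assume "?K = H"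
      then have "scale_digraph (inverse (inverse c)) ?K = scale_digraph c H" by simp
      then show False using scale_digraph_inverse[of "inverse c" H'] c t H' by simp
    qed
    ultimately show False using H by (auto simp: connected_components_def G.max_subgraph_def)
  qed
  define cls where "cls = (\<lambda>H :: ('l, 'l \<times> 'l) pre_digraph. (SOME x. x \<in> verts H) ^ e)"
  have cls: "x ^ e = cls H" if H: "H \<in> ?CC" and x: "x \<in> verts H" for H x
  proof -
    have "(SOME x. x \<in> verts H) \<in> verts H" using x by (rule someI)
    moreover have "tail H a ^ e = head H a ^ e" if a: "a \<in> arcs H" for a
    proof -
      have "a \<in> arcs G" using CC(1)[OF H] a by (auto simp: subgraph_def)
      then have "fst a \<noteq> 0" "(snd a / fst a) ^ e = 1" using power by (auto simp: G_simps)
      then show ?thesis by (simp add: CC(2)[OF H] CC(3)[OF H] power_divide)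
    qed
    ultimately show ?thesis
      unfolding cls_def using connected_constant[OF CC(4)[OF H], of "\<lambda>x. x ^ e"] x by blast
  qed
  have nonempty: "\<exists>x. x \<in> verts H \<and> x \<noteq> 0" if "H \<in> ?CC" for H
  proof -
    have "verts H \<noteq> {}"
      using CC(4)[OF that] by (auto simp: Digraph_Component.connected_def strongly_connected_def mk_symmetric_def)
    moreover have "verts H \<subseteq> verts G" using CC(1)[OF that] by (simp add: subgraph_def)
    ultimately show ?thesis by (auto simp: G_simps)
  qed
  have cls_scale: "cls (scale_digraph c H) = c ^ e * cls H" if c: "c \<noteq> 0" and H: "H \<in> ?CC" for c H
  proof -
    obtain x where x: "x \<in> verts H" using nonempty[OF H] by blast
    have "(c * x) ^ e = cls (scale_digraph c H)"
      by (rule cls[OF scale_CC[OF c H]]) (use imageI[OF x, of "(*) c"] in simp)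
    then show ?thesis by (simp add: power_mult_distrib cls[OF H x])
  qed
  let ?U = "{z::'l. z ^ l = 1}"
  have clsU: "cls H \<in> ?U" if H: "H \<in> ?CC" for H
  proof -
    obtain x where x: "x \<in> verts H" "x \<noteq> 0" using nonempty[OF H] by blast
    have "x ^ (l * e) = 1" using finite_field_power_card_minus_1[OF x(2)] by (simp only: e)
    then show ?thesis by (simp add: cls[OF H x(1), symmetric] power_mult [symmetric] mult.commute)
  qed
  \<comment> \<open>A component is determined by its vertex and arc sets because tail and head are
    fixed. Without finiteness neither the sum over fibres nor the comparison of fibre sizes would
    count anything.\<close>
  have fin: "finite ?CC"
  proof (rule finite_subset)
    show "?CC \<subseteq> (\<lambda>(V, A). \<lparr>verts = V, arcs = A, tail = fst, head = snd\<rparr>) ` (UNIV \<times> UNIV)"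
    proof
      fix H assume H: "H \<in> ?CC"
      show "H \<in> (\<lambda>(V, A). \<lparr>verts = V, arcs = A, tail = fst, head = snd\<rparr>) ` (UNIV \<times> UNIV)"
      proof (rule image_eqI)
        show "H = (case (verts H, arcs H) of (V, A) \<Rightarrow> \<lparr>verts = V, arcs = A, tail = fst, head = snd\<rparr>)"
          unfolding prod.case by (rule pre_digraph.equality) (simp_all add: CC(2)[OF H] CC(3)[OF H])
      qed simp
    qed
  qed simp
  let ?F = "\<lambda>z. {H \<in> ?CC. cls H = z}"
  \<comment> \<open>Scaling by some \<open>c\<close> with \<open>c ^ e = z' / z\<close> maps one
    fibre injectively into the other; as \<open>z\<close> and \<open>z'\<close> are arbitrary,
    equality of all fibre sizes follows.\<close>
  have le: "card (?F z) \<le> card (?F z')" if z: "z \<in> ?U" "z' \<in> ?U" for z z'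
  proof -
    have "l > 0" using e one_less_card_field[where 'a = 'l] by (auto intro: Nat.gr0I)
    then have "z \<noteq> 0" using z by (auto simp: zero_power)
    have "(z' / z) ^ l = 1" using z by (simp add: power_divide)
    then obtain c where c: "c \<noteq> 0" "c ^ e = z' / z" by (rule surj_power_roots_of_unity[OF e])
    have "inj_on (scale_digraph c) (?F z)"
      by (rule inj_on_inverseI[where g = "scale_digraph (inverse c)"])
         (use c CC in \<open>auto intro: scale_digraph_inverse\<close>)
    moreover have "scale_digraph c ` ?F z \<subseteq> ?F z'"
      using c \<open>z \<noteq> 0\<close> by (auto simp: scale_CC cls_scale)
    ultimately show ?thesis using fin by (intro card_inj_on_le) auto
  qed
  have "card ?CC = (\<Sum>z\<in>?U. card (?F z))"
    using sum.group[OF fin, of ?U cls "\<lambda>_. 1::nat"] clsU by (simp add: image_subset_iff)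
  also have "\<dots> = (\<Sum>z\<in>?U. card (?F 1))"
    by (intro sum.cong refl antisym le) auto
  also have "\<dots> = l * card (?F 1)"
    using card_roots_of_unity[where 'a = 'l, of l] e by simp
  finally show ?thesis unfolding G_def by simp
qed

subsection \<open>Numerical estimates\<close>

text \<open>
  Write \<open>s = sqrt CARD('l)\<close>. The factor \<open>31/30\<close> pays for rounding \<open>M = \<lfloor>s / sqrt l\<rfloor>\<close> with
  \<open>s / sqrt l \<ge> 31\<close>. The constant \<open>649/400 = (1 + 2 * 7/25) + 1/16\<close> collects the elements of smaller
  degree, at most \<open>s + 2 * CARD('l) powr (1/3) \<le> 39/25 * s\<close> in number, and the bound \<open>D \<le> s / 16\<close>.
\<close>

lemma main_term_bound_step:
  fixes l c D D0 \<kappa> :: real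
  assumes "sqrt l \<le> c" "0 \<le> D0" "D0 \<le> D" "0 \<le> \<kappa>" "31/15 * c * \<kappa> \<le> l"
    and "31/30 * c * (1 + 2 * \<kappa> * D0) + 649/400 < D0 * l"
  shows "31/30 * sqrt l * (1 + 2 * \<kappa> * D) + 649/400 < D * l"
proof -
  have "31/30 * sqrt l * (1 + 2 * \<kappa> * D) \<le> 31/30 * c * (1 + 2 * \<kappa> * D)"
    using assms by (intro mult_right_mono add_nonneg_nonneg mult_nonneg_nonneg) auto
  also have "\<dots> = 31/30 * c * (1 + 2 * \<kappa> * D0) + (31/15 * c * \<kappa>) * (D - D0)"
    by (simp add: field_simps)
  also have "\<dots> \<le> 31/30 * c * (1 + 2 * \<kappa> * D0) + l * (D - D0)"
    using assms by (intro add_left_mono mult_right_mono) auto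
  finally show ?thesis using assms(6) by (simp add: algebra_simps)
qed

lemma main_term_bound:
  fixes l :: nat and D :: real
  assumes l: "l \<ge> 2" and D: "D \<ge> 2" "l \<le> 4 \<Longrightarrow> D \<ge> 3"
  shows "31/30 * sqrt (real l) * (1 + 2 * (1 - 1 / real l)\<^sup>2 * D) + 649/400 < D * real l"
proof (cases "l \<ge> 9")
  case True
  have s: "sqrt (real l) \<ge> 3"
    using True real_sqrt_le_mono[of 9 "real l"] by simp
  have sq: "real l = sqrt (real l) * sqrt (real l)" by simp
  have \<kappa>: "(1 - 1 / real l)\<^sup>2 \<le> 1"
    using l by (intro power_le_one) auto
  show ?thesis
  proof (rule main_term_bound_step[where c = "sqrt (real l)" and ?D0.0 = 2])
    have "31/15 * sqrt (real l) * (1 - 1 / real l)\<^sup>2 \<le> 31/15 * sqrt (real l) * 1"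
      using \<kappa> by (intro mult_left_mono) auto
    also have "\<dots> \<le> sqrt (real l) * sqrt (real l)"
      using mult_right_mono[OF s, of "sqrt (real l)"] by simp
    finally show "31/15 * sqrt (real l) * (1 - 1 / real l)\<^sup>2 \<le> real l" by simp
    have "31/30 * sqrt (real l) * (1 + 2 * (1 - 1 / real l)\<^sup>2 * 2) \<le> 31/30 * sqrt (real l) * 5"
      using \<kappa> by (intro mult_left_mono) auto
    moreover have "31/30 * sqrt (real l) * 5 + 649/400 < 2 * (sqrt (real l) * sqrt (real l))"
      using mult_right_mono[OF s, of "sqrt (real l)"] s by linarith
    ultimately show "31/30 * sqrt (real l) * (1 + 2 * (1 - 1 / real l)\<^sup>2 * 2) + 649/400 < 2 * real l"
      by simp
  qed (use D in auto)
next
  case False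
  with l consider "l = 2" | "l = 3" | "l = 4" | "l = 5" | "l = 6" | "l = 7" | "l = 8" by linarith
  then show ?thesis
  proof cases
    case 1
    have "sqrt (real 2) \<le> 283/200" by (rule real_le_lsqrt) (simp_all add: power2_eq_square)
    from main_term_bound_step[OF this, of 3 D "(1 - 1 / real 2)\<^sup>2"] show ?thesis unfolding 1
      using D 1 by (simp add: power2_eq_square)
  next
    case 2
    have "sqrt (real 3) \<le> 8661/5000" by (rule real_le_lsqrt) (simp_all add: power2_eq_square)
    from main_term_bound_step[OF this, of 3 D "(1 - 1 / real 3)\<^sup>2"] show ?thesis unfolding 2
      using D 2 by (simp add: power2_eq_square)
  next
    case 3
    have "sqrt (real 4) \<le> 2" by (rule real_le_lsqrt) (simp_all add: power2_eq_square)
    from main_term_bound_step[OF this, of 3 D "(1 - 1 / real 4)\<^sup>2"] show ?thesis unfolding 3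
      using D 3 by (simp add: power2_eq_square)
  next
    case 4
    have "sqrt (real 5) \<le> 22361/10000" by (rule real_le_lsqrt) (simp_all add: power2_eq_square)
    from main_term_bound_step[OF this, of 2 D "(1 - 1 / real 5)\<^sup>2"] show ?thesis unfolding 4
      using D 4 by (simp add: power2_eq_square)
  next
    case 5
    have "sqrt (real 6) \<le> 49/20" by (rule real_le_lsqrt) (simp_all add: power2_eq_square)
    from main_term_bound_step[OF this, of 2 D "(1 - 1 / real 6)\<^sup>2"] show ?thesis unfolding 5
      using D 5 by (simp add: power2_eq_square)
  next
    case 6
    have "sqrt (real 7) \<le> 53/20" by (rule real_le_lsqrt) (simp_all add: power2_eq_square)
    from main_term_bound_step[OF this, of 2 D "(1 - 1 / real 7)\<^sup>2"] show ?thesis unfolding 6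
      using D 6 by (simp add: power2_eq_square)
  next
    case 7
    have "sqrt (real 8) \<le> 2829/1000" by (rule real_le_lsqrt) (simp_all add: power2_eq_square)
    from main_term_bound_step[OF this, of 2 D "(1 - 1 / real 8)\<^sup>2"] show ?thesis unfolding 7
      using D 7 by (simp add: power2_eq_square)
  qed
qed

lemma main_inequality:
  fixes s W D M L :: real and l :: nat
  assumes l: "l \<ge> 2" and W: "W > 0" "16 \<le> W * real l" and s: "s \<ge> D * W * real l"
    and s31: "s \<ge> 31 * sqrt (real l)" and D: "D > 0"
    and M: "M \<ge> s / sqrt (real l) - 1" and L: "L \<le> 39/25 * s"
    and main: "31/30 * sqrt (real l) * (1 + 2 * (1 - 1 / real l)\<^sup>2 * D) + 649/400 < s / W"
  shows "W * L < s\<^sup>2 - W * (D + s\<^sup>2 / M * (1 + 2 * (1 - 1 / real l)\<^sup>2 * D))"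
proof -
  define r where "r = sqrt (real l)"
  define A where "A = 1 + 2 * (1 - 1 / real l)\<^sup>2 * D"
  have r: "r > 0" using l by (simp add: r_def)
  have A: "A \<ge> 0" using D by (simp add: A_def)
  have "31 * r \<le> s" using s31 by (simp add: r_def)
  then have s0: "s > 0" using r by linarith
  have "31 \<le> s / r" using \<open>31 * r \<le> s\<close> r by (simp add: pos_le_divide_eq)
  then have M1: "M \<ge> 30/31 * (s / r)" using M unfolding r_def[symmetric] by linarith
  have "30/31 * (s / r) > 0" using s0 r by simp
  then have M0: "M > 0" using M1 by linarith
  have "s\<^sup>2 / M \<le> s\<^sup>2 / (30/31 * (s / r))"
    by (rule frac_le[OF _ order_refl \<open>30/31 * (s / r) > 0\<close> M1]) simp
  also have "\<dots> = 31/30 * s * r" using s0 r by (simp add: field_simps power2_eq_square)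
  finally have "s\<^sup>2 / M * A \<le> 31/30 * s * r * A" using A by (rule mult_right_mono)
  moreover have "D \<le> s / 16"
  proof -
    have "D * 16 \<le> D * (W * real l)" using W D by (intro mult_left_mono) auto
    then show ?thesis using s by (simp add: mult_ac)
  qed
  ultimately have "L + (D + s\<^sup>2 / M * A) \<le> s * (31/30 * r * A + 649/400)"
    using L by (simp add: algebra_simps)
  also have "\<dots> < s * (s / W)"
    using main s0 unfolding r_def[symmetric] A_def[symmetric] by (intro mult_strict_left_mono) auto
  finally have "W * (L + (D + s\<^sup>2 / M * A)) < W * (s * (s / W))"
    using W(1) by (rule mult_strict_left_mono)
  also have "W * (s * (s / W)) = s\<^sup>2" using W(1) by (simp add: power2_eq_square)
  finally have "W * L + W * (D + s\<^sup>2 / M * A) < s\<^sup>2" by (simp only: distrib_left)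
  then show ?thesis unfolding A_def[symmetric] by linarith
qed

lemma cube_root_bound:
  fixes c s :: real
  assumes "c \<ge> 0" "c ^ 3 \<le> s\<^sup>2" "s \<ge> 48"
  shows "c \<le> 7/25 * s"
proof (rule ccontr)
  assume "\<not> c \<le> 7/25 * s"
  then have "(7/25 * s) ^ 3 < c ^ 3" using assms by (intro power_strict_mono) auto
  also have "c ^ 3 \<le> s\<^sup>2" by (rule assms(2))
  also have "s\<^sup>2 = s\<^sup>2 * 1" by simp
  \<comment> \<open>\<open>(7/25) ^ 3 * 48 = 16464/15625\<close>, just above 1; this is the origin
    of \<open>7/25\<close>.\<close>
  also have "\<dots> \<le> s\<^sup>2 * ((7/25) ^ 3 * s)"
    using assms(3) by (intro mult_left_mono) (auto simp: power3_eq_cube)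
  also have "\<dots> = (7/25 * s) ^ 3" by (simp add: power2_eq_square power3_eq_cube)
  finally show False by simp
qed

section \<open>Existence of the element by counting\<close>

theorem theorem9:
  fixes h :: "'k::{finite,field} \<Rightarrow> 'l::{finite,field}"
    and n d l :: nat
  assumes "field_hom h"
    and "CARD('l) = CARD('k) ^ n"
    and "n > 1"
    and "1 \<le> d" and "d < n"
    and "l > 1" and "l dvd CARD('k) ^ n - 1"
    and "real n \<ge> 2 * real d
           + 2 * (real (card (monic_primary_polys d :: 'k poly set)) + 1) * log (real CARD('k)) (real l)"
  shows "\<exists>\<alpha> :: 'l. has_degree_over h \<alpha> n \<and>
           l dvd card (connected_components (with_proj (cayley_digraph h d \<alpha>)))"
proof -
  interpret field_hom h by (rule assms(1))
  interpret finite_field_extension h n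
    by unfold_locales (use assms in auto)
  define q where "q = CARD('k)"
  define N where "N = card (monic_primary_polys d :: 'k poly set)"
  define D where "D = real (q ^ d)"
  define W where "W = real (l ^ N)"
  define s where "s = sqrt (real CARD('l))"
  have l2: "l \<ge> 2" and d0: "d > 0" using assms by auto
  have q2: "q \<ge> 2" using one_less_card_field[where 'a = 'k] by (simp add: q_def)
  obtain e where e: "CARD('l) - 1 = l * e" using assms(2,7) by (auto elim: dvdE)
  have s2: "s\<^sup>2 = real CARD('l)" by (simp add: s_def)
  have Nq: "q \<le> N" unfolding N_def q_def using assms(4) by (rule card_monic_primary_polys_ge)
  have qD: "q \<le> q ^ d" using q2 d0 by (simp add: self_le_power)
  have W0: "W > 0" using l2 by (simp add: W_def)
  have D2: "D \<ge> 2"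
  proof -
    have "2 \<le> q ^ d" using q2 qD by linarith
    then have "real 2 \<le> D" unfolding D_def by (subst of_nat_le_iff)
    then show ?thesis by simp
  qed
  have Wl: "W * real l = real (l ^ Suc N)" by (simp add: W_def)
  \<comment> \<open>The hypothesis on \<open>n\<close>, raised as an exponent of \<open>q\<close>:
    the summand \<open>2 * d\<close> becomes \<open>D^2\<close>, the logarithmic term becomes
    \<open>(W * l)^2\<close>.\<close>
  have square: "(D * W * real l)\<^sup>2 \<le> real CARD('l)"
  proof -
    have "(D * W * real l)\<^sup>2 = real q powr (2 * real d) * real l powr (2 * (real N + 1))"
    proof -
      have "D * W * real l = real q ^ d * real l ^ Suc N" by (simp add: D_def W_def)
      then have "(D * W * real l)\<^sup>2 = real q ^ (2 * d) * real l ^ (2 * Suc N)"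
        by (simp only: power_mult_distrib power_even_eq)
      also have "real q ^ (2 * d) = real q powr (2 * real d)"
        using q2 by (subst powr_realpow [symmetric]) auto
      also have "real l ^ (2 * Suc N) = real l powr (2 * (real N + 1))"
        using l2 by (subst powr_realpow [symmetric]) (auto simp: algebra_simps)
      finally show ?thesis .
    qed
    also have "real l powr (2 * (real N + 1)) = real q powr (log (real q) (real l) * (2 * (real N + 1)))"
      using q2 l2 by (simp add: powr_powr [symmetric])
    also have "real q powr (2 * real d) * \<dots> = real q powr (2 * real d + 2 * (real N + 1) * log (real q) (real l))"
      by (simp add: powr_add [symmetric] mult_ac)
    also have "\<dots> \<le> real q powr real n"
      using assms(8) q2 unfolding N_def q_def by (intro powr_mono) auto
    also have "\<dots> = real CARD('l)"
      using q2 assms(2) by (simp add: powr_realpow q_def)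
    finally show ?thesis .
  qed
  then have sDWl: "D * W * real l \<le> s" unfolding s_def by (rule real_le_rsqrt)
  \<comment> \<open>For \<open>q = 2\<close> the number \<open>q ^ n - 1\<close> is odd. Even
    \<open>l\<close> therefore come with \<open>D \<ge> 3\<close>, as \<open>main_term_bound\<close>
    demands for \<open>l\<close> = 2 and 4.\<close>
  have q3: "q \<ge> 3" if "even l"
  proof (rule ccontr)
    assume "\<not> q \<ge> 3"
    then have "q = 2" using q2 by simp
    then have "odd (CARD('k) ^ n - 1)" using assms(3) by (simp add: q_def)
    then show False using assms(7) that by (metis dvd_trans)
  qed
  have cube: "D * real l ^ 3 \<le> s"
  proof -
    have "real l ^ 3 \<le> real l ^ Suc N" using l2 Nq q2 by (intro power_increasing) auto
    then have "D * real l ^ 3 \<le> D * (W * real l)" using D2 unfolding Wl by (intro mult_left_mono) auto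
    then show ?thesis using sDWl by (simp add: mult_ac)
  qed
  have small: "16 \<le> W * real l" "48 \<le> s" "31 * sqrt (real l) \<le> s"
  proof -
    have "16 \<le> W * real l \<and> 48 \<le> s \<and> 31 * sqrt (real l) \<le> s"
    \<comment> \<open>For \<open>l = 2\<close>, \<open>N \<ge> q \<ge> 3\<close> gives
      \<open>W * l \<ge> 2 ^ 4\<close> and \<open>s \<ge> 3 * 16\<close>. For larger
      \<open>l\<close>, \<open>N \<ge> 2\<close> gives \<open>W * l \<ge> 3 ^ 3\<close> and
      \<open>s \<ge> 2 * 27\<close>.\<close>
    proof (cases "l = 2")
      case True
      then have "q \<ge> 3" using q3 by simp
      then have "2 ^ 4 \<le> (2::nat) ^ Suc N" using Nq by (intro power_increasing) auto
      then have "real (2 ^ 4) \<le> real (2 ^ Suc N)" by (simp only: of_nat_le_iff)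
      then have W16: "16 \<le> W * real l" unfolding Wl by (simp only: True) simp
      have "3 \<le> q ^ d" using \<open>q \<ge> 3\<close> qD by linarith
      then have "real 3 \<le> D" unfolding D_def by (subst of_nat_le_iff)
      then have "3 * 16 \<le> D * (W * real l)" using W16 by (intro mult_mono) auto
      then have s48: "48 \<le> s" using sDWl by (simp add: mult_ac)
      have "sqrt (real 2) \<le> 283/200" by (rule real_le_lsqrt) (simp_all add: power2_eq_square)
      then have "31 * sqrt (real l) \<le> s" using s48 True by simp
      with W16 s48 show ?thesis by simp
    next
      case False
      then have l3: "l \<ge> 3" using l2 by simp
      have "3 ^ 3 \<le> l ^ 3" using l3 by (rule power_mono) simp
      moreover have "l ^ 3 \<le> l ^ Suc N" using l3 Nq q2 by (intro power_increasing) auto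
      ultimately have "27 \<le> l ^ Suc N" by simp
      then have "real 27 \<le> real (l ^ Suc N)" by (subst of_nat_le_iff)
      then have W27: "27 \<le> W * real l" unfolding Wl by simp
      have "2 * 27 \<le> D * (W * real l)" using W27 D2 by (intro mult_mono) auto
      then have s54: "54 \<le> s" using sDWl by (simp add: mult_ac)
      have "31 * sqrt (real l) \<le> 2 * real l ^ 3"
      proof (rule power2_le_imp_le)
        \<comment> \<open>Enough because \<open>4 * 3 ^ 5 = 972\<close> exceeds
          \<open>31 ^ 2 = 961\<close>.\<close>
        have "3 ^ 5 \<le> l ^ 5" using l3 by (rule power_mono) simp
        then have "real (3 ^ 5) \<le> real (l ^ 5)" by (simp only: of_nat_le_iff)
        then have "243 * real l \<le> real l ^ 5 * real l" by (intro mult_right_mono) auto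
        then have "961 * real l \<le> 4 * (real l ^ 5 * real l)" by linarith
        then show "(31 * sqrt (real l))\<^sup>2 \<le> (2 * real l ^ 3)\<^sup>2"
          by (simp add: power_mult_distrib flip: power_mult) (simp add: power_Suc2 eval_nat_numeral mult_ac)
      qed simp
      also have "\<dots> \<le> D * real l ^ 3" using D2 by (intro mult_right_mono) auto
      also note cube
      finally show ?thesis using W27 s54 by simp
    qed
    then show "16 \<le> W * real l" "48 \<le> s" "31 * sqrt (real l) \<le> s" by auto
  qed
  \<comment> \<open>The largest \<open>M\<close> with \<open>l * M^2 \<le> Q\<close>; the error term
    decreases in \<open>M\<close>.\<close>
  define M where "M = nat \<lfloor>s / sqrt (real l)\<rfloor>"
  have s0: "s > 0" using small by linarith
  have r0: "sqrt (real l) > 0" using l2 by simp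
  have "s / sqrt (real l) \<ge> 0" using s0 r0 by simp
  then have M_le: "real M \<le> s / sqrt (real l)" and M_gt: "s / sqrt (real l) < real M + 1"
    unfolding M_def by linarith+
  have M2: "l * M\<^sup>2 \<le> CARD('l)"
  proof -
    have "real (l * M\<^sup>2) = real l * (real M)\<^sup>2" by simp
    also have "\<dots> \<le> real l * (s / sqrt (real l))\<^sup>2"
      using M_le by (intro mult_left_mono power_mono) auto
    also have "\<dots> = real CARD('l)" using l2 by (simp add: power_divide s2)
    finally show ?thesis by (simp only: of_nat_le_iff)
  qed
  have M1: "l\<^sup>2 * CARD('k) ^ d < M"
  proof -
    \<comment> \<open>The surplus \<open>2/5 * l^2 * D\<close> is at least \<open>16/5\<close> and
      so covers the loss of less than 1 in rounding \<open>M\<close> down.\<close>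
    have "7/5 \<le> sqrt (real l)" using l2 by (intro real_le_rsqrt) (auto simp: power2_eq_square)
    then have "7/5 * ((real l)\<^sup>2 * D) \<le> sqrt (real l) * ((real l)\<^sup>2 * D)"
      using D2 by (intro mult_right_mono) auto
    also have "\<dots> \<le> s / sqrt (real l)"
    proof -
      have "sqrt (real l) * ((real l)\<^sup>2 * D) * sqrt (real l) = D * real l ^ 3"
        by (simp add: power2_eq_square power3_eq_cube mult_ac)
      then show ?thesis using cube by (simp only: pos_le_divide_eq[OF r0])
    qed
    finally have "7/5 * ((real l)\<^sup>2 * D) < real M + 1" using M_gt by linarith
    moreover have "2\<^sup>2 * 2 \<le> (real l)\<^sup>2 * D"
      using l2 D2 by (intro mult_mono power_mono) auto
    ultimately have "(real l)\<^sup>2 * D < real M" by simp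
    then have "real (l\<^sup>2 * CARD('k) ^ d) < real M" by (simp add: D_def q_def)
    then show ?thesis by (simp only: of_nat_less_iff)
  qed
  have main: "31/30 * sqrt (real l) * (1 + 2 * (1 - 1 / real l)\<^sup>2 * D) + 649/400 < s / W"
  \<comment> \<open>In this case \<open>D * l = 6\<close> is too small a lower bound for
    \<open>s / W\<close>. Here \<open>q = 2\<close>, \<open>d = 1\<close> and \<open>W = 9\<close>,
    and \<open>Q\<close> is a power of 2 that is at least \<open>54^2 = 2916\<close>, so
    \<open>s\<close> is at least 64 instead of 54.\<close>
  proof (cases "l = 3 \<and> D = 2")
    case True
    then have qd: "q ^ d = 2" by (simp add: D_def) (metis of_nat_eq_iff of_nat_numeral of_nat_power)
    then have "q = 2" using q2 qD by simp
    then have "N \<le> 2" using card_monic_primary_polys_le[of d] qd by (simp add: N_def q_def)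
    then have "N = 2" using Nq \<open>q = 2\<close> by simp
    then have W9: "W = 9" using True by (simp add: W_def)
    have "n \<ge> 12"
    proof (rule ccontr)
      assume "\<not> n \<ge> 12"
      then have "(2::nat) ^ n \<le> 2 ^ 11" by (intro power_increasing) auto
      then have "CARD('l) \<le> 2048" using assms(2) \<open>q = 2\<close> by (simp add: q_def)
      then have "real CARD('l) \<le> 2048" by simp
      then show False using square True W9 by simp
    qed
    then have "(2::nat) ^ 12 \<le> 2 ^ n" by (intro power_increasing) auto
    then have "4096 \<le> CARD('l)" using assms(2) \<open>q = 2\<close> by (simp add: q_def)
    then have "64\<^sup>2 \<le> real CARD('l)" by simp
    then have s64: "64 \<le> s" unfolding s_def by (rule real_le_rsqrt)
    have "sqrt (real 3) \<le> 8661/5000" by (rule real_le_lsqrt) (simp_all add: power2_eq_square)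
    then show ?thesis using True W9 s64 by (simp add: power2_eq_square)
  next
    case False
    have "D \<ge> 3" if "l \<le> 4"
    proof -
      have "q ^ d \<ge> 3"
      proof (cases "l = 3")
        case True
        then have "D \<noteq> 2" using False by simp
        then have "q ^ d \<noteq> 2" by (auto simp: D_def simp del: of_nat_power)
        then show ?thesis using q2 qD by linarith
      next
        case False
        then have "l = 2 \<or> l = 4" using that l2 by linarith
        then have "even l" by auto
        then show ?thesis using q3 qD by linarith
      qed
      then have "real 3 \<le> D" unfolding D_def by (subst of_nat_le_iff)
      then show ?thesis by simp
    qed
    from main_term_bound[OF l2 D2 this]
    have "31/30 * sqrt (real l) * (1 + 2 * (1 - 1 / real l)\<^sup>2 * D) + 649/400 < D * real l" .
    also have "\<dots> \<le> s / W" using sDWl W0 by (simp add: pos_le_divide_eq mult_ac)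
    finally show ?thesis .
  qed
  define low where "low = card {\<alpha>. \<not> has_degree_over h \<alpha> n}"
  have low: "real low \<le> 39/25 * s"
  proof -
    have "real (q ^ (n div 3)) \<le> 7/25 * s"
    proof (rule cube_root_bound)
      have "q ^ (3 * (n div 3)) \<le> q ^ n" using q2 by (intro power_increasing) auto
      then have "real (q ^ (n div 3 * 3)) \<le> real (q ^ n)" by (simp only: of_nat_le_iff mult.commute)
      then show "real (q ^ (n div 3)) ^ 3 \<le> s\<^sup>2"
        unfolding s2 assms(2) by (simp add: q_def power_mult)
    qed (use small in auto)
    then show ?thesis using card_lower_degree_le by (simp add: low_def s_def q_def)
  qed
  define good where "good = {x. \<forall>p\<in>monic_primary_polys d. poly (residue_poly p) x ^ e = 1}"
  have "W * real low < s\<^sup>2 - W * (D + s\<^sup>2 / real M * (1 + 2 * (1 - 1 / real l)\<^sup>2 * D))"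
    by (rule main_inequality[OF l2 W0 small(1) sDWl small(3) _ _ low main]) (use D2 M_gt in auto)
  also have "\<dots> \<le> W * real (card good)"
    using residue_count_ge[OF l2 e d0 M1 M2]
    by (simp only: s2 D_def W_def N_def q_def good_def)
  finally have "low < card good" using W0 by simp
  then have "\<not> good \<subseteq> {\<alpha>. \<not> has_degree_over h \<alpha> n}"
    unfolding low_def by (metis card_mono finite not_less)
  then obtain \<alpha> where \<alpha>: "\<alpha> \<in> good" "has_degree_over h \<alpha> n" by blast
  have "l dvd card (connected_components (with_proj (cayley_digraph h d \<alpha>)))"
  proof (rule dvd_card_connected_components[OF e])
    fix \<beta> assume "\<beta> \<in> connection_set h d \<alpha>"
    then obtain p where p: "p \<in> monic_primary_polys d" "\<beta> = eval_over h p \<alpha>"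
      by (auto simp: connection_set_def)
    obtain k where "p = radical p ^ k" by (rule radical_power[OF p(1)])
    then have "\<beta> = poly (residue_poly p) \<alpha> ^ k"
      unfolding p(2) by (metis eval_over_def eval_simps(4) residue_poly_def)
    then have "\<beta> ^ e = (poly (residue_poly p) \<alpha> ^ e) ^ k"
      by (simp add: power_mult [symmetric] mult.commute)
    then show "\<beta> ^ e = 1" using \<alpha>(1) p(1) by (simp add: good_def)
  qed
  with \<alpha>(2) show ?thesis by blast
qed

end
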